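(* Let $0\le m\le n$ be integers, let $F,G$ be a pair of dual random functions ($F:\{0,1\}^n\to\{0,1\}^m$, $G=F^\perp:\{0,1\}^n\to\{0,1\}^{n-m}$), and let $\rho_{ABE}$ be a sub-normalized state in the standard form, where $A$ is an $n$-qubit space. Then $${\rm E}_F\,Q^{{\rm PA},F}(\rho_{Z^AE})={\rm E}_G\,Q^{{\rm EC},G}(\rho_{X^AB})={\rm E}_G\,Q^{{\rm DC},G}(\rho_{X^AB})={\rm Tr}(\rho)-{\rm E}_F\,2^{H_{\rm max}(F(Z^A)|E)_\rho-m}={\rm Tr}(\rho)-{\rm E}_G\,2^{-H_{\rm min}(X^A|B,G(X^A))_\rho}.$$
   Context: All Hilbert spaces are finite-dimensional; logarithms are base 2 (with $2^{-\infty}=0$). A sub-normalized state is a positive semidefinite operator of trace at most 1 (normalized if the trace is 1). $A=(\mathbb C^2)^{\otimes n}$ has the $z$ basis $\{|z\rangle\}_{z\in\{0,1\}^n}$ (computational basis, eigenbasis of the Pauli $\sigma_Z$'s) and the $x$ basis $\{|\tilde x\rangle\}_{x\in\{0,1\}^n}$, the product eigenbasis of the Pauli $\sigma_X$'s ($\sigma_X|\tilde x_i\rangle=(-1)^{x_i}|\tilde x_i\rangle$ on each qubit). Measured states: for a state $\rho_{AV}$, $\rho_{Z^AV}=\sum_z(|z\rangle\langle z|_A\otimes I_V)\rho_{AV}(|z\rangle\langle z|_A\otimes I_V)=\sum_z|z\rangle\langle z|_A\otimes\rho^z_V$ and $\rho_{X^AV}=\sum_x(|\tilde x\rangle\langle\tilde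 x|_A\otimes I_V)\rho_{AV}(|\tilde x\rangle\langle\tilde x|_A\otimes I_V)=\sum_x|\tilde x\rangle\langle\tilde x|_A\otimes\tilde\rho^x_V$. $\rho_{AV}$ is classical in $Z^A$ (resp. $X^A$) if $\rho_{AV}=\rho_{Z^AV}$ (resp. $\rho_{AV}=\rho_{X^AV}$). A sub-normalized tripartite state $\rho_{ABE}$ is in the standard form if it is pure (rank one) and either $\rho_{AE}={\rm Tr}_B\rho_{ABE}$ is classical in $Z^A$ or $\rho_{AB}={\rm Tr}_E\rho_{ABE}$ is classical in $X^A$. Entropies: for a sub-normalized $\rho_{UV}$, $H_{\rm min}(U|V)_\rho=-\log\min\{{\rm Tr}(\sigma):\sigma_V\ge0,\ \rho_{UV}\le I_U\otimes\sigma_V\}$ and $H_{\rm max}(U|V)_\rho=\max_{\sigma_V\ge0,{\rm Tr}\sigma=1}\log\big(|\mathcal U|\,F(\rho_{UV},|\mathcal U|^{-1}I_U\otimes\sigma_V)^2\big)$, with $|\mathcal U|$ the alphabet size of $U$ and (only in this formula) $F(\rho,\sigma)=\|\sqrt\rho\sqrt\sigma\|_1+\sqrt{(1-{\rm Tr}\rho)(1-{\rm Tr}\sigma)}$. $H_{\rm max}(f(Z^A)|E)_\rho$ is $H_{\rm max}(K|E)$ of $\rho^f_{KE}=\sum_k|k\rangle\langle k|_K\otimes\sum_{z\in f^{-1}(k)}\rho^z_E$ (alphabet $\{0,1\}^m$). $H_{\rm min}(X^A|B,g(X^A))_\rho$ is $H_{\rm min}(A|BD)$ of the state $\sum_x|\tilde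 x\rangle\langle\tilde x|_A\otimes\tilde\rho^x_B\otimes|g(x)\rangle\langle g(x)|_D$. Indices: $Q^{{\rm PA},f}(\rho_{Z^AE})={\rm Tr}(\rho_{Z^AE})-2^{H_{\rm max}(f(Z^A)|E)_\rho-m}$ (privacy amplification). Error correction with quantum side information: given $x$ and $\tilde\rho^x_B$, the receiver computes $s=g(x)$, measures $B$ by a POVM $M^s=\{M^{s,e}\}_{e\in\{0,1\}^n}$, outputs $y=x+e$, and fails if $y\ne0$: $Q^{{\rm EC},g}(\rho_{X^AB})=\min_{\{M^s\}}\sum_x\sum_{e:\,x+e\ne0}{\rm Tr}(\tilde\rho^xM^{g(x),e})$. Data compression with quantum side information: the decoder receives $s=g(x)$ and $\tilde\rho^x_B$, measures $B$ by a POVM $M^s$, outputs $x'=e$, and fails if $x'\ne x$: $Q^{{\rm DC},g}(\rho_{X^AB})=\min_{\{M^s\}}\sum_x\sum_{e\ne x}{\rm Tr}(\tilde\rho^xM^{g(x),e})$. The minima are over all families of POVMs indexed by $s\in\{0,1\}^{n-m}$. Duality: linear surjective $f:\{0,1\}^n\to\{0,1\}^m$, $g:\{0,1\}^n\to\{0,1\}^{n-m}$, given by full-rank matrices over $\mathbb F_2$ of sizes $m\times n$ and $(n-m)\times n$, are dual ($f\perp g$) if $fg^T=0$. A random function $F$ is a random variable with values in a finite set of functions, and ${\rm E}_F\,r(F)=\sum_f\Pr[F=f]\,r(f)$. A pair of random functions $F,G$ is dual ($G=F^\perp$) if they are chosen from sets $\{f_1,f_2,\dots\}$ and $\{g_1,g_2,\dots\}$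 of the same size with $f_i\perp g_i$ and $\Pr[F=f_i]=\Pr[G=g_i]$ for all $i$. *)

theory Defs
  imports
    "HOL-Probability.Probability_Mass_Function"
    "HOL-Library.Z2"
    "Jordan_Normal_Form.Schur_Decomposition"
    "Jordan_Normal_Form.DL_Rank"
begin

text \<open>
  Operators on the Hilbert space of dimension \<open>d\<close> are elements of \<^term>\<open>carrier_mat d d\<close> over the
  complex numbers. Kets are matrices with a single column, so that the Kronecker product serves
  both vectors and operators. Bit strings of length \<open>n\<close> are elements of \<^term>\<open>carrier_vec n\<close> over
  the two-element field \<^typ>\<open>bit\<close>.
\<close>


subsection \<open>Operators\<close>

definition kron :: "complex mat \<Rightarrow> complex mat \<Rightarrow> complex mat" where
  "kron P Q = mat (dim_row P * dim_row Q) (dim_col P * dim_col Q)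
     (\<lambda>(i, j). P $$ (i div dim_row Q, j div dim_col Q) * Q $$ (i mod dim_row Q, j mod dim_col Q))"

text \<open>The dimensions are explicit because \<^typ>\<open>complex mat\<close> has no dimension-independent zero.\<close>

definition op_sum :: "nat \<Rightarrow> nat \<Rightarrow> ('i \<Rightarrow> complex mat) \<Rightarrow> 'i set \<Rightarrow> complex mat" where
  "op_sum nr nc P S = mat nr nc (\<lambda>ij. \<Sum>x\<in>S. P x $$ ij)"

definition op_trace :: "complex mat \<Rightarrow> complex" where
  "op_trace P = (\<Sum>i<dim_row P. P $$ (i, i))"

text \<open>
  In the order of \<^typ>\<open>complex\<close>, \<open>0 \<le> z\<close> says that \<open>z\<close> is real and nonnegative; in particular
  positive semidefinite operators are Hermitian. The order \<open>\<le>\<close> of the matrix library is entrywise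
  and is not used; \<open>loewner_le\<close> is the operator order.
\<close>

definition psd :: "nat \<Rightarrow> complex mat \<Rightarrow> bool" where
  "psd d P \<longleftrightarrow> P \<in> carrier_mat d d \<and> (\<forall>v\<in>carrier_vec d. 0 \<le> (P *\<^sub>v v) \<bullet>c v)"

definition loewner_le :: "nat \<Rightarrow> complex mat \<Rightarrow> complex mat \<Rightarrow> bool" where
  "loewner_le d P Q \<longleftrightarrow> P \<in> carrier_mat d d \<and> Q \<in> carrier_mat d d \<and> psd d (Q - P)"

definition psd_sqrt :: "complex mat \<Rightarrow> complex mat" where
  "psd_sqrt P = (THE R. psd (dim_row P) R \<and> R * R = P)"

definition trace_norm :: "complex mat \<Rightarrow> real" where
  "trace_norm P = Re (op_trace (psd_sqrt (mat_adjoint P * P)))"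

definition sub_normalized :: "nat \<Rightarrow> complex mat \<Rightarrow> bool" where
  "sub_normalized d \<rho> \<longleftrightarrow> psd d \<rho> \<and> Re (op_trace \<rho>) \<le> 1"

definition normalized :: "nat \<Rightarrow> complex mat \<Rightarrow> bool" where
  "normalized d \<sigma> \<longleftrightarrow> psd d \<sigma> \<and> op_trace \<sigma> = 1"

definition fidelity :: "complex mat \<Rightarrow> complex mat \<Rightarrow> real" where
  "fidelity \<rho> \<sigma> = trace_norm (psd_sqrt \<rho> * psd_sqrt \<sigma>)
     + sqrt ((1 - Re (op_trace \<rho>)) * (1 - Re (op_trace \<sigma>)))"

definition basis_ket :: "nat \<Rightarrow> nat \<Rightarrow> complex mat" where
  "basis_ket d i = mat_of_cols d [unit_vec d i]"

definition ket_proj :: "complex mat \<Rightarrow> complex mat" where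
  "ket_proj \<psi> = \<psi> * mat_adjoint \<psi>"

text \<open>\<open>Tr\<^sub>B \<rho> = (\<Sum>b. (I \<otimes> \<langle>b| \<otimes> I) \<rho> (I \<otimes> |b\<rangle> \<otimes> I))\<close> for \<open>\<rho>\<close> on \<open>A \<otimes> B \<otimes> E\<close>, and
  likewise for \<open>E\<close>; \<open>dA\<close>, \<open>dB\<close>, \<open>dE\<close> are the dimensions of the three factors.\<close>

definition ptrace_B :: "nat \<Rightarrow> nat \<Rightarrow> nat \<Rightarrow> complex mat \<Rightarrow> complex mat" where
  "ptrace_B dA dB dE \<rho> = op_sum (dA * dE) (dA * dE)
     (\<lambda>b. let V = kron (kron (1\<^sub>m dA) (basis_ket dB b)) (1\<^sub>m dE) in mat_adjoint V * \<rho> * V) {..<dB}"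

definition ptrace_E :: "nat \<Rightarrow> nat \<Rightarrow> nat \<Rightarrow> complex mat \<Rightarrow> complex mat" where
  "ptrace_E dA dB dE \<rho> = op_sum (dA * dB) (dA * dB)
     (\<lambda>e. let V = kron (kron (1\<^sub>m dA) (1\<^sub>m dB)) (basis_ket dE e) in mat_adjoint V * \<rho> * V) {..<dE}"


subsection \<open>The two qubit bases and measured states\<close>

definition qubit_z :: "bit \<Rightarrow> complex mat" where
  "qubit_z c = mat_of_cols 2 [unit_vec 2 (if c = 0 then 0 else 1)]"

definition qubit_x :: "bit \<Rightarrow> complex mat" where
  "qubit_x c = mat_of_cols 2
     [vec_of_list [1 / sqrt 2, (if c = 0 then 1 else - 1) / sqrt 2]]"

definition ket_z :: "bit vec \<Rightarrow> complex mat" where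
  "ket_z z = foldr (\<lambda>c. kron (qubit_z c)) (list_of_vec z) (1\<^sub>m 1)"

definition ket_x :: "bit vec \<Rightarrow> complex mat" where
  "ket_x x = foldr (\<lambda>c. kron (qubit_x c)) (list_of_vec x) (1\<^sub>m 1)"

text \<open>
  Below, \<open>ket\<close> is one of \<^const>\<open>ket_z\<close>, \<^const>\<open>ket_x\<close> and \<open>\<rho>\<close> is an operator on \<open>A \<otimes> V\<close>, where
  \<open>A\<close> consists of \<open>n\<close> qubits and \<open>V\<close> has dimension \<open>d\<close>. The operator \<open>block ket d \<rho> u\<close> is
  \<open>\<rho>\<^sup>u = (\<langle>u| \<otimes> I) \<rho> (|u\<rangle> \<otimes> I)\<close> on \<open>V\<close>.
\<close>

definition measured :: "(bit vec \<Rightarrow> complex mat) \<Rightarrow> nat \<Rightarrow> nat \<Rightarrow> complex mat \<Rightarrow> complex mat" where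
  "measured ket n d \<rho> = op_sum (2 ^ n * d) (2 ^ n * d)
     (\<lambda>u. kron (ket_proj (ket u)) (1\<^sub>m d) * \<rho> * kron (ket_proj (ket u)) (1\<^sub>m d)) (carrier_vec n)"

definition block :: "(bit vec \<Rightarrow> complex mat) \<Rightarrow> nat \<Rightarrow> complex mat \<Rightarrow> bit vec \<Rightarrow> complex mat" where
  "block ket d \<rho> u = mat_adjoint (kron (ket u) (1\<^sub>m d)) * \<rho> * kron (ket u) (1\<^sub>m d)"

definition classical_in :: "(bit vec \<Rightarrow> complex mat) \<Rightarrow> nat \<Rightarrow> nat \<Rightarrow> complex mat \<Rightarrow> bool" where
  "classical_in ket n d \<rho> \<longleftrightarrow> \<rho> = measured ket n d \<rho>"

definition standard_form :: "nat \<Rightarrow> nat \<Rightarrow> nat \<Rightarrow> complex mat \<Rightarrow> bool" where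
  "standard_form n dB dE \<rho> \<longleftrightarrow>
     sub_normalized (2 ^ n * dB * dE) \<rho> \<and>
     vec_space.rank (2 ^ n * dB * dE) \<rho> = 1 \<and>
     (classical_in ket_z n dE (ptrace_B (2 ^ n) dB dE \<rho>) \<or>
      classical_in ket_x n dB (ptrace_E (2 ^ n) dB dE \<rho>))"


subsection \<open>Conditional entropies\<close>

definition log2_ereal :: "real \<Rightarrow> ereal" where
  "log2_ereal x = (if 0 < x then ereal (log 2 x) else - \<infinity>)"

text \<open>The value at \<open>\<infinity>\<close> is a dummy: exponents here are of the form \<open>H\<^sub>m\<^sub>a\<^sub>x - m\<close> or \<open>- H\<^sub>m\<^sub>i\<^sub>n\<close>,
  which are bounded above.\<close>

fun exp2_ereal :: "ereal \<Rightarrow> real" where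
  "exp2_ereal (ereal r) = 2 powr r"
| "exp2_ereal MInfty = 0"
| "exp2_ereal PInfty = 0"

text \<open>Both entropies condition the first factor, of dimension \<open>dU\<close>, on the second, of dimension
  \<open>dV\<close>. The minimum and the maximum over \<open>\<sigma>\<close> are attained and written as \<open>Inf\<close> and \<open>SUP\<close>; the same
  applies to the minima over POVM families further down.\<close>

definition H_min :: "nat \<Rightarrow> nat \<Rightarrow> complex mat \<Rightarrow> ereal" where
  "H_min dU dV \<rho> = - log2_ereal (Inf {Re (op_trace \<sigma>) |\<sigma>.
     psd dV \<sigma> \<and> loewner_le (dU * dV) \<rho> (kron (1\<^sub>m dU) \<sigma>)})"

definition H_max :: "nat \<Rightarrow> nat \<Rightarrow> complex mat \<Rightarrow> ereal" where
  "H_max dU dV \<rho> = (SUP \<sigma>\<in>{\<sigma>. normalized dV \<sigma>}.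
     log2_ereal (real dU * (fidelity \<rho> (kron ((1 / of_nat dU) \<cdot>\<^sub>m 1\<^sub>m dU) \<sigma>))\<^sup>2))"

text \<open>\<open>H\<^sub>m\<^sub>a\<^sub>x(f(Z)|E)\<close> and \<open>H\<^sub>m\<^sub>i\<^sub>n(X|B, g(X))\<close>, where \<open>f\<close> maps bit strings of length \<open>n\<close> to bit
  strings of length \<open>m\<close>, and \<open>g\<close> to bit strings of length \<open>l\<close>.\<close>

definition hashed_state ::
    "nat \<Rightarrow> nat \<Rightarrow> nat \<Rightarrow> (bit vec \<Rightarrow> bit vec) \<Rightarrow> complex mat \<Rightarrow> complex mat" where
  "hashed_state n m dE f \<rho> = op_sum (2 ^ m * dE) (2 ^ m * dE)
     (\<lambda>k. kron (ket_proj (ket_z k))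
        (op_sum dE dE (block ket_z dE \<rho>) {z \<in> carrier_vec n. f z = k})) (carrier_vec m)"

definition H_max_hash ::
    "nat \<Rightarrow> nat \<Rightarrow> nat \<Rightarrow> (bit vec \<Rightarrow> bit vec) \<Rightarrow> complex mat \<Rightarrow> ereal" where
  "H_max_hash n m dE f \<rho> = H_max (2 ^ m) dE (hashed_state n m dE f \<rho>)"

definition syndrome_state ::
    "nat \<Rightarrow> nat \<Rightarrow> nat \<Rightarrow> (bit vec \<Rightarrow> bit vec) \<Rightarrow> complex mat \<Rightarrow> complex mat" where
  "syndrome_state n l dB g \<rho> = op_sum (2 ^ n * (dB * 2 ^ l)) (2 ^ n * (dB * 2 ^ l))
     (\<lambda>x. kron (ket_proj (ket_x x))
        (kron (block ket_x dB \<rho> x) (ket_proj (ket_z (g x))))) (carrier_vec n)"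

definition H_min_syndrome ::
    "nat \<Rightarrow> nat \<Rightarrow> nat \<Rightarrow> (bit vec \<Rightarrow> bit vec) \<Rightarrow> complex mat \<Rightarrow> ereal" where
  "H_min_syndrome n l dB g \<rho> = H_min (2 ^ n) (dB * 2 ^ l) (syndrome_state n l dB g \<rho>)"


subsection \<open>Indices of privacy amplification, error correction and data compression\<close>

definition Q_PA :: "nat \<Rightarrow> nat \<Rightarrow> nat \<Rightarrow> (bit vec \<Rightarrow> bit vec) \<Rightarrow> complex mat \<Rightarrow> real" where
  "Q_PA n m dE f \<rho> =
     Re (op_trace \<rho>) - exp2_ereal (H_max_hash n m dE f \<rho> - ereal (real m))"

definition povm :: "nat \<Rightarrow> nat \<Rightarrow> (bit vec \<Rightarrow> complex mat) \<Rightarrow> bool" where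
  "povm n d M \<longleftrightarrow> (\<forall>e\<in>carrier_vec n. psd d (M e)) \<and> op_sum d d M (carrier_vec n) = 1\<^sub>m d"

text \<open>\<open>M s e\<close> is the POVM element for outcome \<open>e\<close> when the syndrome is \<open>s\<close>.\<close>

definition povm_family ::
    "nat \<Rightarrow> nat \<Rightarrow> nat \<Rightarrow> (bit vec \<Rightarrow> bit vec \<Rightarrow> complex mat) \<Rightarrow> bool" where
  "povm_family n l d M \<longleftrightarrow> (\<forall>s\<in>carrier_vec l. povm n d (M s))"

definition Q_EC :: "nat \<Rightarrow> nat \<Rightarrow> nat \<Rightarrow> (bit vec \<Rightarrow> bit vec) \<Rightarrow> complex mat \<Rightarrow> real" where
  "Q_EC n l dB g \<rho> = (INF M\<in>{M. povm_family n l dB M}.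
     \<Sum>x\<in>carrier_vec n. \<Sum>e\<in>{e \<in> carrier_vec n. x + e \<noteq> 0\<^sub>v n}.
       Re (op_trace (block ket_x dB \<rho> x * M (g x) e)))"

definition Q_DC :: "nat \<Rightarrow> nat \<Rightarrow> nat \<Rightarrow> (bit vec \<Rightarrow> bit vec) \<Rightarrow> complex mat \<Rightarrow> real" where
  "Q_DC n l dB g \<rho> = (INF M\<in>{M. povm_family n l dB M}.
     \<Sum>x\<in>carrier_vec n. \<Sum>e\<in>{e \<in> carrier_vec n. e \<noteq> x}.
       Re (op_trace (block ket_x dB \<rho> x * M (g x) e)))"


subsection \<open>Dual random functions\<close>

text \<open>In a dual pair, the functions are surjective because the matrices have full row rank.
  Linear functions are represented by their matrices; a random function is given by its
  distribution.\<close>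

definition dual_functions :: "nat \<Rightarrow> nat \<Rightarrow> bit mat \<Rightarrow> bit mat \<Rightarrow> bool" where
  "dual_functions n m f g \<longleftrightarrow>
     f \<in> carrier_mat m n \<and> g \<in> carrier_mat (n - m) n \<and>
     vec_space.rank m f = m \<and> vec_space.rank (n - m) g = n - m \<and>
     f * transpose_mat g = 0\<^sub>m m (n - m)"

definition dual_random_functions :: "nat \<Rightarrow> nat \<Rightarrow> bit mat pmf \<Rightarrow> bit mat pmf \<Rightarrow> bool" where
  "dual_random_functions n m F G \<longleftrightarrow>
     (\<exists>N f g. inj_on f {..<N::nat} \<and> inj_on g {..<N} \<and>
        set_pmf F \<subseteq> f ` {..<N} \<and> set_pmf G \<subseteq> g ` {..<N} \<and>
        (\<forall>i<N. dual_functions n m (f i) (g i) \<and> pmf F (f i) = pmf G (g i)))"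

end

theory Submission
  imports Defs
begin

text \<open>
  Write \<open>\<psi> = (\<Sum>z. |z\<rangle> \<otimes> \<psi>\<^sub>z)\<close>, read each \<open>\<psi>\<^sub>z\<close> as a \<open>B \<times> E\<close> matrix, and let
  \<open>\<Phi>\<^sub>x = 2\<^sup>-\<^sup>n\<^sup>/\<^sup>2 (\<Sum>z. (-1)\<^sup>x\<^sup>z \<psi>\<^sub>z)\<close>; then \<open>\<rho>\<^sub>E\<^sup>z\<close> is the complex conjugate of \<open>\<psi>\<^sub>z\<^sup>*\<psi>\<^sub>z\<close> and
  \<open>\<rho>\<^sub>B\<^sup>x = \<Phi>\<^sub>x\<Phi>\<^sub>x\<^sup>*\<close>. For a dual pair \<open>f \<bottom> g\<close> we compare the squared fidelities \<open>a\<close> behind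
  \<open>H\<^sub>m\<^sub>a\<^sub>x(f(Z)|E)\<close>, the success probabilities \<open>b\<close> of guessing \<open>x\<close> from \<open>B\<close> and \<open>g(x)\<close>, and the
  traces \<open>c\<close> of the operators admitted in \<open>H\<^sub>m\<^sub>i\<^sub>n(X|B,g(X))\<close>, and show
  \<open>sup b \<le> sup a \<le> inf c \<le> sup b\<close>.

  For \<open>b \<le> a\<close>, a POVM \<open>M\<close> yields the operator \<open>\<omega> = (\<Sum>x. \<Phi>\<^sub>x\<^sup>* M\<^sub>x \<Phi>\<^sub>x)\<close> on \<open>E\<close> and a purification
  of (an operator below) \<open>1 \<otimes> \<omega>\<close> whose overlap with a purification of the hashed state is
  \<open>2\<^sup>m\<^sup>/\<^sup>2 Tr \<omega>\<close>. For \<open>a \<le> c\<close>, Uhlmann's theorem writes the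
  fidelity as an overlap, and Parseval's identity on the cosets of \<open>ker f\<close> and \<open>ker g\<close> together with
  Cauchy-Schwarz bounds it; here the orthogonality coming from the standard form enters. For
  \<open>c \<le> b\<close>, perturbing a nearly optimal POVM by \<open>M \<mapsto> (1 - rL) M (1 - rL)\<close> shows that the Hermitian
  part of \<open>\<Sum>x. \<rho>\<^sub>B\<^sup>x M\<^sub>x\<close> nearly dominates every \<open>\<rho>\<^sub>B\<^sup>x\<close>, so no duality theorem for semidefinite
  programs is needed.
\<close>

section \<open>Finitely supported matrices\<close>

text \<open>The standard form is used only for \<open>a \<le> c\<close>, and its two alternatives
  help in different ways. If the state on \<open>A\<close>, \<open>B\<close> is classical in X,
  distinct \<open>\<Phi> x\<close> have orthogonal row spaces. The squared norm of a sum over x then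
  splits, and Parseval on each fibre of \<open>g\<close> treats every syndrome separately. If the
  state on \<open>A\<close>, \<open>E\<close> is classical in Z, the hashed state has purifications
  that keep no copy of z, one for every sign pattern \<open>chr x0\<close>. Everything else in the
  overlap depends on z only through \<open>f z\<close>, so the signs confine its Fourier transform
  to the fibre of \<open>g\<close> through \<open>x0\<close>. This bounds the fidelity by a single
  \<open>\<tau> s\<close>, for every s, and averaging over s gives the sum of traces. Duality enters
  because a character summed over a coset of the kernel of \<open>f\<close> vanishes unless
  \<open>g\<close> maps its label to zero. Suprema and infima are approached up to an arbitrary
  error, so no compactness of the sets of POVMs or states is invoked.\<close>

text \<open>
  All operators are embedded into one type of finitely supported infinite matrices, so that sums and
  associativity need no dimension side conditions. There is no unit; \<open>fid d\<close> is the identity of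
  dimension \<open>d\<close>. The norm is the Hilbert-Schmidt norm.
\<close>

typedef fmat = "{A :: nat \<Rightarrow> nat \<Rightarrow> complex. \<exists>N. \<forall>i j. A i j \<noteq> 0 \<longrightarrow> i < N \<and> j < N}"
  morphisms entry Fmat
  by (intro exI[of _ "\<lambda>_ _. 0"]) auto

setup_lifting type_definition_fmat

definition bounded_by :: "nat \<Rightarrow> fmat \<Rightarrow> bool" where
  "bounded_by N A \<longleftrightarrow> (\<forall>i j. entry A i j \<noteq> 0 \<longrightarrow> i < N \<and> j < N)"

lemma bounded_byD: "bounded_by N A \<Longrightarrow> \<not> i < N \<or> \<not> j < N \<Longrightarrow> entry A i j = 0"
  by (auto simp: bounded_by_def)

lemma bounded_by_mono: "bounded_by N A \<Longrightarrow> N \<le> M \<Longrightarrow> bounded_by M A"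
  unfolding bounded_by_def by (meson order_less_le_trans)

lemma ex_bounded_by: "\<exists>N. bounded_by N A"
  unfolding bounded_by_def using entry[of A] by auto

lemma ex_bounded_by2: "\<exists>N. bounded_by N A \<and> bounded_by N B"
  by (metis bounded_by_mono ex_bounded_by nle_le)

lemma ex_bounded_by3: "\<exists>N. bounded_by N A \<and> bounded_by N B \<and> bounded_by N C"
  by (metis bounded_by_mono ex_bounded_by ex_bounded_by2 nle_le)

lemma fmat_eqI: "(\<And>i j. entry A i j = entry B i j) \<Longrightarrow> A = B"
  by (metis entry_inject ext)

instantiation fmat :: ring
begin

lift_definition zero_fmat :: fmat is "\<lambda>_ _. 0" by auto

lift_definition plus_fmat :: "fmat \<Rightarrow> fmat \<Rightarrow> fmat" is "\<lambda>A B i j. A i j + B i j"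
proof -
  fix A B :: "nat \<Rightarrow> nat \<Rightarrow> complex"
  assume "\<exists>N. \<forall>i j. A i j \<noteq> 0 \<longrightarrow> i < N \<and> j < N" "\<exists>N. \<forall>i j. B i j \<noteq> 0 \<longrightarrow> i < N \<and> j < N"
  then obtain N M where
    *: "\<And>i j. A i j \<noteq> 0 \<Longrightarrow> i < N \<and> j < N" "\<And>i j. B i j \<noteq> 0 \<Longrightarrow> i < M \<and> j < M" by auto
  have "i < max N M \<and> j < max N M" if "A i j + B i j \<noteq> 0" for i j
  proof -
    have "A i j \<noteq> 0 \<or> B i j \<noteq> 0" using that by auto
    then show ?thesis using *[of i j] by auto
  qed
  then show "\<exists>N. \<forall>i j. A i j + B i j \<noteq> 0 \<longrightarrow> i < N \<and> j < N" by blast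
qed

lift_definition uminus_fmat :: "fmat \<Rightarrow> fmat" is "\<lambda>A i j. - A i j" by auto

definition minus_fmat :: "fmat \<Rightarrow> fmat \<Rightarrow> fmat" where "minus_fmat A B = A + - B"

text \<open>The index set is the support of row \<open>i\<close> of the first factor: it is finite
  and mentions no bound, and \<open>entry_times\<close> trades it for any bound of that
  factor.\<close>

lift_definition times_fmat :: "fmat \<Rightarrow> fmat \<Rightarrow> fmat" is
  "\<lambda>A B i k. \<Sum>j | A i j \<noteq> 0. A i j * B j k"
proof -
  fix A B :: "nat \<Rightarrow> nat \<Rightarrow> complex"
  assume "\<exists>N. \<forall>i j. A i j \<noteq> 0 \<longrightarrow> i < N \<and> j < N" "\<exists>N. \<forall>i j. B i j \<noteq> 0 \<longrightarrow> i < N \<and> j < N"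
  then obtain N M where
    *: "\<And>i j. A i j \<noteq> 0 \<Longrightarrow> i < N \<and> j < N" "\<And>i j. B i j \<noteq> 0 \<Longrightarrow> i < M \<and> j < M" by auto
  have "i < max N M \<and> k < max N M" if "(\<Sum>j | A i j \<noteq> 0. A i j * B j k) \<noteq> 0" for i k
  proof -
    obtain j where "A i j \<noteq> 0" "A i j * B j k \<noteq> 0"
      using \<open>(\<Sum>j | A i j \<noteq> 0. A i j * B j k) \<noteq> 0\<close> by (metis (mono_tags, lifting) mem_Collect_eq sum.neutral)
    then show ?thesis using * by fastforce
  qed
  then show "\<exists>N. \<forall>i k. (\<Sum>j | A i j \<noteq> 0. A i j * B j k) \<noteq> 0 \<longrightarrow> i < N \<and> k < N" by blast
qed

lemma entry_times:
  assumes "bounded_by N A"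
  shows "entry (A * B) i k = (\<Sum>j<N. entry A i j * entry B j k)"
  unfolding times_fmat.rep_eq
  by (rule sum.mono_neutral_left) (use assms in \<open>auto simp: bounded_by_def\<close>)

lemma bounded_by_times: "bounded_by N A \<Longrightarrow> bounded_by N B \<Longrightarrow> bounded_by N (A * B)"
proof -
  assume A: "bounded_by N A" and B: "bounded_by N B"
  have "i < N \<and> k < N" if "entry (A * B) i k \<noteq> 0" for i k
  proof -
    have "\<exists>j. entry A i j * entry B j k \<noteq> 0"
      using that unfolding entry_times[OF A] by (rule contrapos_np) simp
    then show ?thesis using A B by (auto simp: bounded_by_def)
  qed
  then show ?thesis by (simp add: bounded_by_def)
qed

instance
proof
  fix A B C :: fmat
  show "A * B * C = A * (B * C)"
  proof (rule fmat_eqI)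
    fix i l
    obtain N where N: "bounded_by N A" "bounded_by N B" using ex_bounded_by2 by blast
    have "entry (A * B * C) i l = (\<Sum>k<N. (\<Sum>j<N. entry A i j * entry B j k) * entry C k l)"
      by (simp add: entry_times[OF bounded_by_times[OF N]] entry_times[OF N(1)])
    also have "\<dots> = (\<Sum>j<N. entry A i j * (\<Sum>k<N. entry B j k * entry C k l))"
      by (simp add: sum_distrib_left sum_distrib_right mult.assoc) (rule sum.swap)
    also have "\<dots> = entry (A * (B * C)) i l"
      by (simp add: entry_times[OF N(1)] entry_times[OF N(2)])
    finally show "entry (A * B * C) i l = entry (A * (B * C)) i l" .
  qed
  show "(A + B) * C = A * C + B * C"
  proof (rule fmat_eqI)
    fix i k
    obtain N where N: "bounded_by N A" "bounded_by N B" "bounded_by N (A + B)"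
      using ex_bounded_by3 by blast
    show "entry ((A + B) * C) i k = entry (A * C + B * C) i k"
      by (simp add: entry_times[OF N(1)] entry_times[OF N(2)] entry_times[OF N(3)]
          plus_fmat.rep_eq distrib_right sum.distrib)
  qed
  show "A * (B + C) = A * B + A * C"
    by (rule fmat_eqI) (simp add: times_fmat.rep_eq plus_fmat.rep_eq distrib_left sum.distrib)
qed (transfer; simp add: fun_eq_iff minus_fmat_def)+

end

text \<open>Characters and normalizing constants are real, so real scalars suffice and the generic
  facts on real algebras and real inner products apply.\<close>

instantiation fmat :: real_algebra
begin

lift_definition scaleR_fmat :: "real \<Rightarrow> fmat \<Rightarrow> fmat" is "\<lambda>r A i j. r *\<^sub>R A i j" by auto

instance
proof
  fix A B :: fmat and r :: real
  obtain N where N: "bounded_by N A" "bounded_by N (r *\<^sub>R A)" using ex_bounded_by2 by blast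
  show "r *\<^sub>R A * B = r *\<^sub>R (A * B)"
    by (rule fmat_eqI)
      (simp add: entry_times[OF N(1)] entry_times[OF N(2)] scaleR_fmat.rep_eq scaleR_sum_right)
  show "A * r *\<^sub>R B = r *\<^sub>R (A * B)"
    by (rule fmat_eqI)
      (simp add: entry_times[OF N(1)] scaleR_fmat.rep_eq scaleR_sum_right)
qed (transfer; simp add: fun_eq_iff scaleR_add_left scaleR_add_right)+

end

lemmas entry_simps = plus_fmat.rep_eq zero_fmat.rep_eq uminus_fmat.rep_eq scaleR_fmat.rep_eq

lemma entry_minus: "entry (A - B) i j = entry A i j - entry B i j"
  unfolding minus_fmat_def entry_simps by simp

lemma entry_sum: "entry (\<Sum>x\<in>S. A x) i j = (\<Sum>x\<in>S. entry (A x) i j)"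
  by (induction S rule: infinite_finite_induct) (simp_all add: entry_simps)

lift_definition adj :: "fmat \<Rightarrow> fmat" is "\<lambda>A i j. cnj (A j i)" by auto

text \<open>Conjugation without transposition, hence multiplicative in the given order. It relates
  the reduced state on \<open>E\<close> to Gram matrices of coefficient matrices, see
  \<open>\<rho>AE_block\<close>.\<close>

lift_definition cnj_fmat :: "fmat \<Rightarrow> fmat" is "\<lambda>A i j. cnj (A i j)" by auto

lemma bounded_by_adj: "bounded_by N A \<Longrightarrow> bounded_by N (adj A)"
  by (auto simp: bounded_by_def adj.rep_eq)

lemma bounded_by_cnj: "bounded_by N A \<Longrightarrow> bounded_by N (cnj_fmat A)"
  by (auto simp: bounded_by_def cnj_fmat.rep_eq)

lemma adj_adj [simp]: "adj (adj A) = A"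
  by transfer auto

lemma adj_simps [simp]:
  "adj 0 = 0" "adj (A + B) = adj A + adj B" "adj (- A) = - adj A" "adj (A - B) = adj A - adj B"
  "adj (r *\<^sub>R A) = r *\<^sub>R adj A" "adj (A * B) = adj B * adj A"
proof -
  show "adj (A * B) = adj B * adj A"
  proof (rule fmat_eqI)
    fix i j
    obtain N where N: "bounded_by N A" "bounded_by N B" using ex_bounded_by2 by blast
    show "entry (adj (A * B)) i j = entry (adj B * adj A) i j"
      by (simp add: entry_times[OF N(1)] entry_times[OF bounded_by_adj[OF N(2)]] adj.rep_eq mult.commute)
  qed
qed (auto intro!: fmat_eqI simp: adj.rep_eq entry_simps entry_minus)

lemma adj_sum [simp]: "adj (\<Sum>x\<in>S. A x) = (\<Sum>x\<in>S. adj (A x))"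
  by (rule fmat_eqI) (simp add: entry_sum adj.rep_eq)

lemma cnj_fmat_cnj_fmat [simp]: "cnj_fmat (cnj_fmat A) = A"
  by transfer auto

lemma cnj_fmat_simps [simp]:
  "cnj_fmat 0 = 0" "cnj_fmat (A + B) = cnj_fmat A + cnj_fmat B"
  "cnj_fmat (r *\<^sub>R A) = r *\<^sub>R cnj_fmat A" "cnj_fmat (A * B) = cnj_fmat A * cnj_fmat B"
  "cnj_fmat (adj A) = adj (cnj_fmat A)" "cnj_fmat (A - B) = cnj_fmat A - cnj_fmat B"
proof -
  show "cnj_fmat (A * B) = cnj_fmat A * cnj_fmat B"
  proof (rule fmat_eqI)
    fix i j
    obtain N where N: "bounded_by N A" using ex_bounded_by by blast
    show "entry (cnj_fmat (A * B)) i j = entry (cnj_fmat A * cnj_fmat B) i j"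
      by (simp add: entry_times[OF N(1)] entry_times[OF bounded_by_cnj[OF N(1)]] cnj_fmat.rep_eq)
  qed
qed (auto intro!: fmat_eqI simp: cnj_fmat.rep_eq adj.rep_eq entry_simps entry_minus)

lemma cnj_fmat_sum [simp]: "cnj_fmat (\<Sum>x\<in>S. A x) = (\<Sum>x\<in>S. cnj_fmat (A x))"
  by (rule fmat_eqI) (simp add: entry_sum cnj_fmat.rep_eq)

section \<open>Real trace and Hilbert-Schmidt inner product\<close>

definition rtr :: "fmat \<Rightarrow> real" where
  "rtr A = (\<Sum>i | entry A i i \<noteq> 0. Re (entry A i i))"

lemma rtr_bounded:
  assumes "bounded_by N A"
  shows "rtr A = (\<Sum>i<N. Re (entry A i i))"
  unfolding rtr_def by (rule sum.mono_neutral_left) (use assms in \<open>auto simp: bounded_by_def\<close>)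

lemma rtr_0 [simp]: "rtr 0 = 0"
  by (simp add: rtr_def entry_simps)

lemma rtr_add: "rtr (A + B) = rtr A + rtr B"
proof -
  obtain N where "bounded_by N A" "bounded_by N B" "bounded_by N (A + B)" using ex_bounded_by3 by blast
  then show ?thesis by (simp add: rtr_bounded entry_simps sum.distrib)
qed

lemma rtr_scaleR: "rtr (r *\<^sub>R A) = r * rtr A"
proof -
  obtain N where "bounded_by N A" "bounded_by N (r *\<^sub>R A)" using ex_bounded_by2 by blast
  then show ?thesis by (simp add: rtr_bounded entry_simps sum_distrib_left)
qed

lemma rtr_uminus: "rtr (- A) = - rtr A"
  using rtr_scaleR[of "-1" A] by simp

lemma rtr_diff: "rtr (A - B) = rtr A - rtr B"
  using rtr_add[of A "- B"] by (simp add: rtr_uminus)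

lemma rtr_sum: "rtr (\<Sum>x\<in>S. A x) = (\<Sum>x\<in>S. rtr (A x))"
  by (induction S rule: infinite_finite_induct) (simp_all add: rtr_add)

lemma rtr_adj [simp]: "rtr (adj A) = rtr A"
  by (simp add: rtr_def adj.rep_eq)

lemma rtr_cnj_fmat [simp]: "rtr (cnj_fmat A) = rtr A"
  by (simp add: rtr_def cnj_fmat.rep_eq)

lemma rtr_mult_bounded:
  assumes "bounded_by N A" "bounded_by N B"
  shows "rtr (A * B) = (\<Sum>i<N. \<Sum>j<N. Re (entry A i j * entry B j i))"
  by (simp add: rtr_bounded[OF bounded_by_times[OF assms]] entry_times[OF assms(1)])

lemma rtr_comm: "rtr (A * B) = rtr (B * A)"
proof -
  obtain N where N: "bounded_by N A" "bounded_by N B" using ex_bounded_by2 by blast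
  show ?thesis
    unfolding rtr_mult_bounded[OF N] rtr_mult_bounded[OF N(2,1)]
    by (subst sum.swap) (simp add: mult.commute)
qed

instantiation fmat :: real_inner
begin

text \<open>Taking the real part gives a real inner product. Phases of overlaps are not lost, since
  the contractions in Uhlmann's theorem absorb them.\<close>

definition inner_fmat :: "fmat \<Rightarrow> fmat \<Rightarrow> real" where "inner_fmat A B = rtr (adj A * B)"
definition norm_fmat :: "fmat \<Rightarrow> real" where "norm_fmat A = sqrt (inner A A)"
definition dist_fmat :: "fmat \<Rightarrow> fmat \<Rightarrow> real" where "dist_fmat A B = norm (A - B)"
definition sgn_fmat :: "fmat \<Rightarrow> fmat" where "sgn_fmat A = A /\<^sub>R norm A"
definition uniformity_fmat :: "(fmat \<times> fmat) filter" where
  "uniformity_fmat = (INF e\<in>{0<..}. principal {(A, B). dist A B < e})"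
definition open_fmat :: "fmat set \<Rightarrow> bool" where
  "open_fmat U \<longleftrightarrow> (\<forall>A\<in>U. eventually (\<lambda>(A', B). A' = A \<longrightarrow> B \<in> U) uniformity)"

lemma inner_fmat_bounded:
  assumes "bounded_by N A"
  shows "inner A A = (\<Sum>i<N. \<Sum>j<N. (cmod (entry A j i))\<^sup>2)"
proof -
  have "Re (cnj w * w) = (cmod w)\<^sup>2" for w
    by (simp add: cmod_power2) (simp add: power2_eq_square)
  then show ?thesis
    by (simp only: inner_fmat_def rtr_mult_bounded[OF bounded_by_adj[OF assms] assms] adj.rep_eq)
qed

instance
proof
  fix A B C :: fmat and r :: real
  show "inner A B = inner B A"
    unfolding inner_fmat_def using rtr_adj[of "adj A * B"] by simp
  obtain N where N: "bounded_by N A" using ex_bounded_by by blast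
  show "0 \<le> inner A A"
    unfolding inner_fmat_bounded[OF N] by (intro sum_nonneg) simp
  show "inner A A = 0 \<longleftrightarrow> A = 0"
  proof
    assume "inner A A = 0"
    then have "\<And>i j. i < N \<Longrightarrow> j < N \<Longrightarrow> entry A j i = 0"
      unfolding inner_fmat_bounded[OF N] by (simp add: sum_nonneg_eq_0_iff sum_nonneg)
    then have "entry A i j = 0" for i j
      using bounded_byD[OF N, of i j] by blast
    then show "A = 0"
      by (intro fmat_eqI) (simp add: zero_fmat.rep_eq)
  qed (simp add: inner_fmat_def)
  show "inner (A + B) C = inner A C + inner B C" "inner (r *\<^sub>R A) B = r * inner A B"
    by (simp_all add: inner_fmat_def rtr_add rtr_scaleR distrib_right)
  show "norm A = sqrt (inner A A)" by (rule norm_fmat_def)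
  show "dist A B = norm (A - B)" by (rule dist_fmat_def)
  show "sgn A = A /\<^sub>R norm A" by (rule sgn_fmat_def)
  show "uniformity = (INF e\<in>{0<..}. principal {(A :: fmat, B). dist A B < e})"
    by (rule uniformity_fmat_def)
  show "open U \<longleftrightarrow> (\<forall>A\<in>U. eventually (\<lambda>(A', B). A' = A \<longrightarrow> B \<in> U) uniformity)" for U :: "fmat set"
    by (rule open_fmat_def)
qed

end

lemma inner_mult_left: "inner (X * A) B = inner A (adj X * B)" for A B X :: fmat
  by (simp add: inner_fmat_def mult.assoc)

lemma inner_adj: "inner (adj A) (adj B) = inner A B"
  unfolding inner_fmat_def using rtr_adj[of "adj A * B"] by (simp add: rtr_comm)

lemma norm_adj [simp]: "norm (adj A) = norm A" for A :: fmat
  by (simp add: norm_eq_sqrt_inner inner_adj)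

lemma rtr_adj_mult: "rtr (adj A * A) = (norm A)\<^sup>2"
  by (simp add: power2_norm_eq_inner inner_fmat_def)

lemma rtr_mult_adj: "rtr (A * adj A) = (norm A)\<^sup>2"
  using rtr_comm[of A "adj A"] by (simp add: rtr_adj_mult)

lemma rtr_mult_le: "rtr (A * B) \<le> norm A * norm B"
  using norm_cauchy_schwarz[of "adj A" B] by (simp add: inner_fmat_def)

lemma norm_cnj_fmat [simp]: "norm (cnj_fmat A) = norm A" for A :: fmat
  by (metis cnj_fmat_simps(4) cnj_fmat_simps(5) norm_eq_sqrt_inner rtr_cnj_fmat inner_fmat_def)

section \<open>Identities of finite dimension\<close>

lift_definition fid :: "nat \<Rightarrow> fmat" is "\<lambda>d i j. if i = j \<and> i < d then 1 else 0" by auto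

lemma bounded_by_fid: "bounded_by d (fid d)"
  by (auto simp: bounded_by_def fid.rep_eq)

lemma adj_fid [simp]: "adj (fid d) = fid d"
  by transfer (auto simp: fun_eq_iff)

lemma cnj_fid [simp]: "cnj_fmat (fid d) = fid d"
  by transfer (auto simp: fun_eq_iff)

lemma entry_fid_mult: "entry (fid d * A) i j = (if i < d then entry A i j else 0)"
proof -
  have "entry (fid d * A) i j = (\<Sum>k<d. if k = i then entry A i j else 0)"
    unfolding entry_times[OF bounded_by_fid] fid.rep_eq by (intro sum.cong) auto
  then show ?thesis by simp
qed

lemma entry_mult_fid: "entry (A * fid d) i j = (if j < d then entry A i j else 0)"
proof -
  have "A * fid d = adj (fid d * adj A)" by simp
  then show ?thesis by (simp add: adj.rep_eq entry_fid_mult del: adj_simps)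
qed

lemma fid_mult_fid [simp]: "fid d * fid d = fid d"
  by (rule fmat_eqI) (simp add: entry_fid_mult fid.rep_eq)

lemma rtr_fid [simp]: "rtr (fid d) = d"
  by (simp add: rtr_bounded[OF bounded_by_fid] fid.rep_eq)

lemma fid_mult_bounded: "bounded_by d A \<Longrightarrow> fid d * A = A"
  by (rule fmat_eqI) (simp add: entry_fid_mult bounded_byD)

lemma mult_fid_bounded: "bounded_by d A \<Longrightarrow> A * fid d = A"
  by (rule fmat_eqI) (simp add: entry_mult_fid bounded_byD)

section \<open>Transfer from matrices and positivity\<close>

text \<open>Padding by zeros forgets the dimensions, which is why \<open>op_of_inject\<close> asks
  for them.\<close>

lift_definition op_of :: "complex mat \<Rightarrow> fmat" is
  "\<lambda>M i j. if i < dim_row M \<and> j < dim_col M then M $$ (i, j) else 0"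
proof -
  fix M :: "complex mat"
  show "\<exists>N. \<forall>i j. (if i < dim_row M \<and> j < dim_col M then M $$ (i, j) else 0) \<noteq> 0 \<longrightarrow> i < N \<and> j < N"
    by (intro exI[of _ "max (dim_row M) (dim_col M)"]) (simp add: less_max_iff_disj)
qed

lemma bounded_by_op_of: "dim_row M \<le> N \<Longrightarrow> dim_col M \<le> N \<Longrightarrow> bounded_by N (op_of M)"
  by (simp add: bounded_by_def op_of.rep_eq)

lemma entry_mult_op_of:
  "dim_col M \<le> N \<Longrightarrow> entry (op_of M * A) i k = (\<Sum>j<N. entry (op_of M) i j * entry A j k)"
  unfolding times_fmat.rep_eq
  by (rule sum.mono_neutral_left) (auto simp: op_of.rep_eq split: if_splits)

lemma op_of_mult: "dim_col P = dim_row Q \<Longrightarrow> op_of (P * Q) = op_of P * op_of Q"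
  by (rule fmat_eqI)
    (auto simp: entry_mult_op_of[OF order_refl] op_of.rep_eq scalar_prod_def atLeast0LessThan intro!: sum.cong)

lemma mat_adjoint_eq: "mat_adjoint M = mat (dim_col M) (dim_row M) (\<lambda>(i, j). cnj (M $$ (j, i)))"
  by (rule eq_matI) (auto simp: mat_adjoint_def mat_of_rows_def)

lemma dim_mat_adjoint [simp]:
  "dim_row (mat_adjoint M) = dim_col (M :: complex mat)" "dim_col (mat_adjoint M) = dim_row M"
  by (simp_all add: mat_adjoint_eq)

lemma op_of_adjoint [simp]: "op_of (mat_adjoint M) = adj (op_of M)"
  by (rule fmat_eqI) (auto simp: op_of.rep_eq adj.rep_eq mat_adjoint_eq)

lemma op_of_minus:
  "dim_row P = dim_row Q \<Longrightarrow> dim_col P = dim_col Q \<Longrightarrow> op_of (P - Q) = op_of P - op_of Q"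
  by (rule fmat_eqI) (auto simp: op_of.rep_eq entry_minus)

lemma op_of_op_sum:
  assumes "\<And>x. x \<in> S \<Longrightarrow> P x \<in> carrier_mat nr nc"
  shows "op_of (op_sum nr nc P S) = (\<Sum>x\<in>S. op_of (P x))"
proof (rule fmat_eqI)
  fix i j
  have "entry (op_of (P x)) i j = (if i < nr \<and> j < nc then P x $$ (i, j) else 0)" if "x \<in> S" for x
    using assms[OF that] by (auto simp: op_of.rep_eq)
  then have "entry (\<Sum>x\<in>S. op_of (P x)) i j = (\<Sum>x\<in>S. if i < nr \<and> j < nc then P x $$ (i, j) else 0)"
    by (simp add: entry_sum)
  then show "entry (op_of (op_sum nr nc P S)) i j = entry (\<Sum>x\<in>S. op_of (P x)) i j"
    by (auto simp: op_of.rep_eq op_sum_def)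
qed

lemma op_of_one [simp]: "op_of (1\<^sub>m d) = fid d"
  by (rule fmat_eqI) (auto simp: op_of.rep_eq fid.rep_eq)

lemma op_of_smult_real: "op_of (complex_of_real r \<cdot>\<^sub>m M) = r *\<^sub>R op_of M"
  by (rule fmat_eqI) (simp add: op_of.rep_eq entry_simps scaleR_conv_of_real)

lemma op_of_inject:
  assumes "op_of P = op_of Q" "dim_row P = dim_row Q" "dim_col P = dim_col Q"
  shows "P = Q"
proof (rule eq_matI)
  fix i j assume "i < dim_row Q" "j < dim_col Q"
  then show "P $$ (i, j) = Q $$ (i, j)"
    using assms(2,3) arg_cong[OF assms(1), of "\<lambda>A. entry A i j"] by (simp add: op_of.rep_eq)
qed (use assms in auto)

lemma rtr_op_of: "dim_row M = dim_col M \<Longrightarrow> rtr (op_of M) = Re (op_trace M)"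
  by (simp add: rtr_bounded[OF bounded_by_op_of[of M "dim_row M"]] op_trace_def op_of.rep_eq)

lemma fid_mult_op_of: "dim_row M \<le> d \<Longrightarrow> fid d * op_of M = op_of M"
  by (rule fmat_eqI) (auto simp: entry_fid_mult op_of.rep_eq)

lemma op_of_mult_fid: "dim_col M \<le> d \<Longrightarrow> op_of M * fid d = op_of M"
  by (rule fmat_eqI) (auto simp: entry_mult_fid op_of.rep_eq)

definition mat_of :: "nat \<Rightarrow> nat \<Rightarrow> fmat \<Rightarrow> complex mat" where
  "mat_of p q A = mat p q (\<lambda>(i, j). entry A i j)"

lemma mat_of_carrier [simp]: "mat_of p q A \<in> carrier_mat p q"
  by (simp add: mat_of_def)

lemma op_of_mat_of: "op_of (mat_of p q A) = fid p * A * fid q"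
  by (rule fmat_eqI) (auto simp: entry_fid_mult entry_mult_fid op_of.rep_eq mat_of_def)

lemma op_of_mat_of_bounded: "bounded_by N A \<Longrightarrow> op_of (mat_of N N A) = A"
  by (simp add: op_of_mat_of fid_mult_bounded mult_fid_bounded)

text \<open>\<open>inner Y (A * Y)\<close> sums the real part of the quadratic form over the columns
  of \<open>Y\<close>, so matrices serve as test vectors. Self-adjointness is a separate conjunct
  because real parts alone do not force it.\<close>

definition pos :: "fmat \<Rightarrow> bool" where
  "pos A \<longleftrightarrow> adj A = A \<and> (\<forall>Y. 0 \<le> inner Y (A * Y))"

lemma posI: "adj A = A \<Longrightarrow> (\<And>Y. 0 \<le> inner Y (A * Y)) \<Longrightarrow> pos A"
  by (simp add: pos_def)

lemma pos_adj: "pos A \<Longrightarrow> adj A = A"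
  by (simp add: pos_def)

lemma pos_inner: "pos A \<Longrightarrow> 0 \<le> inner Y (A * Y)"
  by (simp add: pos_def)

lemma pos_0 [simp]: "pos 0"
  by (simp add: pos_def)

lemma pos_add: "pos A \<Longrightarrow> pos B \<Longrightarrow> pos (A + B)"
  by (simp add: pos_def distrib_right inner_add_right)

lemma pos_sum: "(\<And>x. x \<in> S \<Longrightarrow> pos (A x)) \<Longrightarrow> pos (\<Sum>x\<in>S. A x)"
  by (induction S rule: infinite_finite_induct) (auto intro: pos_add)

lemma pos_scaleR: "pos A \<Longrightarrow> 0 \<le> r \<Longrightarrow> pos (r *\<^sub>R A)"
  by (simp add: pos_def)

lemma pos_conj: "pos A \<Longrightarrow> pos (adj X * A * X)"
  using pos_inner[of A "X * _"]
  by (simp add: pos_def mult.assoc) (metis adj_adj inner_mult_left)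

lemma pos_adj_mult: "pos (adj X * X)"
  by (intro posI) (simp_all add: mult.assoc flip: inner_mult_left[of X])

lemma pos_mult_adj: "pos (X * adj X)"
  using pos_adj_mult[of "adj X"] by simp

lemma rtr_conj_nonneg: "pos A \<Longrightarrow> 0 \<le> rtr (adj Y * A * Y)"
  using pos_inner[of A Y] by (simp add: inner_fmat_def mult.assoc)

lemma pos_cnj_fmat: "pos A \<Longrightarrow> pos (cnj_fmat A)"
proof (rule posI)
  fix Y assume "pos A"
  then have "0 \<le> rtr (adj (cnj_fmat Y) * A * cnj_fmat Y)" by (rule rtr_conj_nonneg)
  then show "0 \<le> inner Y (cnj_fmat A * Y)"
    using rtr_cnj_fmat[of "adj (cnj_fmat Y) * A * cnj_fmat Y"]
    by (simp add: inner_fmat_def mult.assoc del: rtr_cnj_fmat)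
qed (metis cnj_fmat_simps(5) pos_adj)

lemma pos_rtr: "pos A \<Longrightarrow> 0 \<le> rtr A"
proof -
  assume "pos A"
  obtain N where "bounded_by N A" using ex_bounded_by by blast
  then show ?thesis
    using rtr_conj_nonneg[OF \<open>pos A\<close>, of "fid N"] by (simp add: fid_mult_bounded mult_fid_bounded)
qed

lemma pos_fid_fid: "pos (fid d)"
  using pos_adj_mult[of "fid d"] by simp

section \<open>Quadratic forms and the equivalence of \<open>psd\<close> with
  \<open>pos\<close>\<close>

definition quad_form :: "complex mat \<Rightarrow> (nat \<Rightarrow> complex) \<Rightarrow> complex" where
  "quad_form P v = (\<Sum>i<dim_row P. \<Sum>j<dim_row P. P $$ (i, j) * v j * cnj (v i))"

lemma mult_vec_cscalar:
  assumes "P \<in> carrier_mat d d" "v \<in> carrier_vec d"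
  shows "(P *\<^sub>v v) \<bullet>c v = quad_form P (\<lambda>i. v $ i)"
  using assms
  by (auto simp: quad_form_def scalar_prod_def atLeast0LessThan sum_distrib_right intro!: sum.cong)

lemma psd_iff_quad_form:
  "psd d P \<longleftrightarrow> P \<in> carrier_mat d d \<and> (\<forall>v. 0 \<le> quad_form P v)"
proof
  assume *: "psd d P"
  then have P: "P \<in> carrier_mat d d" by (simp add: psd_def)
  have "0 \<le> quad_form P v" for v
  proof -
    have "quad_form P v = quad_form P (\<lambda>i. vec d v $ i)"
      using P unfolding quad_form_def by (intro sum.cong) auto
    also have "\<dots> = (P *\<^sub>v vec d v) \<bullet>c vec d v" using P by (simp add: mult_vec_cscalar)
    finally show ?thesis using * by (simp add: psd_def)
  qed
  with P show "P \<in> carrier_mat d d \<and> (\<forall>v. 0 \<le> quad_form P v)" by blast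
next
  assume "P \<in> carrier_mat d d \<and> (\<forall>v. 0 \<le> quad_form P v)"
  then show "psd d P" by (auto simp: psd_def mult_vec_cscalar)
qed

lemma quad_form_two:
  assumes "P \<in> carrier_mat d d" "i < d" "j < d" "i \<noteq> j"
  shows "quad_form P (\<lambda>k. if k = i then 1 else if k = j then c else 0)
    = P $$ (i, i) + P $$ (i, j) * c + (P $$ (j, i) + P $$ (j, j) * c) * cnj c"
proof -
  have row: "(\<Sum>l<d. P $$ (k, l) * (if l = i then 1 else if l = j then c else 0)) = P $$ (k, i) + P $$ (k, j) * c"
    for k
  proof -
    have "(\<Sum>l<d. P $$ (k, l) * (if l = i then 1 else if l = j then c else 0))
      = (\<Sum>l<d. (if l = i then P $$ (k, l) else 0) + (if l = j then P $$ (k, l) * c else 0))"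
      using assms by (intro sum.cong) auto
    also have "\<dots> = P $$ (k, i) + P $$ (k, j) * c" using assms by (simp add: sum.distrib)
    finally show ?thesis .
  qed
  have "quad_form P (\<lambda>k. if k = i then 1 else if k = j then c else 0)
    = (\<Sum>k<d. (P $$ (k, i) + P $$ (k, j) * c) * cnj (if k = i then 1 else if k = j then c else 0))"
    using assms unfolding quad_form_def row[symmetric] sum_distrib_right by simp
  also have "\<dots> = (\<Sum>k<d. (if k = i then P $$ (k, i) + P $$ (k, j) * c else 0)
      + (if k = j then (P $$ (k, i) + P $$ (k, j) * c) * cnj c else 0))"
    using assms by (intro sum.cong) auto
  also have "\<dots> = P $$ (i, i) + P $$ (i, j) * c + (P $$ (j, i) + P $$ (j, j) * c) * cnj c"
    using assms by (simp add: sum.distrib)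
  finally show ?thesis .
qed

lemma quad_form_one:
  assumes "P \<in> carrier_mat d d" "i < d"
  shows "quad_form P (\<lambda>k. if k = i then 1 else 0) = P $$ (i, i)"
proof -
  have "quad_form P (\<lambda>k. if k = i then 1 else 0)
    = (\<Sum>k<d. if k = i then (\<Sum>l<d. if l = i then P $$ (i, i) else 0) else 0)"
    unfolding quad_form_def carrier_matD(1)[OF assms(1)]
  proof (intro sum.cong refl)
    fix k assume "k \<in> {..<d}"
    have "(\<Sum>l<d. P $$ (k, l) * (if l = i then 1 else 0) * cnj (if k = i then 1 else 0))
      = (\<Sum>l<d. if l = i then if k = i then P $$ (i, i) else 0 else 0)"
      by (intro sum.cong) auto
    also have "\<dots> = (if k = i then \<Sum>l<d. if l = i then P $$ (i, i) else 0 else 0)" by simp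
    finally show "(\<Sum>l<d. P $$ (k, l) * (if l = i then 1 else 0) * cnj (if k = i then 1 else 0))
      = (if k = i then \<Sum>l<d. if l = i then P $$ (i, i) else 0 else 0)" .
  qed
  also have "\<dots> = P $$ (i, i)" using assms by simp
  finally show ?thesis .
qed

lemma psd_hermitian:
  assumes "psd d P" "i < d" "j < d"
  shows "P $$ (j, i) = cnj (P $$ (i, j))"
proof -
  have P: "P \<in> carrier_mat d d" and q: "\<And>v. 0 \<le> quad_form P v"
    using assms by (auto simp: psd_iff_quad_form)
  have im: "Im (quad_form P v) = 0" for v using q[of v] by (simp add: less_eq_complex_def)
  have diag: "Im (P $$ (k, k)) = 0" if "k < d" for k
    using im[of "\<lambda>l. if l = k then 1 else 0"] quad_form_one[OF P that] by simp
  show ?thesis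
  proof (cases "i = j")
    case True
    with diag assms show ?thesis by (simp add: complex_eq_iff)
  next
    case False
    note two = quad_form_two[OF P assms(2,3) False]
    \<comment> \<open>Polarization: \<open>c = 1\<close> relates the imaginary parts of the two
      off-diagonal entries, and \<open>c = \<i>\<close> relates their real parts.\<close>
    from im[of "\<lambda>k. if k = i then 1 else if k = j then 1 else 0"]
      im[of "\<lambda>k. if k = i then 1 else if k = j then \<i> else 0"] show ?thesis
      unfolding two using diag assms by (simp add: complex_eq_iff)
  qed
qed

lemma Re_quad_form_column:
  assumes "P \<in> carrier_mat d d" "d \<le> N" "bounded_by N Y"
  shows "inner Y (op_of P * Y) = (\<Sum>k<N. Re (quad_form P (\<lambda>i. entry Y i k)))"
proof -
  have "(\<Sum>i<N. Re (cnj (entry Y i k) * entry (op_of P * Y) i k)) = Re (quad_form P (\<lambda>i. entry Y i k))" for k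
  proof -
    have "(\<Sum>i<N. cnj (entry Y i k) * entry (op_of P * Y) i k)
      = (\<Sum>i<d. cnj (entry Y i k) * entry (op_of P * Y) i k)"
      using assms by (intro sum.mono_neutral_right) (auto simp: entry_mult_op_of[of P d] op_of.rep_eq)
    also have "\<dots> = quad_form P (\<lambda>i. entry Y i k)"
      using assms unfolding quad_form_def
      by (auto simp: entry_mult_op_of[of P d] op_of.rep_eq sum_distrib_left mult_ac intro!: sum.cong)
    finally show ?thesis by (metis Re_sum)
  qed
  moreover have "inner Y (op_of P * Y) = (\<Sum>k<N. \<Sum>i<N. Re (cnj (entry Y i k) * entry (op_of P * Y) i k))"
    using assms unfolding inner_fmat_def
    by (subst rtr_mult_bounded[of N]) (auto intro!: bounded_by_adj bounded_by_times bounded_by_op_of simp: adj.rep_eq)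
  ultimately show ?thesis by simp
qed

lemma pos_op_of_iff: "P \<in> carrier_mat d d \<Longrightarrow> pos (op_of P) \<longleftrightarrow> psd d P"
proof
  assume P: "P \<in> carrier_mat d d" and "psd d P"
  then have herm: "adj (op_of P) = op_of P"
    by (intro fmat_eqI) (auto simp: adj.rep_eq op_of.rep_eq psd_hermitian[OF \<open>psd d P\<close>, symmetric])
  show "pos (op_of P)"
  proof (rule posI[OF herm])
    fix Y
    obtain M where "bounded_by M Y" using ex_bounded_by by blast
    then have "bounded_by (max d M) Y" by (rule bounded_by_mono) simp
    with P \<open>psd d P\<close> show "0 \<le> inner Y (op_of P * Y)"
      by (subst Re_quad_form_column[of P d "max d M"])
        (auto simp: psd_iff_quad_form less_eq_complex_def intro!: sum_nonneg)
  qed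
next
  assume P: "P \<in> carrier_mat d d" and pos: "pos (op_of P)"
  have herm: "P $$ (j, i) = cnj (P $$ (i, j))" if "i < d" "j < d" for i j
    using arg_cong[OF pos_adj[OF pos], of "\<lambda>A. entry A j i"] that P by (simp add: adj.rep_eq op_of.rep_eq)
  have "0 \<le> quad_form P v" for v
  proof -
    have "cnj (quad_form P v) = (\<Sum>i<d. \<Sum>j<d. P $$ (j, i) * v i * cnj (v j))"
      using P unfolding quad_form_def cnj_sum by (auto simp: herm[symmetric] mult_ac intro!: sum.cong)
    also have "\<dots> = quad_form P v" using P unfolding quad_form_def by (subst sum.swap) simp
    finally have "Im (quad_form P v) = 0" by (simp add: complex_eq_iff)
    \<comment> \<open>The vector is tested as the first column of a matrix; the size
      \<open>Suc d\<close> makes this column exist even for \<open>d = 0\<close>.\<close>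
    define V where "V = op_of (mat (Suc d) (Suc d) (\<lambda>(i, j). if j = 0 then v i else 0))"
    have V: "bounded_by (Suc d) V" unfolding V_def by (rule bounded_by_op_of) auto
    have "0 \<le> (\<Sum>k<Suc d. Re (quad_form P (\<lambda>i. entry V i k)))"
      using pos_inner[OF pos, of V] Re_quad_form_column[OF P _ V] by simp
    also have "\<dots> = (\<Sum>k<Suc d. if k = 0 then Re (quad_form P v) else 0)"
      using P unfolding quad_form_def V_def by (intro sum.cong) (auto simp: op_of.rep_eq)
    finally have "0 \<le> Re (quad_form P v)" by (simp split: if_splits)
    with \<open>Im (quad_form P v) = 0\<close> show ?thesis by (simp add: less_eq_complex_def)
  qed
  with P show "psd d P" by (simp add: psd_iff_quad_form)
qed

lemma pos_op_of: "psd d P \<Longrightarrow> pos (op_of P)"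
  using pos_op_of_iff psd_def by blast

lemma psd_mat_of: "pos A \<Longrightarrow> fid d * A * fid d = A \<Longrightarrow> psd d (mat_of d d A)"
  using pos_op_of_iff[of "mat_of d d A" d] by (simp add: op_of_mat_of)

text \<open>Vectors are matrices supported on the first column, which is the meaning of
  \<open>V * fid 1 = V\<close>. A single nonzero eigenvalue is all that the maximality argument in
  \<open>spectral\<close> asks for.\<close>

lemma hermitian_nonzero_eigenvalue:
  assumes B: "adj B = B" "B \<noteq> 0"
  shows "\<exists>\<mu> V. \<mu> \<noteq> 0 \<and> V \<noteq> 0 \<and> V * fid 1 = V \<and> B * V = \<mu> *\<^sub>R V"
proof -
  obtain N where N: "bounded_by N B" using ex_bounded_by by blast
  define M where "M = mat_of N N B"
  have M: "M \<in> carrier_mat N N" and opM: "op_of M = B"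
    by (simp_all add: M_def op_of_mat_of_bounded[OF N])
  obtain es where es: "char_poly M = (\<Prod>e\<leftarrow>es. [:- e, 1:])"
    using char_poly_factorized[OF M] by auto
  obtain T P Q where "schur_decomposition M es = (T, P, Q)" by (metis prod_cases3)
  from schur_decomposition[OF M es this]
  have sim: "similar_mat_wit M T P Q" and T: "upper_triangular T" and diag: "diag_mat T = es" by auto
  note w = similar_mat_witD2[OF M sim]
  \<comment> \<open>Otherwise the triangular \<open>T\<close> has zero diagonal, so that \<open>\<parallel>B\<parallel>\<^sup>2 = Tr B\<^sup>2 = Tr T\<^sup>2 = 0\<close>.\<close>
  have "\<exists>e\<in>set es. e \<noteq> 0"
  proof (rule ccontr)
    assume *: "\<not> (\<exists>e\<in>set es. e \<noteq> 0)"
    have T0: "T $$ (i, j) = 0" if "i < N" "j \<le> i" for i j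
    proof (cases "j = i")
      case True
      have "T $$ (i, i) \<in> set (diag_mat T)" using w(5) that by (auto simp: diag_mat_def)
      with * diag True show ?thesis by auto
    next
      case False
      with T w(5) that show ?thesis by (auto simp: upper_triangular_def)
    qed
    have opB: "B = op_of P * op_of T * op_of Q"
      using w(5-7) by (simp flip: opM add: w(3) op_of_mult mult.assoc)
    have QP: "op_of Q * op_of P = fid N"
      using w by (simp flip: op_of_mult)
    have "(norm B)\<^sup>2 = rtr (B * B)" using B(1) rtr_adj_mult[of B] by simp
    also have "\<dots> = rtr (op_of P * (op_of T * (op_of Q * op_of P) * op_of T * op_of Q))"
      by (simp add: opB mult.assoc)
    also have "\<dots> = rtr (op_of T * (op_of Q * op_of P) * op_of T * (op_of Q * op_of P))"
      by (subst rtr_comm) (simp add: mult.assoc)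
    also have "\<dots> = rtr (op_of T * op_of T)"
      using w(5) by (simp add: QP op_of_mult_fid mult.assoc)
    also have "\<dots> = (\<Sum>i<N. \<Sum>j<N. Re (T $$ (i, j) * T $$ (j, i)))"
      using w by (simp add: rtr_mult_bounded[of N] bounded_by_op_of op_of.rep_eq)
    also have "\<dots> = 0"
    proof (intro sum.neutral ballI)
      fix i j assume "i \<in> {..<N}" "j \<in> {..<N}"
      then show "Re (T $$ (i, j) * T $$ (j, i)) = 0"
        using T0[of i j] T0[of j i] by (cases "j \<le> i") auto
    qed
    finally show False using B(2) by simp
  qed
  then obtain e where e: "e \<in> set es" "e \<noteq> 0" by blast
  then have "poly (char_poly M) e = 0" unfolding es by (induction es) auto
  then obtain v where v: "v \<in> carrier_vec N" "v \<noteq> 0\<^sub>v N" "M *\<^sub>v v = e \<cdot>\<^sub>v v"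
    using eigenvalue_root_char_poly[OF M] M unfolding eigenvalue_def eigenvector_def by auto
  have Mv: "(\<Sum>j<N. M $$ (i, j) * v $ j) = e * v $ i" if "i < N" for i
    using arg_cong[OF v(3), of "\<lambda>w. w $ i"] that M v(1)
    by (simp add: scalar_prod_def atLeast0LessThan)
  define V where "V = op_of (mat N 1 (\<lambda>(i, j). v $ i))"
  have entV: "entry V i j = (if i < N \<and> j = 0 then v $ i else 0)" for i j
    by (simp add: V_def op_of.rep_eq)
  have herm: "M $$ (j, i) = cnj (M $$ (i, j))" if "i < N" "j < N" for i j
    using arg_cong[OF B(1), of "\<lambda>A. entry A j i"] that M by (simp flip: opM add: adj.rep_eq op_of.rep_eq)
  have V0: "V \<noteq> 0"
  proof
    assume "V = 0"
    then have "v $ i = 0" if "i < N" for i using entV[of i 0] that by (simp add: zero_fmat.rep_eq)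
    with v(1,2) show False by auto
  qed
  define s where "s = (\<Sum>i<N. (cmod (v $ i))\<^sup>2)"
  have "s \<noteq> 0"
  proof
    assume "s = 0"
    then have "\<forall>i<N. v $ i = 0" unfolding s_def by (simp add: sum_nonneg_eq_0_iff)
    with v(1,2) show False by auto
  qed
  have "quad_form M (\<lambda>i. v $ i) = (\<Sum>i<N. (\<Sum>j<N. M $$ (i, j) * v $ j) * cnj (v $ i))"
    using M by (simp add: quad_form_def sum_distrib_right)
  also have "\<dots> = (\<Sum>i<N. e * (v $ i * cnj (v $ i)))"
    by (intro sum.cong) (auto simp: Mv)
  also have "\<dots> = e * complex_of_real s"
    by (simp add: s_def complex_norm_square sum_distrib_left del: of_real_power)
  finally have q: "quad_form M (\<lambda>i. v $ i) = e * complex_of_real s" .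
  \<comment> \<open>The form is real by Hermiticity and equals \<open>e\<close> times the nonzero
    real number \<open>s\<close>, so \<open>e\<close> is real.\<close>
  have "cnj (quad_form M (\<lambda>i. v $ i)) = quad_form M (\<lambda>i. v $ i)"
  proof -
    have "cnj (quad_form M (\<lambda>i. v $ i)) = (\<Sum>i<N. \<Sum>j<N. M $$ (j, i) * v $ i * cnj (v $ j))"
      using M unfolding quad_form_def cnj_sum by (auto simp: herm[symmetric] mult_ac intro!: sum.cong)
    also have "\<dots> = quad_form M (\<lambda>i. v $ i)" using M unfolding quad_form_def by (subst sum.swap) simp
    finally show ?thesis .
  qed
  with \<open>s \<noteq> 0\<close> have "Im e = 0" unfolding q by (simp add: complex_eq_iff)
  then have e_real: "e = complex_of_real (Re e)" by (simp add: complex_eq_iff)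
  have "B * V = Re e *\<^sub>R V"
  proof (rule fmat_eqI)
    fix i j
    have "entry (B * V) i j = (if i < N \<and> j = 0 then e * v $ i else 0)"
    proof -
      have "entry (B * V) i j = (\<Sum>k<N. entry B i k * entry V k j)" by (rule entry_times[OF N])
      also have "\<dots> = (if i < N \<and> j = 0 then \<Sum>k<N. M $$ (i, k) * v $ k else 0)"
        using M by (auto simp flip: opM simp: entV op_of.rep_eq)
      finally show ?thesis by (simp add: Mv)
    qed
    also have "\<dots> = entry (Re e *\<^sub>R V) i j"
      by (subst e_real) (simp add: scaleR_fmat.rep_eq entV scaleR_conv_of_real)
    finally show "entry (B * V) i j = entry (Re e *\<^sub>R V) i j" .
  qed
  moreover have "V * fid 1 = V" by (rule fmat_eqI) (simp add: entry_mult_fid entV)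
  moreover have "Re e \<noteq> 0" using e(2) e_real by auto
  ultimately show ?thesis using V0 by blast
qed

section \<open>Square roots, contractions and Uhlmann's theorem\<close>

lemma rank_one_hermitian:
  assumes "adj X = X" "X * fid 1 = X"
  shows "X = rtr X *\<^sub>R fid 1"
proof -
  have X: "entry X i j = 0" if "0 < i \<or> 0 < j" for i j
  proof -
    have col: "entry X i j = 0" if "0 < j" for i j
      using arg_cong[OF assms(2), of "\<lambda>A. entry A i j"] that by (simp add: entry_mult_fid split: if_splits)
    have "entry X i j = cnj (entry X j i)"
      using arg_cong[OF assms(1), of "\<lambda>A. entry A i j"] by (simp add: adj.rep_eq)
    with col that show ?thesis by (metis complex_cnj_zero)
  qed
  then have "bounded_by 1 X" by (metis bounded_by_def gr0I less_one)
  then have "rtr X = Re (entry X 0 0)" by (simp add: rtr_bounded)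
  moreover have "Im (entry X 0 0) = 0"
    using arg_cong[OF assms(1), of "\<lambda>A. entry A 0 0"] by (simp add: adj.rep_eq complex_eq_iff)
  ultimately have "entry X i j = entry (rtr X *\<^sub>R fid 1) i j" for i j
    using X[of i j] by (cases "i = 0 \<and> j = 0") (auto simp: scaleR_fmat.rep_eq fid.rep_eq complex_eq_iff)
  then show ?thesis by (rule fmat_eqI)
qed

lemma column_adj_mult: "V * fid 1 = V \<Longrightarrow> adj V * V = (norm V)\<^sup>2 *\<^sub>R fid 1"
  using rank_one_hermitian[of "adj V * V"] by (simp add: mult.assoc rtr_adj_mult)

definition orthonormal_columns :: "nat \<Rightarrow> (nat \<Rightarrow> fmat) \<Rightarrow> bool" where
  "orthonormal_columns k v \<longleftrightarrow>
     (\<forall>i<k. v i * fid 1 = v i) \<and> (\<forall>i<k. \<forall>j<k. adj (v i) * v j = (if i = j then fid 1 else 0))"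

definition diag_op :: "nat \<Rightarrow> (nat \<Rightarrow> fmat) \<Rightarrow> (nat \<Rightarrow> real) \<Rightarrow> fmat" where
  "diag_op k v c = (\<Sum>i<k. c i *\<^sub>R (v i * adj (v i)))"

lemma adj_diag_op [simp]: "adj (diag_op k v c) = diag_op k v c"
  by (simp add: diag_op_def)

lemma diag_op_column:
  assumes "orthonormal_columns k v" "j < k"
  shows "diag_op k v c * v j = c j *\<^sub>R v j"
proof -
  have "diag_op k v c * v j = (\<Sum>i<k. c i *\<^sub>R (v i * (adj (v i) * v j)))"
    by (simp add: diag_op_def sum_distrib_right mult.assoc)
  also have "\<dots> = (\<Sum>i<k. if i = j then c j *\<^sub>R v j else 0)"
    using assms by (intro sum.cong) (auto simp: orthonormal_columns_def)
  finally show ?thesis using assms(2) by simp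
qed

lemma diag_op_mult:
  assumes "orthonormal_columns k v"
  shows "diag_op k v c * diag_op k v c' = diag_op k v (\<lambda>i. c i * c' i)"
proof -
  have "diag_op k v c * diag_op k v c' = (\<Sum>j<k. c' j *\<^sub>R (diag_op k v c * v j * adj (v j)))"
    by (simp add: diag_op_def[of k v c'] sum_distrib_left mult.assoc)
  also have "\<dots> = (\<Sum>j<k. (c j * c' j) *\<^sub>R (v j * adj (v j)))"
    using diag_op_column[OF assms] by (intro sum.cong) (auto simp: mult.commute)
  finally show ?thesis by (simp add: diag_op_def)
qed

lemma pos_diag_op: "(\<And>i. i < k \<Longrightarrow> 0 \<le> c i) \<Longrightarrow> pos (diag_op k v c)"
  unfolding diag_op_def by (intro pos_sum pos_scaleR pos_mult_adj) simp

text \<open>The projection \<open>Q\<close> onto the columns lies inside \<open>fid N\<close>, so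
  \<open>fid N - Q\<close> is again a projection and its trace \<open>N - k\<close> is a squared
  norm.\<close>

lemma orthonormal_columns_le:
  assumes "orthonormal_columns k v" "\<And>i. i < k \<Longrightarrow> fid N * v i = v i"
  shows "k \<le> N"
proof -
  define Q where "Q = diag_op k v (\<lambda>_. 1)"
  have Q: "Q * Q = Q" "adj Q = Q" unfolding Q_def by (simp_all add: diag_op_mult[OF assms(1)])
  have "fid N * Q = Q"
    unfolding Q_def diag_op_def sum_distrib_left
    by (intro sum.cong) (auto simp: assms(2) simp flip: mult.assoc)
  then have "adj (fid N * Q) = adj Q" by simp
  then have "Q * fid N = Q" using Q(2) by simp
  have "rtr Q = (\<Sum>i<k. rtr (adj (v i) * v i))"
    unfolding Q_def diag_op_def by (simp add: rtr_sum) (simp add: rtr_comm)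
  also have "\<dots> = k" using assms(1) by (simp add: orthonormal_columns_def)
  finally have "rtr Q = k" .
  have "0 \<le> rtr (adj (fid N - Q) * (fid N - Q))" by (simp only: rtr_adj_mult) simp
  also have "adj (fid N - Q) * (fid N - Q) = fid N - Q"
    using \<open>fid N * Q = Q\<close> \<open>Q * fid N = Q\<close> Q by (simp add: algebra_simps)
  also have "rtr (fid N - Q) = N - real k" by (simp add: rtr_diff \<open>rtr Q = k\<close>)
  finally show ?thesis by simp
qed

text \<open>Take an orthonormal family of eigenvectors with positive eigenvalues of maximal size. If
  it left a remainder \<open>B\<close>, an eigenvector of \<open>B\<close> with nonzero eigenvalue
  would be orthogonal to the family and also an eigenvector of \<open>A\<close>, with positive
  eigenvalue, and would extend the family. Kernel vectors do not occur, so no ambient dimension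
  enters the statement.\<close>

theorem spectral:
  assumes A: "pos A"
  obtains k v c where "orthonormal_columns k v" "\<And>i. i < k \<Longrightarrow> 0 < c i" "A = diag_op k v c"
proof -
  obtain N where N: "bounded_by N A" using ex_bounded_by by blast
  define fam where "fam k \<longleftrightarrow> (\<exists>v c. orthonormal_columns k v \<and> (\<forall>i<k. 0 < c i \<and> A * v i = c i *\<^sub>R v i))"
    for k
  have "k \<le> N" if fam: "fam k" for k
  proof -
    obtain v c where v: "orthonormal_columns k v" "\<And>i. i < k \<Longrightarrow> 0 < (c i :: real)"
        "\<And>i. i < k \<Longrightarrow> A * v i = c i *\<^sub>R v i"
      using fam unfolding fam_def by blast
    have "fid N * v i = v i" if "i < k" for i
    proof -
      have "fid N * (c i *\<^sub>R v i) = c i *\<^sub>R v i"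
        using fid_mult_bounded[OF N] v(3)[OF that] by (metis mult.assoc)
      with v(2)[OF that] show ?thesis by simp
    qed
    with v(1) show ?thesis by (rule orthonormal_columns_le)
  qed
  moreover have "fam 0" by (simp add: fam_def orthonormal_columns_def)
  ultimately obtain k where k: "fam k" "\<And>l. fam l \<Longrightarrow> l \<le> k"
    by (metis GreatestI_nat Greatest_le_nat)
  obtain v c where v: "orthonormal_columns k v" "\<And>i. i < k \<Longrightarrow> 0 < (c i :: real)"
      "\<And>i. i < k \<Longrightarrow> A * v i = c i *\<^sub>R v i"
    using k(1) unfolding fam_def by blast
  define B where "B = A - diag_op k v c"
  have "B = 0"
  proof (rule ccontr)
    assume "B \<noteq> 0"
    moreover have adjB: "adj B = B" using pos_adj[OF A] by (simp add: B_def)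
    ultimately obtain \<mu> V where V: "\<mu> \<noteq> 0" "V \<noteq> 0" "V * fid 1 = V" "B * V = \<mu> *\<^sub>R V"
      using hermitian_nonzero_eigenvalue by blast
    \<comment> \<open>\<open>B\<close> is self-adjoint and kills each \<open>v i\<close>, so its
      range is orthogonal to them.\<close>
    have orth: "adj (v i) * V = 0" if "i < k" for i
    proof -
      have "B * v i = 0" using v(3)[OF that] diag_op_column[OF v(1) that] by (simp add: B_def algebra_simps)
      then have "adj (v i) * B = 0" using adjB adj_simps(6)[of B "v i"] by simp
      then have "\<mu> *\<^sub>R (adj (v i) * V) = 0" using V(4) by (metis mult.assoc mult_scaleR_right mult_zero_left)
      with V(1) show ?thesis by simp
    qed
    have "diag_op k v c * V = 0"
      unfolding diag_op_def sum_distrib_right by (intro sum.neutral) (auto simp: mult.assoc orth)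
    then have AV: "A * V = \<mu> *\<^sub>R V" using V(4) by (simp add: B_def algebra_simps)
    have "0 \<le> \<mu> * (norm V)\<^sup>2" using pos_inner[OF A, of V] by (simp add: AV power2_norm_eq_inner)
    with V(1,2) have "0 < \<mu>" by (simp add: zero_le_mult_iff)
    define w where "w = V /\<^sub>R norm V"
    have "inverse (norm V) * (inverse (norm V) * (norm V * norm V)) = 1"
      using V(2) by (simp add: field_simps)
    then have w: "A * w = \<mu> *\<^sub>R w" "w * fid 1 = w" "adj w * w = fid 1"
      using V by (simp_all add: w_def AV column_adj_mult power2_eq_square)
    have vw: "adj (v i) * w = 0" "adj w * v i = 0" if "i < k" for i
    proof -
      show "adj (v i) * w = 0" using orth[OF that] by (simp add: w_def)
      have "adj V * v i = 0" using arg_cong[OF orth[OF that], of adj] by simp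
      then show "adj w * v i = 0" by (simp add: w_def)
    qed
    have "fam (Suc k)"
      unfolding fam_def
    proof (intro exI conjI)
      show "orthonormal_columns (Suc k) (v(k := w))"
        using v(1) w vw by (auto simp: orthonormal_columns_def less_Suc_eq)
      show "\<forall>i<Suc k. 0 < (c(k := \<mu>)) i \<and> A * (v(k := w)) i = (c(k := \<mu>)) i *\<^sub>R (v(k := w)) i"
        using v w \<open>0 < \<mu>\<close> by (auto simp: less_Suc_eq)
    qed
    with k(2) show False by fastforce
  qed
  then have "A = diag_op k v c" by (simp add: B_def)
  with v that show ?thesis by blast
qed

text \<open>A self-adjoint generalized inverse commuting with \<open>S\<close>. Applied to square
  roots, it plays the part of the inverse root on the support.\<close>

definition pinv_of :: "fmat \<Rightarrow> fmat \<Rightarrow> bool" where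
  "pinv_of S N \<longleftrightarrow> adj N = N \<and> S * N = N * S \<and> S * N * S = S"

lemma pos_ex_sqrt:
  assumes "pos A"
  shows "\<exists>S. pos S \<and> S * S = A"
proof -
  obtain k v c where *: "orthonormal_columns k v" "\<And>i. i < k \<Longrightarrow> 0 < c i" "A = diag_op k v c"
    using spectral[OF assms] by blast
  have "diag_op k v (\<lambda>i. sqrt (c i)) * diag_op k v (\<lambda>i. sqrt (c i)) = A"
    unfolding diag_op_mult[OF *(1)] *(3) unfolding diag_op_def
    by (intro sum.cong) (auto simp: less_imp_le *(2))
  moreover have "pos (diag_op k v (\<lambda>i. sqrt (c i)))"
    by (rule pos_diag_op) (simp add: *(2) less_imp_le)
  ultimately show ?thesis by blast
qed

lemma pos_ex_pinv:
  assumes "pos S"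
  shows "\<exists>N. pinv_of S N"
proof -
  obtain k v c where *: "orthonormal_columns k v" "\<And>i. i < k \<Longrightarrow> 0 < c i" "S = diag_op k v c"
    using spectral[OF assms] by blast
  have "S * diag_op k v (\<lambda>i. inverse (c i)) * S = S"
    unfolding *(3) diag_op_mult[OF *(1)] unfolding diag_op_def
    by (intro sum.cong) (use *(2) in fastforce)+
  moreover have "S * diag_op k v (\<lambda>i. inverse (c i)) = diag_op k v (\<lambda>i. inverse (c i)) * S"
    unfolding *(3) diag_op_mult[OF *(1)] by (simp add: mult.commute)
  ultimately show ?thesis unfolding pinv_of_def by (metis adj_diag_op)
qed

lemma pos_mult_eq_0:
  assumes "pos A" "inner Y (A * Y) = 0"
  shows "A * Y = 0"
proof -
  obtain S where S: "pos S" "S * S = A" using pos_ex_sqrt[OF assms(1)] by blast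
  have "inner (S * Y) (S * Y) = inner Y (A * Y)"
    by (simp add: inner_mult_left pos_adj[OF S(1)] flip: S(2) mult.assoc)
  with assms(2) have "S * Y = 0" by simp
  then show ?thesis by (simp add: mult.assoc flip: S(2))
qed

text \<open>With \<open>D = R - Q\<close>, equal squares make \<open>D\<close> anticommute with
  \<open>R + Q\<close>, so the trace of \<open>D * (R + Q) * D\<close> is its own negative.
  Positivity then forces \<open>R * D = 0\<close> and \<open>Q * D = 0\<close>, hence
  \<open>D * D = 0\<close>.\<close>

lemma pos_sqrt_unique:
  assumes R: "pos R" and Q: "pos Q" and eq: "R * R = Q * Q"
  shows "R = Q"
proof -
  define D where "D = R - Q"
  have adjD: "adj D = D" by (simp add: D_def pos_adj[OF R] pos_adj[OF Q])
  have "D * (R + Q) + (R + Q) * D = 2 *\<^sub>R (R * R - Q * Q)"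
    by (simp add: D_def algebra_simps scaleR_2)
  then have anti: "D * (R + Q) = - ((R + Q) * D)" by (simp add: eq eq_neg_iff_add_eq_0)
  have "rtr (D * ((R + Q) * D)) = rtr (D * (R + Q) * D)" by (simp add: mult.assoc)
  also have "\<dots> = - rtr ((R + Q) * D * D)" unfolding anti by (simp add: rtr_uminus)
  also have "rtr ((R + Q) * D * D) = rtr (D * ((R + Q) * D))" by (rule rtr_comm)
  finally have "inner D ((R + Q) * D) = 0" by (simp add: inner_fmat_def adjD)
  then have "inner D (R * D) + inner D (Q * D) = 0" by (simp add: distrib_right inner_add_right)
  with pos_inner[OF R, of D] pos_inner[OF Q, of D]
  have "inner D (R * D) = 0" "inner D (Q * D) = 0" by linarith+
  then have "R * D = 0" "Q * D = 0" using pos_mult_eq_0 R Q by blast+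
  then have "D * D = 0" by (simp add: D_def left_diff_distrib)
  then have "(norm D)\<^sup>2 = 0" using rtr_adj_mult[of D] by (simp add: adjD)
  then show ?thesis by (simp add: D_def)
qed

text \<open>\<open>S\<close> equals \<open>S * S * N\<close>, so a root has no larger range than its
  square. This keeps the square root of a \<open>d\<close>-dimensional operator in dimension
  \<open>d\<close>.\<close>

lemma pinv_support:
  assumes "pinv_of S N" "fid d * (S * S) = S * S"
  shows "fid d * S = S"
proof -
  have "S = S * S * N" using assms(1) unfolding pinv_of_def by (metis mult.assoc)
  with assms(2) show ?thesis by (metis mult.assoc)
qed

lemma psd_ex1_sqrt:
  assumes P: "psd d P"
  shows "\<exists>!R. psd d R \<and> R * R = P"
proof (rule ex_ex1I)
  have Pc: "P \<in> carrier_mat d d" using P by (simp add: psd_def)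
  obtain S where S: "pos S" "S * S = op_of P" using pos_ex_sqrt[OF pos_op_of[OF P]] by blast
  obtain N where "pinv_of S N" using pos_ex_pinv[OF S(1)] by blast
  then have "fid d * S = S" by (rule pinv_support) (use S Pc in \<open>simp add: fid_mult_op_of\<close>)
  then have "S * fid d = S" using pos_adj[OF S(1)] adj_simps(6)[of "fid d" S] by simp
  have op: "op_of (mat_of d d S) = S" by (simp add: op_of_mat_of \<open>fid d * S = S\<close> \<open>S * fid d = S\<close>)
  have "psd d (mat_of d d S)" using S(1) \<open>fid d * S = S\<close> \<open>S * fid d = S\<close> by (simp add: psd_mat_of)
  moreover have "mat_of d d S * mat_of d d S = P"
  proof (rule op_of_inject)
    have "op_of (mat_of d d S * mat_of d d S) = op_of (mat_of d d S) * op_of (mat_of d d S)"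
      by (rule op_of_mult) (simp add: mat_of_def)
    then show "op_of (mat_of d d S * mat_of d d S) = op_of P" by (simp add: op S(2))
  qed (use Pc in \<open>auto simp: mat_of_def\<close>)
  ultimately show "\<exists>R. psd d R \<and> R * R = P" by blast
next
  fix R Q assume "psd d R \<and> R * R = P" "psd d Q \<and> Q * Q = P"
  then have *: "psd d R" "psd d Q" "R * R = Q * Q" "R \<in> carrier_mat d d" "Q \<in> carrier_mat d d"
    by (auto simp: psd_def)
  have "op_of R * op_of R = op_of Q * op_of Q"
    using arg_cong[OF *(3), of op_of] *(4,5) by (simp add: op_of_mult)
  with * have "op_of R = op_of Q" using pos_sqrt_unique pos_op_of by blast
  with * show "R = Q" by (intro op_of_inject) auto
qed

lemma psd_sqrt:
  assumes "psd d P"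
  shows "psd d (psd_sqrt P)" "psd_sqrt P * psd_sqrt P = P"
proof -
  have "dim_row P = d" using assms by (auto simp: psd_def)
  with theI'[OF psd_ex1_sqrt[OF assms]] show "psd d (psd_sqrt P)" "psd_sqrt P * psd_sqrt P = P"
    unfolding psd_sqrt_def by auto
qed

lemma op_of_psd_sqrt:
  assumes "psd d P"
  shows "pos (op_of (psd_sqrt P))" "op_of (psd_sqrt P) * op_of (psd_sqrt P) = op_of P"
proof -
  note s = psd_sqrt[OF assms]
  show "pos (op_of (psd_sqrt P))" by (rule pos_op_of[OF s(1)])
  have "psd_sqrt P \<in> carrier_mat d d" using s(1) by (simp add: psd_def)
  then show "op_of (psd_sqrt P) * op_of (psd_sqrt P) = op_of P"
    using arg_cong[OF s(2), of op_of] by (auto simp: op_of_mult)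
qed

section \<open>Contractions and factorizations through positive operators\<close>

definition contr :: "fmat \<Rightarrow> bool" where
  "contr U \<longleftrightarrow> (\<forall>Y. norm (U * Y) \<le> norm Y)"

lemma contrD: "contr U \<Longrightarrow> norm (U * Y) \<le> norm Y"
  by (simp add: contr_def)

lemma contr_mult: "contr U \<Longrightarrow> contr V \<Longrightarrow> contr (U * V)"
  unfolding contr_def by (metis mult.assoc order_trans)

lemma norm_le_of_square_le:
  "(norm X)\<^sup>2 \<le> norm Y * norm X \<Longrightarrow> norm X \<le> norm Y" for X Y :: fmat
  by (cases "X = 0") (simp_all add: power2_eq_square)

lemma contr_adj:
  assumes "contr U"
  shows "contr (adj U)"
  unfolding contr_def
proof
  fix Y
  have "(norm (adj U * Y))\<^sup>2 = inner Y (U * (adj U * Y))"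
    by (simp add: power2_norm_eq_inner inner_mult_left)
  also have "\<dots> \<le> norm Y * norm (U * (adj U * Y))" by (rule norm_cauchy_schwarz)
  also have "\<dots> \<le> norm Y * norm (adj U * Y)" by (intro mult_left_mono contrD assms) simp
  finally show "norm (adj U * Y) \<le> norm Y"
    by (rule norm_le_of_square_le)
qed

lemma contr_cnj:
  assumes "contr U"
  shows "contr (cnj_fmat U)"
  unfolding contr_def
proof
  fix Y
  have "norm (cnj_fmat U * Y) = norm (U * cnj_fmat Y)"
    by (subst norm_cnj_fmat[symmetric]) simp
  also have "\<dots> \<le> norm Y" using contrD[OF assms, of "cnj_fmat Y"] by simp
  finally show "norm (cnj_fmat U * Y) \<le> norm Y" .
qed

lemma contr_projection:
  assumes "adj E = E" "E * E = E"
  shows "contr E"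
  unfolding contr_def
proof
  fix Y
  have "(norm (E * Y))\<^sup>2 = inner Y (E * Y)"
    by (simp add: power2_norm_eq_inner inner_mult_left assms flip: mult.assoc)
  also have "\<dots> \<le> norm Y * norm (E * Y)" by (rule norm_cauchy_schwarz)
  finally show "norm (E * Y) \<le> norm Y"
    by (rule norm_le_of_square_le)
qed

lemma contr_fid: "contr (fid d)"
  by (rule contr_projection) simp_all

text \<open>Douglas factorization: an operator dominated in norm by \<open>S\<close> is a
  contraction times \<open>S\<close>, and a generalized inverse of \<open>S\<close> exhibits the
  contraction.\<close>

lemma factor_through_pos:
  assumes N: "pinv_of S N" and S: "pos S" and le: "\<And>Y. norm (X * Y) \<le> norm (S * Y)"
  shows "contr (X * N)" "X * N * S = X"
proof -
  have n: "adj N = N" "S * N = N * S" "S * N * S = S" using N by (auto simp: pinv_of_def)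
  have "contr (S * N)"
    by (rule contr_projection) (simp_all add: n(1) pos_adj[OF S] n(2)[symmetric], metis mult.assoc n(3))
  then show "contr (X * N)" using le unfolding contr_def by (metis mult.assoc order_trans)
  obtain M where M: "bounded_by M X" "bounded_by M S" using ex_bounded_by2 by blast
  \<comment> \<open>\<open>fid M - N * S\<close> maps into the kernel of \<open>S\<close>, on which
    \<open>X\<close> vanishes by the domination hypothesis.\<close>
  have "S * (fid M - N * S) = 0" using n(3) by (simp add: right_diff_distrib mult_fid_bounded[OF M(2)] mult.assoc)
  with le[of "fid M - N * S"] have "X * (fid M - N * S) = 0" by simp
  then show "X * N * S = X" by (simp add: right_diff_distrib mult_fid_bounded[OF M(1)] mult.assoc)
qed

text \<open>Writing \<open>H\<close> as \<open>K * K\<close> and moving one root around the trace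
  places the contraction between two factors of equal norm.\<close>

lemma rtr_contr_le:
  assumes "contr C" "pos H"
  shows "rtr (C * H) \<le> rtr H"
proof -
  obtain K where K: "pos K" "K * K = H" using pos_ex_sqrt[OF assms(2)] by blast
  have "rtr (C * H) = rtr ((C * K) * K)" by (simp add: K(2) mult.assoc)
  also have "\<dots> = rtr (K * (C * K))" by (rule rtr_comm)
  also have "\<dots> \<le> norm K * norm (C * K)" by (rule rtr_mult_le)
  also have "\<dots> \<le> norm K * norm K" by (intro mult_left_mono contrD assms) simp
  also have "\<dots> = rtr H" using rtr_adj_mult[of K] by (simp add: K pos_adj power2_eq_square)
  finally show ?thesis .
qed

section \<open>Trace norm and Uhlmann's theorem\<close>

lemma trace_norm_op:
  assumes "X \<in> carrier_mat d d"
  obtains H where "pos H" "H * H = adj (op_of X) * op_of X" "trace_norm X = rtr H"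
proof
  let ?P = "mat_adjoint X * X"
  have opP: "op_of ?P = adj (op_of X) * op_of X" using assms by (simp add: op_of_mult)
  have "?P \<in> carrier_mat d d" using assms by (auto intro!: carrier_matI)
  with opP have P: "psd d ?P" using pos_op_of_iff[of ?P d] pos_adj_mult[of "op_of X"] by simp
  show "pos (op_of (psd_sqrt ?P))" "op_of (psd_sqrt ?P) * op_of (psd_sqrt ?P) = adj (op_of X) * op_of X"
    using op_of_psd_sqrt[OF P] opP by simp_all
  have "psd_sqrt ?P \<in> carrier_mat d d" using psd_sqrt(1)[OF P] by (simp add: psd_def)
  then show "trace_norm X = rtr (op_of (psd_sqrt ?P))"
    by (auto simp: trace_norm_def rtr_op_of)
qed

lemma norm_mult_gram: "adj X * X = A \<Longrightarrow> (norm (X * Z))\<^sup>2 = inner Z (A * Z)"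
  by (auto simp: power2_norm_eq_inner inner_mult_left mult.assoc)

lemma psd_sqrt_factor:
  assumes P: "psd d P" and le: "\<And>Z. (norm (X * Z))\<^sup>2 \<le> inner Z (op_of P * Z)"
  obtains N where "adj N = N" "N * op_of P = op_of (psd_sqrt P)"
    "contr (X * N)" "X * N * op_of (psd_sqrt P) = X"
proof -
  note s = op_of_psd_sqrt[OF P]
  obtain N where N: "pinv_of (op_of (psd_sqrt P)) N" using pos_ex_pinv[OF s(1)] by blast
  have "norm (X * Z) \<le> norm (op_of (psd_sqrt P) * Z)" for Z
    by (rule power2_le_imp_le)
      (use le[of Z] norm_mult_gram[of "op_of (psd_sqrt P)"] in \<open>simp_all add: pos_adj[OF s(1)] s(2)\<close>)
  from factor_through_pos[OF N s(1) this] show ?thesis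
    using N s(2) that unfolding pinv_of_def by (metis mult.assoc)
qed

text \<open>Polar decomposition: \<open>H\<close> is the modulus of \<open>T\<close>, and
  \<open>op_of T * N\<close>, with \<open>N\<close> a generalized inverse of \<open>H\<close>, is
  the polar factor.\<close>

lemma trace_norm_polar:
  assumes "T \<in> carrier_mat d d"
  obtains H N where "pos H" "trace_norm T = rtr H" "contr (op_of T * N)" "op_of T * N * H = op_of T"
    "adj (op_of T * N) * op_of T = H"
proof -
  obtain H where H: "pos H" "H * H = adj (op_of T) * op_of T" "trace_norm T = rtr H"
    using trace_norm_op[OF assms] by blast
  obtain N where N: "pinv_of H N" using pos_ex_pinv[OF H(1)] by blast
  have "norm (op_of T * Z) \<le> norm (H * Z)" for Z
    by (rule power2_le_imp_le)
      (use norm_mult_gram[of "op_of T"] norm_mult_gram[of H] H in \<open>simp_all add: pos_adj\<close>)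
  note f = factor_through_pos[OF N H(1) this]
  have "adj (op_of T * N) * op_of T = N * (H * H)" using N by (simp add: pinv_of_def H(2) mult.assoc)
  also have "\<dots> = H" using N unfolding pinv_of_def by (metis mult.assoc)
  finally show ?thesis using H f that by blast
qed

lemma psd_sqrt_carrier: "psd d P \<Longrightarrow> psd_sqrt P \<in> carrier_mat d d"
  using psd_sqrt(1) by (simp add: psd_def)

text \<open>\<open>X\<close> is an exact purification of \<open>P\<close>, while the Gram operator
  of \<open>Y\<close> is merely dominated by \<open>Q\<close>: Douglas factorization still writes
  \<open>Y\<close> as a contraction times the root of \<open>Q\<close>. The bound by
  \<open>\<Gamma>\<close> relies on this slack.\<close>

lemma uhlmann_le:
  assumes P: "psd d P" and Q: "psd d Q"
    and X: "adj X * X = op_of P"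
    and Y: "\<And>Z. (norm (Y * Z))\<^sup>2 \<le> inner Z (op_of Q * Z)"
  shows "rtr (adj Y * X) \<le> trace_norm (psd_sqrt P * psd_sqrt Q)"
proof -
  let ?SP = "op_of (psd_sqrt P)" and ?SQ = "op_of (psd_sqrt Q)" and ?T = "psd_sqrt P * psd_sqrt Q"
  note carr = psd_sqrt_carrier[OF P] psd_sqrt_carrier[OF Q]
  have T: "?T \<in> carrier_mat d d" "op_of ?T = ?SP * ?SQ" using carr by (auto simp: op_of_mult)
  obtain NP where NP: "contr (X * NP)" "X * NP * ?SP = X"
    using psd_sqrt_factor[OF P] norm_mult_gram[OF X] by (metis order_refl)
  obtain NQ where NQ: "contr (Y * NQ)" "Y * NQ * ?SQ = Y" using psd_sqrt_factor[OF Q Y] by metis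
  obtain H N where H: "pos H" "trace_norm ?T = rtr H" "contr (op_of ?T * N)" "op_of ?T * N * H = op_of ?T"
    using trace_norm_polar[OF T(1)] by metis
  let ?C = "adj (Y * NQ) * (X * NP)"
  have "rtr (adj Y * X) = rtr (adj (Y * NQ * ?SQ) * (X * NP * ?SP))" by (simp only: NP NQ)
  also have "\<dots> = rtr (?SQ * (?C * ?SP))" by (simp add: mult.assoc pos_adj[OF op_of_psd_sqrt(1)[OF Q]])
  also have "\<dots> = rtr (?C * ?SP * ?SQ)" by (rule rtr_comm)
  also have "\<dots> = rtr (?C * (op_of ?T * N * H))" by (simp only: H(4)) (simp add: T(2) mult.assoc)
  also have "\<dots> = rtr ((?C * (op_of ?T * N)) * H)" by (simp add: mult.assoc)
  also have "\<dots> \<le> rtr H" by (intro rtr_contr_le contr_mult contr_adj NP NQ H)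
  finally show ?thesis by (simp add: H(2))
qed

text \<open>Both purifications are prescribed, and the contraction is assembled from their polar
  factors and the adjoint polar factor of the product of the two roots.\<close>

lemma uhlmann_eq:
  assumes P: "psd d P" and Q: "psd d Q"
    and X: "adj X * X = op_of P" and Y: "adj Y * Y = op_of Q"
  shows "\<exists>U. contr U \<and> trace_norm (psd_sqrt P * psd_sqrt Q) = rtr (U * X * adj Y)"
proof -
  let ?SP = "op_of (psd_sqrt P)" and ?SQ = "op_of (psd_sqrt Q)" and ?T = "psd_sqrt P * psd_sqrt Q"
  note carr = psd_sqrt_carrier[OF P] psd_sqrt_carrier[OF Q]
  have T: "?T \<in> carrier_mat d d" "op_of ?T = ?SP * ?SQ" using carr by (auto simp: op_of_mult)
  obtain NP where NP: "adj NP = NP" "NP * op_of P = ?SP" "contr (X * NP)"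
    using psd_sqrt_factor[OF P] norm_mult_gram[OF X] by (metis order_refl)
  obtain NQ where NQ: "adj NQ = NQ" "NQ * op_of Q = ?SQ" "contr (Y * NQ)"
    using psd_sqrt_factor[OF Q] norm_mult_gram[OF Y] by (metis order_refl)
  obtain H N where H: "trace_norm ?T = rtr H" "contr (op_of ?T * N)" "adj (op_of ?T * N) * op_of ?T = H"
    using trace_norm_polar[OF T(1)] by metis
  have SP: "adj (X * NP) * X = ?SP" using NP X by (simp add: mult.assoc)
  have "adj (adj (Y * NQ) * Y) = adj ?SQ" using NQ Y by (simp add: mult.assoc)
  then have SQ: "adj Y * (Y * NQ) = ?SQ" by (simp add: pos_adj[OF op_of_psd_sqrt(1)[OF Q]])
  let ?U = "(Y * NQ) * (adj (op_of ?T * N) * adj (X * NP))"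
  have "rtr H = rtr (adj (op_of ?T * N) * (adj (X * NP) * X * (adj Y * (Y * NQ))))"
    by (simp only: SP SQ T(2)[symmetric] H(3))
  also have "\<dots> = rtr ((adj (op_of ?T * N) * (adj (X * NP) * (X * adj Y))) * (Y * NQ))"
    by (simp only: mult.assoc)
  also have "\<dots> = rtr (?U * X * adj Y)" by (subst rtr_comm) (simp only: mult.assoc)
  finally have "trace_norm ?T = rtr (?U * X * adj Y)" by (simp add: H(1))
  moreover have "contr ?U" by (intro contr_mult contr_adj NP NQ H)
  ultimately show ?thesis by blast
qed

section \<open>Characters and dual linear functions\<close>

unbundle no inner_syntax
unbundle no vec_syntax

lemma bits_eq_lists: "carrier_vec n = vec_of_list ` {xs :: bit list. set xs \<subseteq> UNIV \<and> length xs = n}"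
proof
  show "carrier_vec n \<subseteq> vec_of_list ` {xs :: bit list. set xs \<subseteq> UNIV \<and> length xs = n}"
  proof
    fix x :: "bit vec" assume "x \<in> carrier_vec n"
    then show "x \<in> vec_of_list ` {xs. set xs \<subseteq> UNIV \<and> length xs = n}"
      by (intro image_eqI[of _ _ "list_of_vec x"]) (auto simp: vec_list)
  qed
qed (auto intro!: carrier_vecI)

lemma UNIV_bit: "(UNIV :: bit set) = {0, 1}"
  by (auto intro: bit.exhaust)

lemma finite_bits [simp]: "finite (carrier_vec n :: bit vec set)"
  unfolding bits_eq_lists by (intro finite_imageI finite_lists_length_eq) (simp add: UNIV_bit)

lemma card_bits [simp]: "card (carrier_vec n :: bit vec set) = 2 ^ n"
proof -
  have "inj_on vec_of_list {xs :: bit list. set xs \<subseteq> UNIV \<and> length xs = n}"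
    by (rule inj_onI) (metis list_vec)
  then have "card (carrier_vec n :: bit vec set) = card {xs :: bit list. set xs \<subseteq> UNIV \<and> length xs = n}"
    unfolding bits_eq_lists by (rule card_image)
  also have "\<dots> = card (UNIV :: bit set) ^ n" by (intro card_lists_length_eq) (simp add: UNIV_bit)
  also have "card (UNIV :: bit set) = 2" by (simp add: UNIV_bit)
  finally show ?thesis .
qed

lemma bits_add_self [simp]: "x \<in> carrier_vec n \<Longrightarrow> x + x = (0\<^sub>v n :: bit vec)"
  by (rule eq_vecI) auto

lemma bits_add_cancel:
  "x \<in> carrier_vec n \<Longrightarrow> y \<in> carrier_vec n \<Longrightarrow> x + y + y = (x :: bit vec)"
  by (rule eq_vecI) (auto simp: add.assoc)

lemma bits_add_eq_0:
  assumes "x \<in> carrier_vec n" "y \<in> carrier_vec n"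
  shows "x + y = 0\<^sub>v n \<longleftrightarrow> x = (y :: bit vec)"
proof
  assume "x + y = 0\<^sub>v n"
  then have "x + y + y = 0\<^sub>v n + y" by simp
  with assms show "x = y" by (simp add: bits_add_cancel)
qed (use assms in simp)

definition chr :: "bit vec \<Rightarrow> bit vec \<Rightarrow> real" where
  "chr x z = (if x \<bullet> z = 0 then 1 else - 1)"

lemma chr_add_left:
  assumes "x \<in> carrier_vec n" "y \<in> carrier_vec n" "z \<in> carrier_vec n"
  shows "chr (x + y) z = chr x z * chr y z"
proof -
  have "(x + y) \<bullet> z = x \<bullet> z + y \<bullet> z" using assms by (rule add_scalar_prod_distrib)
  then show ?thesis unfolding chr_def by (cases "x \<bullet> z"; cases "y \<bullet> z") simp_all
qed

lemma chr_commute: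
  assumes "x \<in> carrier_vec n" "z \<in> carrier_vec n"
  shows "chr x z = chr z x"
  using assms by (simp add: chr_def comm_scalar_prod[OF assms])

lemma chr_add_right:
  assumes "x \<in> carrier_vec n" "y \<in> carrier_vec n" "z \<in> carrier_vec n"
  shows "chr z (x + y) = chr z x * chr z y"
  using chr_add_left[OF assms] chr_commute[of z n] assms by simp

lemma chr_square [simp]: "chr x z * chr x z = 1"
  by (simp add: chr_def)

lemma chr_zero [simp]: "z \<in> carrier_vec n \<Longrightarrow> chr (0\<^sub>v n) z = 1"
  by (simp add: chr_def)

text \<open>For nonzero \<open>x\<close>, adding the unit vector of a coordinate where
  \<open>x\<close> is 1 permutes the summands and reverses every sign.\<close>

lemma sum_chr:
  assumes x: "x \<in> carrier_vec n"
  shows "(\<Sum>z\<in>carrier_vec n. chr x z) = (if x = 0\<^sub>v n then 2 ^ n else 0)"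
proof (cases "x = 0\<^sub>v n")
  case True
  then show ?thesis by simp
next
  case False
  then obtain i where i: "i < n" "x $ i = 1" using x by (metis bit_not_zero_iff carrier_vecD eq_vecI index_zero_vec)
  let ?e = "unit_vec n i :: bit vec"
  have e: "?e \<in> carrier_vec n" "chr x ?e = - 1" using i x by (simp_all add: chr_def)
  have "(\<Sum>z\<in>carrier_vec n. chr x z) = (\<Sum>z\<in>carrier_vec n. chr x (z + ?e))"
    by (rule sum.reindex_bij_witness[of _ "\<lambda>z. z + ?e" "\<lambda>z. z + ?e"])
      (auto simp: bits_add_cancel[of _ n] simp del: assoc_add_vec)
  also have "\<dots> = - (\<Sum>z\<in>carrier_vec n. chr x z)"
    using e x by (simp add: chr_add_right sum_negf)
  finally show ?thesis using False by simp
qed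

lemma sum_chr_mult:
  assumes "z \<in> carrier_vec n" "z' \<in> carrier_vec n"
  shows "(\<Sum>x\<in>carrier_vec n. chr x z * chr x z') = (if z' = z then 2 ^ n else 0)"
proof -
  have "(\<Sum>x\<in>carrier_vec n. chr x z * chr x z') = (\<Sum>x\<in>carrier_vec n. chr (z + z') x)"
    using assms by (intro sum.cong refl) (metis chr_add_left chr_commute)
  then show ?thesis using assms by (auto simp: sum_chr bits_add_eq_0[of _ n])
qed

section \<open>Fibres of dual linear maps\<close>

definition fibre :: "nat \<Rightarrow> bit mat \<Rightarrow> bit vec \<Rightarrow> bit vec set" where
  "fibre n f k = {z \<in> carrier_vec n. f *\<^sub>v z = k}"

lemma fibre_iff: "z \<in> fibre n f k \<longleftrightarrow> z \<in> carrier_vec n \<and> f *\<^sub>v z = k"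
  by (simp add: fibre_def)

lemma fibre_carrier: "z \<in> fibre n f k \<Longrightarrow> z \<in> carrier_vec n"
  by (simp add: fibre_def)

lemma finite_fibre [simp]: "finite (fibre n f k)"
  unfolding fibre_def by (rule finite_subset[OF _ finite_bits]) auto

lemma sum_fibres:
  assumes "f \<in> carrier_mat m n"
  shows "(\<Sum>k\<in>carrier_vec m. \<Sum>z\<in>fibre n f k. h z) = (\<Sum>z\<in>carrier_vec n. h z)"
  unfolding fibre_def using assms by (intro sum.group) auto

text \<open>Full row rank makes a maximal independent set of columns a basis of the target space;
  the coordinates of \<open>k\<close> in this basis give the preimage.\<close>

lemma full_rank_surj:
  fixes f :: "bit mat"
  assumes f: "f \<in> carrier_mat m n" and rank: "vec_space.rank m f = m" and k: "k \<in> carrier_vec m"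
  shows "\<exists>z\<in>carrier_vec n. f *\<^sub>v z = k"
proof -
  interpret vec_space "TYPE(bit)" m .
  have "lin_indpt {}"
    by (metis (no_types) empty_subsetI fin_dim finite_basis_exists subset_li_is_li basis_def)
  then obtain S where S: "maximal S (\<lambda>T. T \<subseteq> set (cols f) \<and> lin_indpt T)" "finite S"
    using maximal_exists_superset[of "set (cols f)" "\<lambda>T. T \<subseteq> set (cols f) \<and> lin_indpt T" "{}"]
    by blast
  have S_sub: "S \<subseteq> set (cols f)" "lin_indpt S" using S(1) unfolding maximal_def by auto
  have S_carr: "S \<subseteq> carrier_vec m" using S_sub(1) cols_dim[of f] f by auto
  have "card S = m" using rank_card_indpt[OF f S(1)] rank by simp
  then have "basis S"
    by (intro dim_li_is_basis[OF fin_dim S(2)]) (simp_all only: S_sub(2) dim_is_n, simp_all add: S_carr)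
  then have "span S = carrier_vec m" unfolding basis_def by blast
  with k have "k \<in> span S" by blast
  then obtain a where a: "lincomb a S = k" using finite_span[OF S(2) S_carr] by auto
  define idx where "idx s = (SOME j. j < n \<and> col f j = s)" for s
  have idx: "idx s < n \<and> col f (idx s) = s" if "s \<in> S" for s
    unfolding idx_def
    by (rule someI_ex) (use that S_sub(1) f in \<open>auto simp: cols_def in_set_conv_nth dest!: subsetD\<close>)
  \<comment> \<open>Coordinate \<open>j\<close> receives the coefficient of the basis column chosen
    at position \<open>j\<close>, and 0 elsewhere. Writing it as a sum lets \<open>sum.group\<close>
    regroup by \<open>idx\<close>.\<close>
  define z where "z = vec n (\<lambda>j. \<Sum>s | s \<in> S \<and> idx s = j. a s)"
  have "f *\<^sub>v z = k"
  proof (rule eq_vecI)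
    fix i assume "i < dim_vec k"
    then have i: "i < m" using k by simp
    have "(f *\<^sub>v z) $ i = (\<Sum>j<n. f $$ (i, j) * (\<Sum>s | s \<in> S \<and> idx s = j. a s))"
      using f i by (simp add: z_def scalar_prod_def atLeast0LessThan)
    also have "\<dots> = (\<Sum>j<n. \<Sum>s | s \<in> S \<and> idx s = j. a s * s $ i)"
      unfolding sum_distrib_left
    proof (intro sum.cong refl)
      fix j s assume "j \<in> {..<n}" "s \<in> {s \<in> S. idx s = j}"
      then have "f $$ (i, j) = s $ i" using idx[of s] f i by (auto simp: col_def)
      then show "f $$ (i, j) * a s = a s * s $ i" by (simp add: mult.commute)
    qed
    also have "\<dots> = (\<Sum>s\<in>S. a s * s $ i)"
      by (rule sum.group) (use S(2) idx in auto)
    also have "\<dots> = k $ i" unfolding lincomb_index[OF i S_carr, symmetric] a ..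
    finally show "(f *\<^sub>v z) $ i = k $ i" .
  qed (use f k in auto)
  moreover have "z \<in> carrier_vec n" by (simp add: z_def)
  ultimately show ?thesis by blast
qed

locale dual_pair =
  fixes n m :: nat and f g :: "bit mat"
  assumes le: "m \<le> n" and dual: "dual_functions n m f g"
begin

lemma carriers [simp]: "f \<in> carrier_mat m n" "g \<in> carrier_mat (n - m) n"
  using dual by (auto simp: dual_functions_def)

lemma image_carrier [simp]: "z \<in> carrier_vec n \<Longrightarrow> f *\<^sub>v z \<in> carrier_vec m"
  "z \<in> carrier_vec n \<Longrightarrow> g *\<^sub>v z \<in> carrier_vec (n - m)"
  by (rule mult_mat_vec_carrier[OF carriers(1)], assumption, rule mult_mat_vec_carrier[OF carriers(2)])

lemma f_add: "x \<in> carrier_vec n \<Longrightarrow> y \<in> carrier_vec n \<Longrightarrow> f *\<^sub>v (x + y) = f *\<^sub>v x + f *\<^sub>v y"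
  by (rule mult_add_distrib_mat_vec[OF carriers(1)])

lemma g_add: "x \<in> carrier_vec n \<Longrightarrow> y \<in> carrier_vec n \<Longrightarrow> g *\<^sub>v (x + y) = g *\<^sub>v x + g *\<^sub>v y"
  by (rule mult_add_distrib_mat_vec[OF carriers(2)])

lemma f_surj: "k \<in> carrier_vec m \<Longrightarrow> \<exists>z. z \<in> fibre n f k"
  using full_rank_surj[OF carriers(1)] dual by (auto simp: dual_functions_def fibre_def)

lemma g_surj: "s \<in> carrier_vec (n - m) \<Longrightarrow> \<exists>x. x \<in> fibre n g s"
  using full_rank_surj[OF carriers(2)] dual by (auto simp: dual_functions_def fibre_def)

lemma f_transpose_g: "v \<in> carrier_vec (n - m) \<Longrightarrow> f *\<^sub>v (transpose_mat g *\<^sub>v v) = 0\<^sub>v m"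
proof -
  assume v: "v \<in> carrier_vec (n - m)"
  have "f *\<^sub>v (transpose_mat g *\<^sub>v v) = (f * transpose_mat g) *\<^sub>v v"
    using v by (intro assoc_mult_mat_vec[symmetric, of _ m n _ "n - m"]) (auto simp: transpose_carrier_mat)
  also have "f * transpose_mat g = 0\<^sub>m m (n - m)" using dual by (simp add: dual_functions_def)
  also have "0\<^sub>m m (n - m) *\<^sub>v v = 0\<^sub>v m" using v by (intro eq_vecI) auto
  finally show ?thesis .
qed

lemma transpose_g_carrier: "v \<in> carrier_vec (n - m) \<Longrightarrow> transpose_mat g *\<^sub>v v \<in> carrier_vec n"
  by (auto intro!: mult_mat_vec_carrier[of _ n "n - m"])

text \<open>By surjectivity all fibres are translates of the kernel, so the \<open>2 ^ n\<close>
  strings are shared equally among \<open>2 ^ m\<close> fibres.\<close>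

lemma card_fibre:
  assumes "k \<in> carrier_vec m"
  shows "card (fibre n f k) = 2 ^ (n - m)"
proof -
  have eq: "card (fibre n f k) = card (fibre n f (0\<^sub>v m))" if k: "k \<in> carrier_vec m" for k
  proof -
    obtain z where z: "z \<in> carrier_vec n" "f *\<^sub>v z = k" using f_surj[OF k] by (auto simp: fibre_def)
    have "bij_betw (\<lambda>y. y + z) (fibre n f k) (fibre n f (0\<^sub>v m))"
      by (rule bij_betw_byWitness[of _ "\<lambda>y. y + z"])
        (use z k in \<open>auto simp: fibre_def bits_add_cancel[of _ n] f_add simp del: assoc_add_vec\<close>)
    then show ?thesis by (rule bij_betw_same_card)
  qed
  have "2 ^ n = (\<Sum>k\<in>(carrier_vec m :: bit vec set). card (fibre n f k))"
    using sum_fibres[OF carriers(1), of "\<lambda>_. 1 :: nat"] by simp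
  also have "\<dots> = (\<Sum>k\<in>(carrier_vec m :: bit vec set). card (fibre n f (0\<^sub>v m)))"
    by (rule sum.cong) (rule refl, rule eq)
  also have "\<dots> = 2 ^ m * card (fibre n f (0\<^sub>v m))" by simp
  finally have "2 ^ m * card (fibre n f (0\<^sub>v m)) = 2 ^ m * 2 ^ (n - m)"
    using le by (simp flip: power_add)
  with eq[OF assms] show ?thesis by simp
qed

text \<open>The orthogonality in the duality relation gives one inclusion. The transpose of
  \<open>g\<close> is injective because \<open>g\<close> is onto, and counting turns the inclusion
  into an equality.\<close>

lemma kernel_f_eq: "fibre n f (0\<^sub>v m) = (\<lambda>v. transpose_mat g *\<^sub>v v) ` carrier_vec (n - m)"
proof (rule card_subset_eq[symmetric])
  have "inj_on (\<lambda>v. transpose_mat g *\<^sub>v v) (carrier_vec (n - m))"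
  proof (rule inj_onI)
    fix v w :: "bit vec"
    assume v: "v \<in> carrier_vec (n - m)" and w: "w \<in> carrier_vec (n - m)"
      and eq: "transpose_mat g *\<^sub>v v = transpose_mat g *\<^sub>v w"
    have "v \<bullet> s = w \<bullet> s" if s: "s \<in> carrier_vec (n - m)" for s
    proof -
      obtain x where x: "x \<in> carrier_vec n" "g *\<^sub>v x = s" using g_surj[OF s] by (auto simp: fibre_def)
      show ?thesis
        using transpose_vec_mult_scalar[OF carriers(2) x(1) v] transpose_vec_mult_scalar[OF carriers(2) x(1) w]
        by (simp add: eq x(2))
    qed
    then have "v $ i = w $ i" if "i < n - m" for i
      using that v w by (metis scalar_prod_right_unit unit_vec_carrier)
    with v w show "v = w" by auto
  qed
  then have "card ((\<lambda>v. transpose_mat g *\<^sub>v v) ` carrier_vec (n - m)) = 2 ^ (n - m)"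
    by (simp add: card_image)
  then show "card ((\<lambda>v. transpose_mat g *\<^sub>v v) ` carrier_vec (n - m)) = card (fibre n f (0\<^sub>v m))"
    by (simp add: card_fibre)
qed (auto simp: fibre_def f_transpose_g transpose_g_carrier)

lemma chr_transpose_g:
  assumes "v \<in> carrier_vec (n - m)" "x \<in> carrier_vec n"
  shows "chr x (transpose_mat g *\<^sub>v v) = chr (g *\<^sub>v x) v"
proof -
  have "x \<bullet> (transpose_mat g *\<^sub>v v) = (transpose_mat g *\<^sub>v v) \<bullet> x"
    using assms transpose_g_carrier by (intro comm_scalar_prod[of _ n]) auto
  also have "\<dots> = v \<bullet> (g *\<^sub>v x)" using assms by (intro transpose_vec_mult_scalar[of _ _ n]) auto
  also have "\<dots> = (g *\<^sub>v x) \<bullet> v" using assms by (intro comm_scalar_prod[of _ "n - m"]) auto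
  finally show ?thesis by (simp add: chr_def)
qed

text \<open>On the kernel of \<open>f\<close>, parametrized by the transpose of \<open>g\<close>,
  the character of \<open>x\<close> becomes the character of the syndrome of \<open>x\<close>.
  Translation to the fibre of \<open>z\<close> contributes the sign \<open>chr x z\<close>.\<close>

lemma sum_chr_fibre:
  assumes x: "x \<in> carrier_vec n" and z: "z \<in> fibre n f k"
  shows "(\<Sum>y\<in>fibre n f k. chr x y) = (if g *\<^sub>v x = 0\<^sub>v (n - m) then 2 ^ (n - m) * chr x z else 0)"
proof -
  have zc: "z \<in> carrier_vec n" and fz: "f *\<^sub>v z = k" using z by (auto simp: fibre_def)
  have kc: "k \<in> carrier_vec m" using zc fz by auto
  have inj: "inj_on (\<lambda>v. transpose_mat g *\<^sub>v v) (carrier_vec (n - m))"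
    by (rule eq_card_imp_inj_on) (simp_all flip: kernel_f_eq add: card_fibre)
  have "(\<Sum>y\<in>fibre n f k. chr x y) = (\<Sum>y\<in>fibre n f (0\<^sub>v m). chr x (y + z))"
    by (rule sum.reindex_bij_witness[of _ "\<lambda>y. y + z" "\<lambda>y. y + z"])
      (use zc fz kc in \<open>auto simp: fibre_def bits_add_cancel[of _ n] f_add simp del: assoc_add_vec\<close>)
  also have "\<dots> = (\<Sum>y\<in>fibre n f (0\<^sub>v m). chr x y) * chr x z"
    unfolding sum_distrib_right using x zc by (intro sum.cong) (auto simp: fibre_def chr_add_right)
  also have "(\<Sum>y\<in>fibre n f (0\<^sub>v m). chr x y) = (\<Sum>v\<in>carrier_vec (n - m). chr (g *\<^sub>v x) v)"
    unfolding kernel_f_eq by (subst sum.reindex[OF inj]) (simp add: chr_transpose_g x)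
  also have "\<dots> = (if g *\<^sub>v x = 0\<^sub>v (n - m) then 2 ^ (n - m) else 0)"
    by (rule sum_chr) (simp add: x)
  finally show ?thesis by simp
qed

text \<open>Summing over one fibre of \<open>f\<close> instead of all strings annihilates only the
  pairs with different syndromes, so Parseval survives in block form. The representative
  \<open>z\<close> fixes the signs. Two families are kept apart because in applications one is the
  adjoint of the other.\<close>

lemma coset_parseval:
  fixes A B :: "bit vec \<Rightarrow> 'a :: real_algebra"
  assumes z: "z \<in> fibre n f k"
  shows "(\<Sum>y\<in>fibre n f k. (\<Sum>x\<in>carrier_vec n. chr x y *\<^sub>R A x) * (\<Sum>x\<in>carrier_vec n. chr x y *\<^sub>R B x))
    = 2 ^ (n - m) *\<^sub>R (\<Sum>s\<in>carrier_vec (n - m).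
        (\<Sum>x\<in>fibre n g s. chr x z *\<^sub>R A x) * (\<Sum>x\<in>fibre n g s. chr x z *\<^sub>R B x))"
proof -
  have zc: "z \<in> carrier_vec n" using z by (rule fibre_carrier)
  have kernel: "(\<Sum>y\<in>fibre n f k. chr x y * chr x' y)
      = (if g *\<^sub>v x = g *\<^sub>v x' then 2 ^ (n - m) * (chr x z * chr x' z) else 0)"
    if "x \<in> carrier_vec n" "x' \<in> carrier_vec n" for x x'
  proof -
    have "(\<Sum>y\<in>fibre n f k. chr x y * chr x' y) = (\<Sum>y\<in>fibre n f k. chr (x + x') y)"
      using that by (intro sum.cong) (auto simp: chr_add_left fibre_def)
    then show ?thesis
      using that zc by (simp add: sum_chr_fibre[OF _ z] g_add bits_add_eq_0[of _ "n - m"] chr_add_left)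
  qed
  have "(\<Sum>y\<in>fibre n f k. (\<Sum>x\<in>carrier_vec n. chr x y *\<^sub>R A x) * (\<Sum>x\<in>carrier_vec n. chr x y *\<^sub>R B x))
    = (\<Sum>y\<in>fibre n f k. \<Sum>x\<in>carrier_vec n. \<Sum>x'\<in>carrier_vec n. (chr x y * chr x' y) *\<^sub>R (A x * B x'))"
    by (simp add: sum_product mult.commute)
  also have "\<dots> = (\<Sum>x\<in>carrier_vec n. \<Sum>x'\<in>carrier_vec n. (\<Sum>y\<in>fibre n f k. chr x y * chr x' y) *\<^sub>R (A x * B x'))"
    by (simp add: scaleR_sum_left sum.swap[of _ "carrier_vec n" "fibre n f k"])
  also have "\<dots> = (\<Sum>x\<in>carrier_vec n. \<Sum>x'\<in>fibre n g (g *\<^sub>v x). (2 ^ (n - m) * (chr x z * chr x' z)) *\<^sub>R (A x * B x'))"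
  proof (rule sum.cong[OF refl])
    fix x :: "bit vec" assume x: "x \<in> carrier_vec n"
    show "(\<Sum>x'\<in>carrier_vec n. (\<Sum>y\<in>fibre n f k. chr x y * chr x' y) *\<^sub>R (A x * B x'))
      = (\<Sum>x'\<in>fibre n g (g *\<^sub>v x). (2 ^ (n - m) * (chr x z * chr x' z)) *\<^sub>R (A x * B x'))"
      by (rule sum.mono_neutral_cong_right) (auto simp: fibre_iff kernel x)
  qed
  also have "\<dots> = (\<Sum>s\<in>carrier_vec (n - m). \<Sum>x\<in>fibre n g s. \<Sum>x'\<in>fibre n g s.
      (2 ^ (n - m) * (chr x z * chr x' z)) *\<^sub>R (A x * B x'))"
    unfolding sum_fibres[OF carriers(2), symmetric] by (intro sum.cong refl) (simp add: fibre_def)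
  also have "\<dots> = 2 ^ (n - m) *\<^sub>R (\<Sum>s\<in>carrier_vec (n - m).
        (\<Sum>x\<in>fibre n g s. chr x z *\<^sub>R A x) * (\<Sum>x\<in>fibre n g s. chr x z *\<^sub>R B x))"
    by (simp add: sum_product scaleR_sum_right mult.commute)
  finally show ?thesis .
qed

text \<open>Makes the block Parseval identity available on fibres of \<open>g\<close>, as in
  \<open>overlap_le_X\<close>.\<close>

lemma swap: "dual_pair n (n - m) g f"
proof
  have "f * transpose_mat g = 0\<^sub>m m (n - m)" using dual by (simp add: dual_functions_def)
  then have "transpose_mat (f * transpose_mat g) = transpose_mat (0\<^sub>m m (n - m))" by simp
  then have "g * transpose_mat f = 0\<^sub>m (n - m) m"
    using transpose_mult[of f m n "transpose_mat g" "n - m"] by (simp add: transpose_carrier_mat)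
  with dual le show "dual_functions n (n - m) g f" by (simp add: dual_functions_def)
qed simp

end

lemma parseval:
  fixes A B :: "bit vec \<Rightarrow> 'a :: real_algebra"
  shows "(\<Sum>x\<in>carrier_vec n. (\<Sum>z\<in>carrier_vec n. chr x z *\<^sub>R A z) * (\<Sum>z\<in>carrier_vec n. chr x z *\<^sub>R B z))
    = 2 ^ n *\<^sub>R (\<Sum>z\<in>carrier_vec n. A z * B z)"
proof -
  have "(\<Sum>x\<in>carrier_vec n. (\<Sum>z\<in>carrier_vec n. chr x z *\<^sub>R A z) * (\<Sum>z\<in>carrier_vec n. chr x z *\<^sub>R B z))
    = (\<Sum>x\<in>carrier_vec n. \<Sum>z\<in>carrier_vec n. \<Sum>z'\<in>carrier_vec n. (chr x z * chr x z') *\<^sub>R (A z * B z'))"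
    by (simp add: sum_product mult.commute)
  also have "\<dots> = (\<Sum>z\<in>carrier_vec n. \<Sum>x\<in>carrier_vec n. \<Sum>z'\<in>carrier_vec n. (chr x z * chr x z') *\<^sub>R (A z * B z'))"
    by (rule sum.swap)
  also have "\<dots> = (\<Sum>z\<in>carrier_vec n. \<Sum>z'\<in>carrier_vec n. (\<Sum>x\<in>carrier_vec n. chr x z * chr x z') *\<^sub>R (A z * B z'))"
    by (rule sum.cong[OF refl], subst sum.swap) (simp add: scaleR_sum_left)
  also have "\<dots> = (\<Sum>z\<in>carrier_vec n. \<Sum>z'\<in>carrier_vec n. if z' = z then 2 ^ n *\<^sub>R (A z * B z') else 0)"
    by (intro sum.cong) (auto simp: sum_chr_mult)
  also have "\<dots> = 2 ^ n *\<^sub>R (\<Sum>z\<in>carrier_vec n. A z * B z)"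
    by (simp add: scaleR_sum_right)
  finally show ?thesis .
qed

section \<open>The two fidelity bounds\<close>

text \<open>Operator form of Jensen's inequality: the difference is the variance of \<open>A\<close>
  about its mean \<open>B\<close> under the weights \<open>M\<close>, plus the contribution of the
  missing weight, sandwiched between \<open>adj B\<close> and \<open>B\<close>.\<close>

lemma pos_sum_conj_diff:
  assumes M: "\<And>x. x \<in> S \<Longrightarrow> pos (M x)" "\<And>x. x \<in> S \<Longrightarrow> fid d * M x = M x"
    and le: "pos (fid d - (\<Sum>x\<in>S. M x))"
  shows "pos ((\<Sum>x\<in>S. adj (A x) * M x * A x) - adj (\<Sum>x\<in>S. M x * A x) * (\<Sum>x\<in>S. M x * A x))"
proof -
  define B where "B = (\<Sum>x\<in>S. M x * A x)"
  have B: "fid d * B = B" unfolding B_def sum_distrib_left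
    by (intro sum.cong) (auto simp: M(2) simp flip: mult.assoc)
  have adjB: "adj B = (\<Sum>x\<in>S. adj (A x) * M x)"
    unfolding B_def adj_sum by (intro sum.cong) (auto simp: pos_adj[OF M(1)])
  have "(\<Sum>x\<in>S. adj (A x - B) * M x * (A x - B)) = (\<Sum>x\<in>S. adj (A x) * M x * A x)
      - (\<Sum>x\<in>S. adj (A x) * M x) * B - adj B * (\<Sum>x\<in>S. M x * A x) + adj B * (\<Sum>x\<in>S. M x) * B"
    by (simp add: algebra_simps sum.distrib sum_subtractf sum_distrib_left sum_distrib_right)
  also have "\<dots> = (\<Sum>x\<in>S. adj (A x) * M x * A x) - adj B * B - adj B * B + adj B * (\<Sum>x\<in>S. M x) * B"
    by (simp add: B_def[symmetric] adjB[symmetric])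
  finally have "(\<Sum>x\<in>S. adj (A x) * M x * A x) - adj B * B
      = (\<Sum>x\<in>S. adj (A x - B) * M x * (A x - B)) + adj B * (fid d - (\<Sum>x\<in>S. M x)) * B"
    using B by (simp add: algebra_simps)
  also have "pos \<dots>"
    by (intro pos_add pos_sum pos_conj M le)
  finally show ?thesis by (simp add: B_def)
qed

lemma contr_isometry: "adj J * J = fid d \<Longrightarrow> contr J"
  unfolding contr_def
proof
  fix Y assume J: "adj J * J = fid d"
  have "(norm (J * Y))\<^sup>2 = inner Y (fid d * Y)"
    by (simp add: power2_norm_eq_inner inner_mult_left J flip: mult.assoc)
  also have "\<dots> \<le> norm Y * norm (fid d * Y)" by (rule norm_cauchy_schwarz)
  also have "\<dots> \<le> norm Y * norm Y" by (intro mult_left_mono contrD contr_fid) simp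
  finally show "norm (J * Y) \<le> norm Y" by (simp flip: power2_eq_square)
qed

lemma isometry_right:
  assumes "adj J * J = fid d"
  shows "J * fid d = J"
proof -
  have "adj J * (J * fid d - J) = 0" using assms by (simp add: right_diff_distrib flip: mult.assoc)
  then have "adj (J * fid d - J) * (J * fid d - J) = 0" by (simp add: left_diff_distrib mult.assoc)
  then show ?thesis using rtr_adj_mult[of "J * fid d - J"] by simp
qed

lemma orthogonal_ranges_idem:
  assumes "\<And>k k'. k \<in> S \<Longrightarrow> k' \<in> S \<Longrightarrow> adj (J k) * J k' = (if k = k' then fid d else 0)"
    and "finite S"
  shows "(\<Sum>k\<in>S. J k * adj (J k)) * (\<Sum>k\<in>S. J k * adj (J k)) = (\<Sum>k\<in>S. J k * adj (J k))"
proof -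
  have JF: "J k * fid d = J k" if "k \<in> S" for k
    using assms(1)[OF that that] by (intro isometry_right) simp
  have "(\<Sum>k\<in>S. J k * adj (J k)) * (\<Sum>k\<in>S. J k * adj (J k))
    = (\<Sum>k\<in>S. \<Sum>k'\<in>S. J k * (adj (J k) * J k') * adj (J k'))"
    by (simp add: sum_product mult.assoc)
  also have "\<dots> = (\<Sum>k\<in>S. \<Sum>k'\<in>S. if k' = k then J k * adj (J k) else 0)"
    by (intro sum.cong) (auto simp: assms(1) JF)
  finally show ?thesis using assms(2) by simp
qed

text \<open>The sum is a projection inside \<open>fid N\<close> of trace \<open>N\<close>, so its
  squared distance from \<open>fid N\<close> is zero. Counting dimensions replaces explicit
  reindexing in the completeness relations below.\<close>

lemma orthogonal_ranges_complete:
  assumes "\<And>k k'. k \<in> S \<Longrightarrow> k' \<in> S \<Longrightarrow> adj (J k) * J k' = (if k = k' then fid d else 0)"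
    and "finite S" "\<And>k. k \<in> S \<Longrightarrow> fid N * J k = J k" "card S * d = N"
  shows "(\<Sum>k\<in>S. J k * adj (J k)) = fid N"
proof -
  define E where "E = (\<Sum>k\<in>S. J k * adj (J k))"
  have E: "E * E = E" "adj E = E"
    using orthogonal_ranges_idem[OF assms(1,2)] by (simp_all add: E_def)
  have fE: "fid N * E = E"
    unfolding E_def sum_distrib_left using assms(3) by (intro sum.cong) (auto simp flip: mult.assoc)
  have Ef: "E * fid N = E" using arg_cong[OF fE, of adj] E(2) by simp
  have "rtr E = (\<Sum>k\<in>S. rtr (adj (J k) * J k))" by (simp only: E_def rtr_sum) (simp only: rtr_comm)
  also have "\<dots> = N" using assms(1) by (simp flip: assms(4))
  finally have "rtr E = N" .
  have "(norm (fid N - E))\<^sup>2 = rtr (adj (fid N - E) * (fid N - E))" by (simp only: rtr_adj_mult)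
  also have "\<dots> = rtr (fid N - E)" using E fE Ef by (simp add: algebra_simps)
  also have "\<dots> = 0" by (simp add: rtr_diff \<open>rtr E = N\<close>)
  finally show ?thesis by (simp add: E_def)
qed

lemma rtr_compression:
  assumes "(\<Sum>k\<in>S. J k * adj (J k)) = fid N" "A * fid N = A"
  shows "(\<Sum>k\<in>S. rtr (adj (J k) * A * J k)) = rtr A"
proof -
  have "(\<Sum>k\<in>S. rtr (adj (J k) * A * J k)) = (\<Sum>k\<in>S. rtr (A * (J k * adj (J k))))"
    by (intro sum.cong refl) (metis mult.assoc rtr_comm)
  also have "\<dots> = rtr (A * fid N)" by (simp add: sum_distrib_left rtr_sum flip: assms(1))
  finally show ?thesis by (simp add: assms(2))
qed

lemma bessel:
  assumes "\<And>k k'. k \<in> S \<Longrightarrow> k' \<in> S \<Longrightarrow> adj (J k) * J k' = (if k = k' then fid d else 0)"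
    and "finite S"
  shows "(\<Sum>k\<in>S. (norm (adj (J k) * Z))\<^sup>2) \<le> (norm Z)\<^sup>2"
proof -
  define E where "E = (\<Sum>k\<in>S. J k * adj (J k))"
  have "contr E"
    by (intro contr_projection) (simp_all add: E_def orthogonal_ranges_idem[OF assms])
  have "(\<Sum>k\<in>S. (norm (adj (J k) * Z))\<^sup>2) = inner Z (E * Z)"
    unfolding E_def sum_distrib_right inner_sum_right
    by (intro sum.cong) (simp_all add: power2_norm_eq_inner inner_mult_left mult.assoc)
  also have "\<dots> \<le> norm Z * norm (E * Z)" by (rule norm_cauchy_schwarz)
  also have "\<dots> \<le> norm Z * norm Z" by (intro mult_left_mono contrD \<open>contr E\<close>) simp
  finally show ?thesis by (simp add: power2_eq_square)
qed

lemma norm_sum_squared_le: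
  fixes A :: "'i \<Rightarrow> 'a :: real_normed_vector"
  assumes "finite S"
  shows "(norm (\<Sum>x\<in>S. A x))\<^sup>2 \<le> card S * (\<Sum>x\<in>S. (norm (A x))\<^sup>2)"
proof -
  have "(norm (\<Sum>x\<in>S. A x))\<^sup>2 \<le> (\<Sum>x\<in>S. norm (A x))\<^sup>2"
    by (intro power_mono norm_sum) simp
  also have "\<dots> \<le> (\<Sum>x\<in>S. (norm (A x))\<^sup>2) * card S"
    by (rule sum_squared_le_sum_of_squares)
  finally show ?thesis by (simp add: mult.commute)
qed

text \<open>Serves to exchange \<open>\<Phi> x\<close> for a square root of an operator that
  dominates \<open>\<Phi> x * adj (\<Phi> x)\<close>.\<close>

lemma norm_conj_mono:
  assumes "pos (R * adj R - X * adj X)"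
  shows "norm (U * X) \<le> norm (U * R)"
proof (rule power2_le_imp_le)
  have "0 \<le> rtr (U * (R * adj R - X * adj X) * adj U)"
    using rtr_conj_nonneg[OF assms, of "adj U"] by simp
  then show "(norm (U * X))\<^sup>2 \<le> (norm (U * R))\<^sup>2"
    by (simp add: algebra_simps rtr_diff flip: rtr_mult_adj)
qed simp

text \<open>\<open>\<Psi> z\<close> is the coefficient matrix on \<open>B\<close> and
  \<open>E\<close> that belongs to the outcome \<open>z\<close>. The isometries \<open>J k\<close>
  adjoin the hash value to \<open>E\<close>, and \<open>K z\<close> adjoin a copy of
  \<open>z\<close> to \<open>B\<close>.\<close>

locale purified = dual_pair +
  fixes dB dE :: nat and \<Psi> :: "bit vec \<Rightarrow> fmat" and J K :: "bit vec \<Rightarrow> fmat"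
  assumes \<Psi>_left: "z \<in> carrier_vec n \<Longrightarrow> fid dB * \<Psi> z = \<Psi> z"
    and \<Psi>_right: "z \<in> carrier_vec n \<Longrightarrow> \<Psi> z * fid dE = \<Psi> z"
    and J: "k \<in> carrier_vec m \<Longrightarrow> k' \<in> carrier_vec m \<Longrightarrow>
      adj (J k) * J k' = (if k = k' then fid dE else 0)"
    and K: "z \<in> carrier_vec n \<Longrightarrow> z' \<in> carrier_vec n \<Longrightarrow>
      adj (K z) * K z' = (if z = z' then fid dB else 0)"
begin

definition \<Phi> :: "bit vec \<Rightarrow> fmat" where
  "\<Phi> x = (1 / sqrt (2 ^ n)) *\<^sub>R (\<Sum>z\<in>carrier_vec n. chr x z *\<^sub>R \<Psi> z)"

text \<open>Coefficient matrix of the vector that carries \<open>z\<close> next to \<open>B\<close>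
  and \<open>f z\<close> next to \<open>E\<close>. The copy of \<open>z\<close> removes interference
  between different \<open>z\<close> in the Gram operator.\<close>

definition \<Xi> :: fmat where
  "\<Xi> = (\<Sum>z\<in>carrier_vec n. K z * \<Psi> z * adj (J (f *\<^sub>v z)))"

definition \<rho>KE :: fmat where
  "\<rho>KE = (\<Sum>z\<in>carrier_vec n. J (f *\<^sub>v z) * (adj (\<Psi> z) * \<Psi> z) * adj (J (f *\<^sub>v z)))"

lemma sum_chr_\<Phi>: "z \<in> carrier_vec n \<Longrightarrow> (\<Sum>x\<in>carrier_vec n. chr x z *\<^sub>R \<Phi> x) = sqrt (2 ^ n) *\<^sub>R \<Psi> z"
proof -
  assume z: "z \<in> carrier_vec n"
  have "(\<Sum>x\<in>carrier_vec n. chr x z *\<^sub>R \<Phi> x)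
    = (1 / sqrt (2 ^ n)) *\<^sub>R (\<Sum>x\<in>carrier_vec n. \<Sum>z'\<in>carrier_vec n. (chr x z * chr x z') *\<^sub>R \<Psi> z')"
    by (simp add: \<Phi>_def scaleR_sum_right mult.commute)
  also have "\<dots> = (1 / sqrt (2 ^ n)) *\<^sub>R (\<Sum>z'\<in>carrier_vec n. (\<Sum>x\<in>carrier_vec n. chr x z * chr x z') *\<^sub>R \<Psi> z')"
    by (subst sum.swap) (simp add: scaleR_sum_left)
  also have "\<dots> = (1 / sqrt (2 ^ n)) *\<^sub>R (\<Sum>z'\<in>carrier_vec n. if z' = z then 2 ^ n *\<^sub>R \<Psi> z else 0)"
    by (intro arg_cong[where f = "scaleR _"] sum.cong) (auto simp: sum_chr_mult[OF z])
  also have "\<dots> = sqrt (2 ^ n) *\<^sub>R \<Psi> z"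
    using z by (simp add: real_div_sqrt)
  finally show ?thesis .
qed

lemma \<Phi>_left: "x \<in> carrier_vec n \<Longrightarrow> fid dB * \<Phi> x = \<Phi> x"
  unfolding \<Phi>_def by (simp add: sum_distrib_left \<Psi>_left)

lemma \<Phi>_right: "x \<in> carrier_vec n \<Longrightarrow> \<Phi> x * fid dE = \<Phi> x"
  unfolding \<Phi>_def by (simp add: sum_distrib_right \<Psi>_right)

lemma K_mult_K:
  assumes "z \<in> carrier_vec n" "z' \<in> carrier_vec n" "fid dB * Y = Y"
  shows "adj (K z) * (K z' * Y) = (if z' = z then Y else 0)"
  using assms K[of z z'] by (auto simp flip: mult.assoc)

lemma J_mult_J:
  assumes "k \<in> carrier_vec m" "k' \<in> carrier_vec m" "fid dE * Y = Y"
  shows "adj (J k) * (J k' * Y) = (if k' = k then Y else 0)"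
  using assms J[of k k'] by (auto simp flip: mult.assoc)

lemma \<Xi>_gram: "adj \<Xi> * \<Xi> = \<rho>KE"
proof -
  have "adj \<Xi> * \<Xi> = (\<Sum>z\<in>carrier_vec n. \<Sum>z'\<in>carrier_vec n.
      J (f *\<^sub>v z) * (adj (\<Psi> z) * (adj (K z) * (K z' * (\<Psi> z' * adj (J (f *\<^sub>v z')))))))"
    by (simp add: \<Xi>_def sum_product mult.assoc)
  also have "\<dots> = (\<Sum>z\<in>carrier_vec n. \<Sum>z'\<in>carrier_vec n. if z' = z then
      J (f *\<^sub>v z) * (adj (\<Psi> z) * \<Psi> z) * adj (J (f *\<^sub>v z)) else 0)"
    by (intro sum.cong refl) (auto simp: K_mult_K \<Psi>_left mult.assoc simp flip: mult.assoc[of "fid dB"])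
  finally show ?thesis by (simp add: \<rho>KE_def)
qed

definition \<omega> :: "(bit vec \<Rightarrow> fmat) \<Rightarrow> fmat" where
  "\<omega> M = (\<Sum>x\<in>carrier_vec n. adj (\<Phi> x) * M x * \<Phi> x)"

text \<open>Obtained from \<open>\<Xi>\<close> by inserting \<open>M x\<close> in front of each
  \<open>\<Phi> x\<close>: by \<open>sum_chr_\<Phi>\<close>, the choice \<open>M x = fid dB\<close>
  would give \<open>sqrt (2 ^ m)\<close> times \<open>\<Xi>\<close>. The prefactor is the one that
  coset Parseval cancels in \<open>\<Gamma>_gram_le\<close>.\<close>

definition \<Gamma> :: "(bit vec \<Rightarrow> fmat) \<Rightarrow> fmat" where
  "\<Gamma> M = (1 / sqrt (2 ^ (n - m))) *\<^sub>R
     (\<Sum>z\<in>carrier_vec n. K z * (\<Sum>x\<in>carrier_vec n. chr x z *\<^sub>R (M x * \<Phi> x)) * adj (J (f *\<^sub>v z)))"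

text \<open>\<open>M x\<close> is the POVM element for the correct guess \<open>x\<close> under the
  syndrome of \<open>x\<close>. On a fibre of \<open>g\<close> these elements belong to one POVM but
  need not exhaust it, hence a sum below the identity.\<close>

context
  fixes M :: "bit vec \<Rightarrow> fmat"
  assumes M: "\<And>x. x \<in> carrier_vec n \<Longrightarrow> pos (M x)" "\<And>x. x \<in> carrier_vec n \<Longrightarrow> fid dB * M x = M x"
    and M_le: "\<And>s. s \<in> carrier_vec (n - m) \<Longrightarrow> pos (fid dB - (\<Sum>x\<in>fibre n g s. M x))"
begin

text \<open>Under the trace each \<open>J\<close> meets its own adjoint, and the signed sum of the
  \<open>\<Psi> z\<close> restores \<open>\<Phi> x\<close>, so that \<open>\<omega> M\<close>
  appears.\<close>

lemma \<Gamma>_overlap: "rtr (adj (\<Gamma> M) * \<Xi>) = sqrt (2 ^ m) * rtr (\<omega> M)"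
proof -
  have trm: "rtr (J (f *\<^sub>v z) * (adj (\<Phi> x) * (M x * (adj (K z) * (K z' * (\<Psi> z' * adj (J (f *\<^sub>v z')))))))) =
      (if z' = z then rtr (adj (\<Phi> x) * M x * \<Psi> z) else 0)"
    if "z \<in> carrier_vec n" "z' \<in> carrier_vec n" "x \<in> carrier_vec n" for x z z'
  proof -
    have "rtr (J (f *\<^sub>v z) * (adj (\<Phi> x) * (M x * (\<Psi> z * adj (J (f *\<^sub>v z))))))
      = rtr (adj (\<Phi> x) * (M x * (\<Psi> z * (adj (J (f *\<^sub>v z)) * J (f *\<^sub>v z)))))"
      by (subst rtr_comm) (simp add: mult.assoc)
    then show ?thesis
      using that by (auto simp: K_mult_K \<Psi>_left J \<Psi>_right mult.assoc simp flip: mult.assoc[of "fid dB"])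
  qed
  have adj\<Gamma>: "adj (\<Gamma> M) = (1 / sqrt (2 ^ (n - m))) *\<^sub>R
     (\<Sum>z\<in>carrier_vec n. J (f *\<^sub>v z) * ((\<Sum>x\<in>carrier_vec n. chr x z *\<^sub>R (adj (\<Phi> x) * M x)) * adj (K z)))"
    by (simp add: \<Gamma>_def pos_adj[OF M(1)])
  have "adj (\<Gamma> M) * \<Xi> = (1 / sqrt (2 ^ (n - m))) *\<^sub>R (\<Sum>z\<in>carrier_vec n. \<Sum>z'\<in>carrier_vec n. \<Sum>x\<in>carrier_vec n.
      chr x z *\<^sub>R (J (f *\<^sub>v z) * (adj (\<Phi> x) * (M x * (adj (K z) * (K z' * (\<Psi> z' * adj (J (f *\<^sub>v z')))))))))"
    unfolding adj\<Gamma> \<Xi>_def mult_scaleR_left sum_product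
    by (simp add: sum_distrib_left sum_distrib_right mult.assoc)
  then have "rtr (adj (\<Gamma> M) * \<Xi>) = (1 / sqrt (2 ^ (n - m))) * (\<Sum>z\<in>carrier_vec n. \<Sum>z'\<in>carrier_vec n. \<Sum>x\<in>carrier_vec n.
      chr x z * (if z' = z then rtr (adj (\<Phi> x) * M x * \<Psi> z) else 0))"
    by (simp add: rtr_scaleR rtr_sum trm)
  also have "\<dots> = (1 / sqrt (2 ^ (n - m))) * (\<Sum>z\<in>carrier_vec n. \<Sum>x\<in>carrier_vec n.
      chr x z * rtr (adj (\<Phi> x) * M x * \<Psi> z))"
    by (rule arg_cong[where f = "(*) _"], rule sum.cong[OF refl], subst sum.swap)
      (simp flip: sum_distrib_left)
  also have "\<dots> = (1 / sqrt (2 ^ (n - m))) * (\<Sum>x\<in>carrier_vec n. rtr (adj (\<Phi> x) * M x * (\<Sum>z\<in>carrier_vec n. chr x z *\<^sub>R \<Psi> z)))"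
    by (subst sum.swap) (simp add: sum_distrib_left rtr_sum rtr_scaleR)
  also have "\<dots> = (1 / sqrt (2 ^ (n - m))) * (\<Sum>x\<in>carrier_vec n. sqrt (2 ^ n) * rtr (adj (\<Phi> x) * M x * \<Phi> x))"
  proof -
    have "(\<Sum>z\<in>carrier_vec n. chr x z *\<^sub>R \<Psi> z) = sqrt (2 ^ n) *\<^sub>R \<Phi> x" for x by (simp add: \<Phi>_def)
    then show ?thesis by (simp add: rtr_scaleR)
  qed
  also have "\<dots> = (sqrt (2 ^ n) / sqrt (2 ^ (n - m))) * rtr (\<omega> M)"
    by (simp add: \<omega>_def rtr_sum sum_distrib_left)
  also have "sqrt (2 ^ n) / sqrt (2 ^ (n - m)) = sqrt (2 ^ m)"
    using le by (simp add: power_diff flip: real_sqrt_divide)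
  finally show ?thesis .
qed

text \<open>The Gram operator of \<open>\<Gamma> M\<close> is block diagonal in the hash value.
  Coset Parseval turns each block into a sum over syndromes, and Jensen's inequality bounds every
  term by the part of \<open>\<omega> M\<close> coming from that syndrome.\<close>

lemma \<Gamma>_gram_le: "pos ((\<Sum>k\<in>carrier_vec m. J k * \<omega> M * adj (J k)) - adj (\<Gamma> M) * \<Gamma> M)"
proof -
  define W where "W z = (\<Sum>x\<in>carrier_vec n. chr x z *\<^sub>R (M x * \<Phi> x))" for z
  define zk where "zk k = (SOME z. z \<in> fibre n f k)" for k
  have zk: "zk k \<in> fibre n f k" if "k \<in> carrier_vec m" for k
    unfolding zk_def using f_surj[OF that] by (rule someI_ex)
  define V where "V k s = (\<Sum>x\<in>fibre n g s. chr x (zk k) *\<^sub>R (M x * \<Phi> x))" for k s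
  have W_left: "fid dB * (W z * Y) = W z * Y" for z Y
    unfolding W_def sum_distrib_left sum_distrib_right
    by (intro sum.cong) (auto simp: M(2) simp flip: mult.assoc)
  have "adj (\<Gamma> M) * \<Gamma> M = (1 / 2 ^ (n - m)) *\<^sub>R (\<Sum>z\<in>carrier_vec n. \<Sum>z'\<in>carrier_vec n.
      J (f *\<^sub>v z) * (adj (W z) * (adj (K z) * (K z' * (W z' * adj (J (f *\<^sub>v z')))))))"
    unfolding \<Gamma>_def W_def[symmetric] by (simp add: sum_product mult.assoc)
  also have "\<dots> = (1 / 2 ^ (n - m)) *\<^sub>R (\<Sum>z\<in>carrier_vec n. \<Sum>z'\<in>carrier_vec n.
      if z' = z then J (f *\<^sub>v z) * (adj (W z) * (W z * adj (J (f *\<^sub>v z)))) else 0)"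
    by (intro arg_cong[where f = "scaleR _"] sum.cong refl) (auto simp: K_mult_K W_left)
  also have "\<dots> = (1 / 2 ^ (n - m)) *\<^sub>R (\<Sum>k\<in>carrier_vec m. \<Sum>z\<in>fibre n f k.
      J (f *\<^sub>v z) * (adj (W z) * (W z * adj (J (f *\<^sub>v z)))))"
    by (simp add: sum_fibres[OF carriers(1)])
  also have "\<dots> = (\<Sum>k\<in>carrier_vec m. J k * ((1 / 2 ^ (n - m)) *\<^sub>R (\<Sum>z\<in>fibre n f k. adj (W z) * W z)) * adj (J k))"
    by (simp add: scaleR_sum_right sum_distrib_left sum_distrib_right mult.assoc fibre_iff)
  also have "\<dots> = (\<Sum>k\<in>carrier_vec m. J k * (\<Sum>s\<in>carrier_vec (n - m). adj (V k s) * V k s) * adj (J k))"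
  proof (intro sum.cong refl arg_cong2[where f = "(*)"])
    fix k :: "bit vec" assume k: "k \<in> carrier_vec m"
    have "(\<Sum>z\<in>fibre n f k. adj (W z) * W z) = 2 ^ (n - m) *\<^sub>R (\<Sum>s\<in>carrier_vec (n - m). adj (V k s) * V k s)"
      using coset_parseval[OF zk[OF k], of "\<lambda>x. adj (M x * \<Phi> x)" "\<lambda>x. M x * \<Phi> x"]
      unfolding W_def V_def adj_sum adj_simps(5) .
    then show "(1 / 2 ^ (n - m)) *\<^sub>R (\<Sum>z\<in>fibre n f k. adj (W z) * W z) = (\<Sum>s\<in>carrier_vec (n - m). adj (V k s) * V k s)"
      by simp
  qed
  finally have gram: "adj (\<Gamma> M) * \<Gamma> M = (\<Sum>k\<in>carrier_vec m. J k * (\<Sum>s\<in>carrier_vec (n - m). adj (V k s) * V k s) * adj (J k))" .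
  \<comment> \<open>The signs \<open>chr x (zk k)\<close> are attached to \<open>\<Phi> x\<close>
    before Jensen's inequality is applied. They square to 1, so the bound does not depend on
    \<open>k\<close>.\<close>
  have "pos (\<omega> M - (\<Sum>s\<in>carrier_vec (n - m). adj (V k s) * V k s))" for k
  proof -
    have "pos ((\<Sum>x\<in>fibre n g s. adj (\<Phi> x) * M x * \<Phi> x) - adj (V k s) * V k s)" if "s \<in> carrier_vec (n - m)" for s
    proof -
      have "pos ((\<Sum>x\<in>fibre n g s. adj (chr x (zk k) *\<^sub>R \<Phi> x) * M x * (chr x (zk k) *\<^sub>R \<Phi> x))
        - adj (\<Sum>x\<in>fibre n g s. M x * (chr x (zk k) *\<^sub>R \<Phi> x)) * (\<Sum>x\<in>fibre n g s. M x * (chr x (zk k) *\<^sub>R \<Phi> x)))"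
        by (rule pos_sum_conj_diff[OF _ _ M_le[OF that]]) (auto simp: fibre_iff M)
      then show ?thesis by (simp add: V_def)
    qed
    then have "pos (\<Sum>s\<in>carrier_vec (n - m). (\<Sum>x\<in>fibre n g s. adj (\<Phi> x) * M x * \<Phi> x) - adj (V k s) * V k s)"
      by (rule pos_sum)
    then show ?thesis by (simp add: \<omega>_def sum_subtractf sum_fibres[OF carriers(2)])
  qed
  then have "pos (\<Sum>k\<in>carrier_vec m. J k * (\<omega> M - (\<Sum>s\<in>carrier_vec (n - m). adj (V k s) * V k s)) * adj (J k))"
    using pos_conj[of _ "adj (J _)"] by (intro pos_sum) simp
  then show ?thesis
    unfolding gram by (simp add: right_diff_distrib left_diff_distrib sum_subtractf)
qed

end

text \<open>For self-adjoint \<open>S\<close> this is a square root, and hence a purification, of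
  the uniform state tensored with \<open>S * S\<close>.\<close>

definition purif :: "fmat \<Rightarrow> fmat" where
  "purif S = (1 / sqrt (2 ^ m)) *\<^sub>R (\<Sum>k\<in>carrier_vec m. J k * S * adj (J k))"

text \<open>\<open>U\<close> is the contraction supplied by Uhlmann's theorem, \<open>S\<close> the
  conjugated root of a normalized state on \<open>E\<close>, and \<open>\<tau> s\<close> the dual
  operator of syndrome \<open>s\<close>.\<close>

context
  fixes U S :: fmat and \<tau> :: "bit vec \<Rightarrow> fmat"
  assumes U: "contr U" and S: "norm S = 1" "adj S = S"  "fid dE * S = S"
    and \<tau>: "\<And>s. s \<in> carrier_vec (n - m) \<Longrightarrow> pos (\<tau> s)"
    and \<tau>_ge: "\<And>x. x \<in> carrier_vec n \<Longrightarrow> pos (\<tau> (g *\<^sub>v x) - \<Phi> x * adj (\<Phi> x))"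
begin

text \<open>The factor \<open>L\<close> covers both purifications of the hashed state:
  \<open>K\<close> for \<open>\<Xi>\<close>, and a signed identity for the purification without a
  copy of \<open>z\<close>. Orthogonality of the \<open>J\<close> selects \<open>k = f z\<close>,
  and Cauchy-Schwarz removes \<open>S\<close>.\<close>

lemma rtr_mult_purif:
  assumes X: "X = (\<Sum>z\<in>carrier_vec n. L z * \<Psi> z * adj (J (f *\<^sub>v z)))"
  shows "rtr (U * X * adj (purif S)) \<le> (1 / sqrt (2 ^ m)) * norm (\<Sum>z\<in>carrier_vec n. adj (J (f *\<^sub>v z)) * U * L z * \<Psi> z)"
proof -
  have trm: "rtr (U * (L z * (\<Psi> z * (adj (J (f *\<^sub>v z)) * (J k * (S * adj (J k)))))))
      = (if k = f *\<^sub>v z then rtr (adj (J (f *\<^sub>v z)) * U * L z * \<Psi> z * S) else 0)"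
    if z: "z \<in> carrier_vec n" and k: "k \<in> carrier_vec m" for z k
  proof -
    have "fid dE * (S * adj (J k)) = S * adj (J k)" by (simp add: S(3) flip: mult.assoc)
    then have "adj (J (f *\<^sub>v z)) * (J k * (S * adj (J k))) = (if k = f *\<^sub>v z then S * adj (J k) else 0)"
      using z k by (intro J_mult_J) auto
    moreover have "rtr (U * (L z * (\<Psi> z * (S * adj (J (f *\<^sub>v z)))))) = rtr (adj (J (f *\<^sub>v z)) * U * L z * \<Psi> z * S)"
      using rtr_comm[of "U * L z * \<Psi> z * S" "adj (J (f *\<^sub>v z))"] by (simp add: mult.assoc)
    ultimately show ?thesis by simp
  qed
  have adj_purif: "adj (purif S) = (1 / sqrt (2 ^ m)) *\<^sub>R (\<Sum>k\<in>carrier_vec m. J k * (S * adj (J k)))"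
    by (simp add: purif_def S(2))
  have "U * X * adj (purif S) = (1 / sqrt (2 ^ m)) *\<^sub>R (\<Sum>z\<in>carrier_vec n. \<Sum>k\<in>carrier_vec m.
      U * (L z * (\<Psi> z * (adj (J (f *\<^sub>v z)) * (J k * (S * adj (J k)))))))"
    unfolding adj_purif X mult.assoc[of U] mult_scaleR_right sum_product
    by (simp add: sum_distrib_left mult.assoc)
  then have "rtr (U * X * adj (purif S)) = (1 / sqrt (2 ^ m)) * (\<Sum>z\<in>carrier_vec n. rtr (adj (J (f *\<^sub>v z)) * U * L z * \<Psi> z * S))"
    by (simp add: rtr_scaleR rtr_sum trm)
  also have "(\<Sum>z\<in>carrier_vec n. rtr (adj (J (f *\<^sub>v z)) * U * L z * \<Psi> z * S))
    = rtr ((\<Sum>z\<in>carrier_vec n. adj (J (f *\<^sub>v z)) * U * L z * \<Psi> z) * S)"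
    by (simp add: sum_distrib_right rtr_sum)
  also have "\<dots> \<le> norm (\<Sum>z\<in>carrier_vec n. adj (J (f *\<^sub>v z)) * U * L z * \<Psi> z)"
    using rtr_mult_le[of _ S] by (simp add: S(1))
  finally show ?thesis by (simp add: divide_right_mono)
qed

lemma sum_\<Psi>_eq_sum_\<Phi>:
  "(\<Sum>z\<in>carrier_vec n. A z * \<Psi> z) = (1 / sqrt (2 ^ n)) *\<^sub>R (\<Sum>x\<in>carrier_vec n. (\<Sum>z\<in>carrier_vec n. chr x z *\<^sub>R A z) * \<Phi> x)"
proof -
  have "(\<Sum>x\<in>carrier_vec n. (\<Sum>z\<in>carrier_vec n. chr x z *\<^sub>R A z) * \<Phi> x)
    = (\<Sum>z\<in>carrier_vec n. A z * (\<Sum>x\<in>carrier_vec n. chr x z *\<^sub>R \<Phi> x))"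
    by (simp add: sum_distrib_left sum_distrib_right) (rule sum.swap)
  also have "\<dots> = (\<Sum>z\<in>carrier_vec n. sqrt (2 ^ n) *\<^sub>R (A z * \<Psi> z))"
    by (intro sum.cong) (simp_all add: sum_chr_\<Phi>)
  finally show ?thesis by (simp flip: scaleR_sum_right)
qed

definition R where "R s = (SOME Q. pos Q \<and> Q * Q = \<tau> s)"

lemma R: "s \<in> carrier_vec (n - m) \<Longrightarrow> R s * adj (R s) = \<tau> s" "s \<in> carrier_vec (n - m) \<Longrightarrow> (norm (R s))\<^sup>2 = rtr (\<tau> s)"
proof -
  assume "s \<in> carrier_vec (n - m)"
  then have "\<exists>Q. pos Q \<and> Q * Q = \<tau> s" by (intro pos_ex_sqrt \<tau>)
  then have "pos (R s) \<and> R s * R s = \<tau> s" unfolding R_def by (rule someI_ex)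
  then show "R s * adj (R s) = \<tau> s" by (simp add: pos_adj)
  then show "(norm (R s))\<^sup>2 = rtr (\<tau> s)" by (simp flip: rtr_mult_adj)
qed

lemma norm_mult_\<Phi>_le: "x \<in> carrier_vec n \<Longrightarrow> norm (Y * \<Phi> x) \<le> norm (Y * R (g *\<^sub>v x))"
  by (intro norm_conj_mono) (simp add: R \<tau>_ge)

text \<open>Orthogonality turns the squared norm of the sum over \<open>x\<close> into a sum of
  squared norms, where \<open>\<Phi> x\<close> may be exchanged for the root \<open>R\<close> at the
  syndrome of \<open>x\<close>. The roots are constant on fibres of \<open>g\<close>, so block
  Parseval applies with \<open>f\<close> and \<open>g\<close> exchanged. The powers of two combine
  to \<open>2 ^ m\<close>, which the prefactor of \<open>purif\<close> cancels.\<close>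

lemma overlap_le_X:
  assumes orth: "\<And>x x'. x \<in> carrier_vec n \<Longrightarrow> x' \<in> carrier_vec n \<Longrightarrow> x \<noteq> x' \<Longrightarrow> \<Phi> x * adj (\<Phi> x') = 0"
  shows "rtr (U * \<Xi> * adj (purif S)) \<le> sqrt (\<Sum>s\<in>carrier_vec (n - m). rtr (\<tau> s))"
proof -
  define A where "A z = adj (J (f *\<^sub>v z)) * U * K z" for z
  define Ah where "Ah x = (\<Sum>z\<in>carrier_vec n. chr x z *\<^sub>R A z)" for x
  define Y where "Y = (\<Sum>z\<in>carrier_vec n. A z * \<Psi> z)"
  define xs where "xs s = (SOME x. x \<in> fibre n g s)" for s
  have xs: "xs s \<in> fibre n g s" if "s \<in> carrier_vec (n - m)" for s
    unfolding xs_def using g_surj[OF that] by (rule someI_ex)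
  interpret sw: dual_pair n "n - m" g f by (rule swap)
  have nn: "n - (n - m) = m" using le by simp
  define V where "V k s = (\<Sum>z\<in>fibre n f k. chr z (xs s) *\<^sub>R A z)" for k s
  define N where "N k s = (\<Sum>z\<in>fibre n f k. chr z (xs s) *\<^sub>R K z)" for k s
  \<comment> \<open>For fixed \<open>k\<close> the signed sum \<open>N k s\<close> contains
    \<open>2 ^ (n - m)\<close> mutually orthogonal isometries, so its Gram operator is that multiple
    of \<open>fid dB\<close>; the contractions \<open>U\<close> and \<open>adj (J k)\<close> cost
    nothing.\<close>
  have V_le: "(norm (V k s * R s))\<^sup>2 \<le> 2 ^ (n - m) * rtr (\<tau> s)"
    if k: "k \<in> carrier_vec m" and s: "s \<in> carrier_vec (n - m)" for k s
  proof -
    have "V k s = adj (J k) * (U * N k s)"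
      unfolding V_def N_def sum_distrib_left
      by (intro sum.cong) (auto simp: A_def fibre_iff mult.assoc)
    then have "norm (V k s * R s) = norm (adj (J k) * (U * (N k s * R s)))" by (simp add: mult.assoc)
    also have "\<dots> \<le> norm (U * (N k s * R s))"
      using J[OF k k] by (intro contrD contr_adj) (auto intro: contr_isometry)
    also have "\<dots> \<le> norm (N k s * R s)" by (rule contrD[OF U])
    finally have "(norm (V k s * R s))\<^sup>2 \<le> (norm (N k s * R s))\<^sup>2" by (intro power_mono) auto
    also have "\<dots> = inner (R s) (adj (N k s) * N k s * R s)"
      by (simp add: power2_norm_eq_inner inner_mult_left mult.assoc)
    also have "adj (N k s) * N k s = (\<Sum>z\<in>fibre n f k. \<Sum>z'\<in>fibre n f k. if z' = z then fid dB else 0)"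
      unfolding N_def adj_sum sum_product
      by (intro sum.cong refl) (auto simp: K fibre_iff)
    also have "\<dots> = 2 ^ (n - m) *\<^sub>R fid dB" using card_fibre[OF k] by (simp add: sum_constant_scaleR)
    also have "inner (R s) (2 ^ (n - m) *\<^sub>R fid dB * R s) = 2 ^ (n - m) * inner (R s) (fid dB * R s)"
      by simp
    also have "inner (R s) (fid dB * R s) \<le> norm (R s) * norm (fid dB * R s)" by (rule norm_cauchy_schwarz)
    also have "\<dots> \<le> norm (R s) * norm (R s)" by (intro mult_left_mono contrD contr_fid) simp
    also have "\<dots> = rtr (\<tau> s)" using R(2)[OF s] by (simp add: power2_eq_square)
    finally show ?thesis by simp
  qed
  have "(norm Y)\<^sup>2 = (1 / 2 ^ n) * rtr ((\<Sum>x\<in>carrier_vec n. Ah x * \<Phi> x) * adj (\<Sum>x\<in>carrier_vec n. Ah x * \<Phi> x))"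
    unfolding rtr_mult_adj[symmetric] Y_def sum_\<Psi>_eq_sum_\<Phi> Ah_def[symmetric] by (simp add: rtr_scaleR)
  also have "(\<Sum>x\<in>carrier_vec n. Ah x * \<Phi> x) * adj (\<Sum>x\<in>carrier_vec n. Ah x * \<Phi> x)
    = (\<Sum>x\<in>carrier_vec n. \<Sum>x'\<in>carrier_vec n. Ah x * ((\<Phi> x * adj (\<Phi> x')) * adj (Ah x')))"
    by (simp add: sum_product mult.assoc)
  also have "\<dots> = (\<Sum>x\<in>carrier_vec n. \<Sum>x'\<in>carrier_vec n. if x' = x then Ah x * \<Phi> x * adj (Ah x * \<Phi> x) else 0)"
  proof (intro sum.cong refl)
    fix x x' :: "bit vec" assume "x \<in> carrier_vec n" "x' \<in> carrier_vec n"
    then show "Ah x * ((\<Phi> x * adj (\<Phi> x')) * adj (Ah x')) = (if x' = x then Ah x * \<Phi> x * adj (Ah x * \<Phi> x) else 0)"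
      using orth[of x x'] by (cases "x' = x") (simp_all add: mult.assoc[of "Ah x"] mult.assoc[of "\<Phi> x"])
  qed
  also have "rtr \<dots> = (\<Sum>x\<in>carrier_vec n. (norm (Ah x * \<Phi> x))\<^sup>2)"
    by (simp add: rtr_sum rtr_mult_adj del: adj_simps)
  also have "\<dots> \<le> (\<Sum>x\<in>carrier_vec n. (norm (Ah x * R (g *\<^sub>v x)))\<^sup>2)"
    by (intro sum_mono power_mono norm_mult_\<Phi>_le) auto
  also have "\<dots> = (\<Sum>s\<in>carrier_vec (n - m). \<Sum>x\<in>fibre n g s. (norm (Ah x * R s))\<^sup>2)"
    by (subst sum_fibres[OF carriers(2), symmetric]) (auto intro!: sum.cong simp: fibre_iff)
  also have "\<dots> = (\<Sum>s\<in>carrier_vec (n - m). 2 ^ m * (\<Sum>k\<in>carrier_vec m. (norm (V k s * R s))\<^sup>2))"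
  proof (rule sum.cong[OF refl])
    fix s :: "bit vec" assume s: "s \<in> carrier_vec (n - m)"
    have "(\<Sum>x\<in>fibre n g s. (norm (Ah x * R s))\<^sup>2)
      = rtr (\<Sum>x\<in>fibre n g s. (\<Sum>z\<in>carrier_vec n. chr z x *\<^sub>R (A z * R s)) * (\<Sum>z\<in>carrier_vec n. chr z x *\<^sub>R adj (A z * R s)))"
      unfolding rtr_sum rtr_mult_adj[symmetric]
    proof (rule sum.cong[OF refl])
      fix x assume "x \<in> fibre n g s"
      then have "Ah x * R s = (\<Sum>z\<in>carrier_vec n. chr z x *\<^sub>R (A z * R s))"
        unfolding Ah_def sum_distrib_right by (intro sum.cong) (auto simp: fibre_iff chr_commute[of x n])
      then show "rtr (Ah x * R s * adj (Ah x * R s))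
        = rtr ((\<Sum>z\<in>carrier_vec n. chr z x *\<^sub>R (A z * R s)) * (\<Sum>z\<in>carrier_vec n. chr z x *\<^sub>R adj (A z * R s)))"
        by (simp only: adj_sum adj_simps(5))
    qed
    also have "\<dots> = 2 ^ m * (\<Sum>k\<in>carrier_vec m. rtr ((\<Sum>z\<in>fibre n f k. chr z (xs s) *\<^sub>R (A z * R s)) * (\<Sum>z\<in>fibre n f k. chr z (xs s) *\<^sub>R adj (A z * R s))))"
      unfolding sw.coset_parseval[OF xs[OF s]] nn by (simp add: rtr_scaleR rtr_sum)
    also have "\<dots> = 2 ^ m * (\<Sum>k\<in>carrier_vec m. (norm (V k s * R s))\<^sup>2)"
      unfolding rtr_mult_adj[symmetric] V_def sum_distrib_right adj_sum by simp
    finally show "(\<Sum>x\<in>fibre n g s. (norm (Ah x * R s))\<^sup>2) = 2 ^ m * (\<Sum>k\<in>carrier_vec m. (norm (V k s * R s))\<^sup>2)" .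
  qed
  also have "\<dots> \<le> (\<Sum>s\<in>carrier_vec (n - m). 2 ^ m * (\<Sum>k\<in>(carrier_vec m :: bit vec set). 2 ^ (n - m) * rtr (\<tau> s)))"
    by (intro sum_mono mult_left_mono V_le) auto
  also have "\<dots> = 2 ^ m * (2 ^ m * 2 ^ (n - m)) * (\<Sum>s\<in>carrier_vec (n - m). rtr (\<tau> s))"
    by (simp add: sum_distrib_left mult_ac)
  also have "2 ^ m * 2 ^ (n - m) = (2 ^ n :: real)" using le by (simp flip: power_add)
  finally have Y: "(norm Y)\<^sup>2 \<le> 2 ^ m * (\<Sum>s\<in>carrier_vec (n - m). rtr (\<tau> s))"
    by (simp add: field_simps)
  have "rtr (U * \<Xi> * adj (purif S)) \<le> (1 / sqrt (2 ^ m)) * norm Y"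
    using rtr_mult_purif[OF \<Xi>_def] by (simp add: Y_def A_def)
  also have "\<dots> \<le> (1 / sqrt (2 ^ m)) * sqrt (2 ^ m * (\<Sum>s\<in>carrier_vec (n - m). rtr (\<tau> s)))"
    by (intro mult_left_mono real_le_rsqrt Y) simp
  also have "\<dots> = sqrt (\<Sum>s\<in>carrier_vec (n - m). rtr (\<tau> s))" by (simp add: real_sqrt_mult)
  finally show ?thesis .
qed

text \<open>Apart from its sign, the coefficient \<open>A z\<close> depends on \<open>z\<close> only
  through \<open>f z\<close>. Its Fourier transform therefore lives on the fibre of \<open>g\<close>
  through \<open>x0\<close>, and only the operator \<open>\<tau> s\<close> enters the bound.\<close>

lemma overlap_le_Z:
  assumes s: "s \<in> carrier_vec (n - m)" and x0: "x0 \<in> fibre n g s"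
    and X: "X = (\<Sum>z\<in>carrier_vec n. chr x0 z *\<^sub>R \<Psi> z * adj (J (f *\<^sub>v z)))"
  shows "rtr (U * X * adj (purif S)) \<le> sqrt (2 ^ (n - m) * rtr (\<tau> s))"
proof -
  have x0c: "x0 \<in> carrier_vec n" "g *\<^sub>v x0 = s" using x0 by (auto simp: fibre_iff)
  define A where "A z = chr x0 z *\<^sub>R (adj (J (f *\<^sub>v z)) * U)" for z
  define Ah where "Ah x = (\<Sum>z\<in>carrier_vec n. chr x z *\<^sub>R A z)" for x
  define Y where "Y = (\<Sum>z\<in>carrier_vec n. A z * \<Psi> z)"
  \<comment> \<open>The signs of \<open>x\<close> and \<open>x0\<close> merge into the character of
    \<open>x + x0\<close>, whose syndrome is nonzero, so it sums to zero over each fibre of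
    \<open>f\<close>.\<close>
  have Ah0: "Ah x = 0" if x: "x \<in> carrier_vec n" and "x \<notin> fibre n g s" for x
  proof -
    have ne: "g *\<^sub>v (x + x0) \<noteq> 0\<^sub>v (n - m)"
      using that x0c s by (simp add: g_add bits_add_eq_0[OF image_carrier(2)[OF x] s] fibre_iff)
    have "Ah x = (\<Sum>k\<in>carrier_vec m. \<Sum>z\<in>fibre n f k. chr (x + x0) z *\<^sub>R (adj (J k) * U))"
      unfolding Ah_def A_def sum_fibres[OF carriers(1), symmetric]
      using x x0c by (intro sum.cong refl) (auto simp: fibre_iff chr_add_left[of _ n])
    also have "\<dots> = (\<Sum>k\<in>carrier_vec m. (\<Sum>z\<in>fibre n f k. chr (x + x0) z) *\<^sub>R (adj (J k) * U))"
      by (simp add: scaleR_sum_left)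
    also have "\<dots> = 0"
    proof (rule sum.neutral, rule ballI)
      fix k :: "bit vec" assume "k \<in> carrier_vec m"
      then obtain z where "z \<in> fibre n f k" using f_surj by blast
      then show "(\<Sum>z\<in>fibre n f k. chr (x + x0) z) *\<^sub>R (adj (J k) * U) = 0"
        using sum_chr_fibre[of "x + x0" z k] ne x x0c by simp
    qed
    finally show ?thesis .
  qed
  have card: "card (fibre n g s) = 2 ^ m"
  proof -
    interpret sw: dual_pair n "n - m" g f by (rule swap)
    show ?thesis using sw.card_fibre[OF s] le by simp
  qed
  have "2 ^ n * (norm Y)\<^sup>2 = (norm (\<Sum>x\<in>carrier_vec n. Ah x * \<Phi> x))\<^sup>2"
    unfolding Y_def sum_\<Psi>_eq_sum_\<Phi> Ah_def[symmetric] by (simp add: power_mult_distrib power_divide)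
  also have "(\<Sum>x\<in>carrier_vec n. Ah x * \<Phi> x) = (\<Sum>x\<in>fibre n g s. Ah x * \<Phi> x)"
    by (rule sum.mono_neutral_right) (auto simp: Ah0 fibre_carrier)
  \<comment> \<open>Cauchy-Schwarz over a fibre of \<open>g\<close>, which has \<open>2 ^ m\<close>
    elements.\<close>
  also have "(norm \<dots>)\<^sup>2 \<le> 2 ^ m * (\<Sum>x\<in>fibre n g s. (norm (Ah x * \<Phi> x))\<^sup>2)"
    using norm_sum_squared_le[of "fibre n g s"] by (simp add: card)
  also have "(\<Sum>x\<in>fibre n g s. (norm (Ah x * \<Phi> x))\<^sup>2) \<le> (\<Sum>x\<in>fibre n g s. (norm (Ah x * R s))\<^sup>2)"
  proof (intro sum_mono power_mono)
    fix x assume "x \<in> fibre n g s"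
    then show "norm (Ah x * \<Phi> x) \<le> norm (Ah x * R s)"
      using norm_mult_\<Phi>_le[of x "Ah x"] by (simp add: fibre_iff)
  qed simp
  \<comment> \<open>Extending the sum to all strings makes the full Parseval identity
    available.\<close>
  also have "\<dots> \<le> (\<Sum>x\<in>carrier_vec n. (norm (Ah x * R s))\<^sup>2)"
    by (rule sum_mono2) (auto simp: fibre_carrier)
  also have "\<dots> = rtr (\<Sum>x\<in>carrier_vec n. (\<Sum>z\<in>carrier_vec n. chr x z *\<^sub>R (A z * R s)) * (\<Sum>z\<in>carrier_vec n. chr x z *\<^sub>R adj (A z * R s)))"
    unfolding rtr_sum rtr_mult_adj[symmetric] Ah_def sum_distrib_right adj_sum by simp
  also have "\<dots> = 2 ^ n * (\<Sum>z\<in>carrier_vec n. (norm (A z * R s))\<^sup>2)"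
    unfolding parseval by (simp add: rtr_scaleR rtr_sum rtr_mult_adj del: adj_simps)
  also have "(\<Sum>z\<in>carrier_vec n. (norm (A z * R s))\<^sup>2) = (\<Sum>k\<in>carrier_vec m. \<Sum>z\<in>fibre n f k. (norm (adj (J k) * (U * R s)))\<^sup>2)"
  proof -
    have "norm (A z * R s) = norm (adj (J (f *\<^sub>v z)) * (U * R s))" for z
      by (simp add: A_def chr_def mult.assoc)
    then show ?thesis
      by (subst sum_fibres[OF carriers(1), symmetric]) (auto intro!: sum.cong simp: fibre_iff)
  qed
  also have "\<dots> = 2 ^ (n - m) * (\<Sum>k\<in>carrier_vec m. (norm (adj (J k) * (U * R s)))\<^sup>2)"
    by (simp add: card_fibre sum_distrib_left)
  \<comment> \<open>The \<open>2 ^ m\<close> hash values together cost a single squared norm because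
    the ranges of the \<open>J k\<close> are orthogonal. Bounding them one by one would lose a
    factor \<open>2 ^ m\<close>.\<close>
  also have "(\<Sum>k\<in>carrier_vec m. (norm (adj (J k) * (U * R s)))\<^sup>2) \<le> (norm (U * R s))\<^sup>2"
    by (rule bessel) (auto simp: J)
  also have "\<dots> \<le> (norm (R s))\<^sup>2" by (intro power_mono contrD U) simp
  also have "\<dots> = rtr (\<tau> s)" by (rule R(2)[OF s])
  finally have "2 ^ n * (norm Y)\<^sup>2 \<le> 2 ^ m * (2 ^ n * (2 ^ (n - m) * rtr (\<tau> s)))"
    by simp
  then have Y: "(norm Y)\<^sup>2 \<le> 2 ^ m * (2 ^ (n - m) * rtr (\<tau> s))"
    by (simp add: mult.left_commute[of "2 ^ m"])
  have X': "X = (\<Sum>z\<in>carrier_vec n. (chr x0 z *\<^sub>R fid dB) * \<Psi> z * adj (J (f *\<^sub>v z)))"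
    unfolding X by (intro sum.cong) (auto simp: \<Psi>_left)
  have "rtr (U * X * adj (purif S)) \<le> (1 / sqrt (2 ^ m)) * norm Y"
  proof -
    have "(\<Sum>z\<in>carrier_vec n. adj (J (f *\<^sub>v z)) * U * (chr x0 z *\<^sub>R fid dB) * \<Psi> z) = Y"
      unfolding Y_def A_def by (intro sum.cong) (auto simp: \<Psi>_left mult.assoc)
    then show ?thesis using rtr_mult_purif[OF X'] by simp
  qed
  also have "\<dots> \<le> (1 / sqrt (2 ^ m)) * sqrt (2 ^ m * (2 ^ (n - m) * rtr (\<tau> s)))"
    by (intro mult_left_mono real_le_rsqrt Y) simp
  also have "\<dots> = sqrt (2 ^ (n - m) * rtr (\<tau> s))" by (simp add: real_sqrt_mult)
  finally show ?thesis .
qed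

end

lemma gram_Z:
  assumes orth: "\<And>z z'. z \<in> carrier_vec n \<Longrightarrow> z' \<in> carrier_vec n \<Longrightarrow> z \<noteq> z' \<Longrightarrow> adj (\<Psi> z) * \<Psi> z' = 0"
    and X: "X = (\<Sum>z\<in>carrier_vec n. chr x0 z *\<^sub>R \<Psi> z * adj (J (f *\<^sub>v z)))"
  shows "adj X * X = \<rho>KE"
proof -
  have "adj X * X = (\<Sum>z\<in>carrier_vec n. \<Sum>z'\<in>carrier_vec n. (chr x0 z * chr x0 z') *\<^sub>R
      (J (f *\<^sub>v z) * ((adj (\<Psi> z) * \<Psi> z') * adj (J (f *\<^sub>v z')))))"
    unfolding X by (simp add: sum_product mult.assoc mult.commute)
  also have "\<dots> = (\<Sum>z\<in>carrier_vec n. \<Sum>z'\<in>carrier_vec n. if z' = z then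
      J (f *\<^sub>v z) * (adj (\<Psi> z) * \<Psi> z) * adj (J (f *\<^sub>v z)) else 0)"
  proof (intro sum.cong refl)
    fix z z' :: "bit vec" assume "z \<in> carrier_vec n" "z' \<in> carrier_vec n"
    then show "(chr x0 z * chr x0 z') *\<^sub>R (J (f *\<^sub>v z) * ((adj (\<Psi> z) * \<Psi> z') * adj (J (f *\<^sub>v z'))))
      = (if z' = z then J (f *\<^sub>v z) * (adj (\<Psi> z) * \<Psi> z) * adj (J (f *\<^sub>v z)) else 0)"
      by (cases "z' = z") (simp add: mult.assoc, simp add: orth)
  qed
  finally show ?thesis by (simp add: \<rho>KE_def)
qed

end

section \<open>Nearly optimal dual operators\<close>

lemma norm_fmat_bounded: "bounded_by N A \<Longrightarrow> (norm A)\<^sup>2 = (\<Sum>i<N. \<Sum>j<N. (cmod (entry A j i))\<^sup>2)"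
  unfolding power2_norm_eq_inner[of A] by (rule inner_fmat_bounded)

lemma norm_mult_fmat_le: "norm (A * B) \<le> norm A * norm B" for A B :: fmat
proof (rule power2_le_imp_le)
  obtain N where N: "bounded_by N A" "bounded_by N B" using ex_bounded_by2 by blast
  have "(norm (A * B))\<^sup>2 = (\<Sum>k<N. \<Sum>i<N. (cmod (\<Sum>j<N. entry A i j * entry B j k))\<^sup>2)"
    by (simp add: norm_fmat_bounded[OF bounded_by_times[OF N]] entry_times[OF N(1)])
  also have "\<dots> \<le> (\<Sum>k<N. \<Sum>i<N. (\<Sum>j<N. (cmod (entry A i j))\<^sup>2) * (\<Sum>j<N. (cmod (entry B j k))\<^sup>2))"
  proof (intro sum_mono)
    fix i k
    have "(cmod (\<Sum>j<N. entry A i j * entry B j k))\<^sup>2 \<le> (\<Sum>j<N. cmod (entry A i j) * cmod (entry B j k))\<^sup>2"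
      by (intro power_mono) (auto intro: order_trans[OF norm_sum] simp: norm_mult)
    also have "\<dots> \<le> (\<Sum>j<N. (cmod (entry A i j))\<^sup>2) * (\<Sum>j<N. (cmod (entry B j k))\<^sup>2)"
      by (rule Cauchy_Schwarz_ineq_sum)
    finally show "(cmod (\<Sum>j<N. entry A i j * entry B j k))\<^sup>2
      \<le> (\<Sum>j<N. (cmod (entry A i j))\<^sup>2) * (\<Sum>j<N. (cmod (entry B j k))\<^sup>2)" .
  qed
  also have "\<dots> = (\<Sum>i<N. \<Sum>j<N. (cmod (entry A i j))\<^sup>2) * (norm B)\<^sup>2"
    by (simp add: norm_fmat_bounded[OF N(2)] flip: sum_distrib_left sum_distrib_right)
  also have "(\<Sum>i<N. \<Sum>j<N. (cmod (entry A i j))\<^sup>2) = (norm A)\<^sup>2"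
    unfolding norm_fmat_bounded[OF N(1)] by (rule sum.swap)
  finally show "(norm (A * B))\<^sup>2 \<le> (norm A * norm B)\<^sup>2" by (simp add: power_mult_distrib)
qed simp

text \<open>Unit test vectors inside dimension \<open>d\<close> suffice by homogeneity. On them
  \<open>fid d\<close> has expectation 1, so a multiple of it can absorb a uniform error.\<close>

lemma pos_iff_fid_test:
  assumes "adj A = A" "fid d * A = A"
    and test: "\<And>Y. fid d * Y = Y \<Longrightarrow> norm Y = 1 \<Longrightarrow> 0 \<le> inner Y (A * Y)"
  shows "pos A"
proof (rule posI[OF assms(1)])
  fix Y
  define Z where "Z = fid d * Y"
  have "A * fid d = A" using arg_cong[OF assms(2), of adj] assms(1) by simp
  then have AY: "A * Y = A * Z" by (metis Z_def mult.assoc)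
  have "inner Y (A * Y) = inner Y (fid d * (A * Z))" by (metis AY assms(2) mult.assoc)
  also have "\<dots> = inner Z (A * Z)" by (simp add: Z_def inner_mult_left)
  also have "0 \<le> \<dots>"
  proof (cases "Z = 0")
    case False
    define W where "W = Z /\<^sub>R norm Z"
    have "fid d * Z = Z" by (simp add: Z_def flip: mult.assoc)
    then have "0 \<le> inner W (A * W)" using False by (intro test) (simp_all add: W_def)
    moreover have "inner Z (A * Z) = (norm Z)\<^sup>2 * inner W (A * W)"
      using False by (simp add: W_def power2_eq_square field_simps)
    ultimately show ?thesis by simp
  qed simp
  finally show "0 \<le> inner Y (A * Y)" .
qed

context purified
begin

definition povm_op :: "(bit vec \<Rightarrow> bit vec \<Rightarrow> fmat) \<Rightarrow> bool" where
  "povm_op M \<longleftrightarrow> (\<forall>s\<in>carrier_vec (n - m). (\<forall>e\<in>carrier_vec n. pos (M s e) \<and> fid dB * M s e = M s e) \<and>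
     (\<Sum>e\<in>carrier_vec n. M s e) = fid dB)"

definition success :: "(bit vec \<Rightarrow> bit vec \<Rightarrow> fmat) \<Rightarrow> real" where
  "success M = (\<Sum>x\<in>carrier_vec n. rtr (\<Phi> x * adj (\<Phi> x) * M (g *\<^sub>v x) x))"

text \<open>Only the POVM of the syndrome of \<open>j\<close> changes. The operator freed by
  compressing with \<open>T\<close> is \<open>D = fid dB - T * T\<close>, and it is reassigned to
  outcome \<open>j\<close>. The first-order change in success compares
  \<open>\<Phi> j * adj (\<Phi> j)\<close> with the symmetrized sum over the fibre, in the direction
  \<open>Y\<close>.\<close>

lemma perturbed_success_le:
  assumes M: "povm_op M" and j: "j \<in> carrier_vec n"
    and Y: "fid dB * Y = Y" "norm Y = 1" and r: "0 < r" "r \<le> 1"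
    and upper: "\<And>M. povm_op M \<Longrightarrow> success M \<le> \<beta>"
  defines "s \<equiv> g *\<^sub>v j"
  shows "success M - r * (\<Sum>x\<in>fibre n g s. inner Y ((\<Phi> x * adj (\<Phi> x) * M s x + M s x * (\<Phi> x * adj (\<Phi> x))) * Y))
    + 2 * r * inner Y (\<Phi> j * adj (\<Phi> j) * Y) - r\<^sup>2 * (norm (\<Phi> j))\<^sup>2 \<le> \<beta>"
proof -
  have s: "s \<in> carrier_vec (n - m)" using j by (simp add: s_def)
  define L where "L = Y * adj Y"
  define T where "T = fid dB - r *\<^sub>R L"
  define D where "D = (2 * r) *\<^sub>R L - r\<^sup>2 *\<^sub>R (L * L)"
  define M' where "M' s' e = (if s' = s then T * M s e * T + (if e = j then D else 0) else M s' e)" for s' e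
  have adjL: "adj L = L" by (simp add: L_def)
  have fidL: "fid dB * L = L" by (simp add: L_def Y(1) flip: mult.assoc)
  have Lfid: "L * fid dB = L" using arg_cong[OF fidL, of adj] adjL by simp
  have adjT: "adj T = T" by (simp add: T_def adjL)
  have fidT: "fid dB * T = T" by (simp add: T_def right_diff_distrib fidL)
  have contr_L: "norm (L * Z) \<le> norm Z" for Z
  proof -
    have "norm (L * Z) \<le> norm L * norm Z" by (rule norm_mult_fmat_le)
    also have "norm L \<le> norm Y * norm (adj Y)" unfolding L_def by (rule norm_mult_fmat_le)
    finally show ?thesis using Y(2) by (simp add: mult_right_mono)
  qed
  \<comment> \<open>Uses \<open>r \<le> 1\<close> together with
    \<open>norm (L * Z) \<le> norm (adj Y * Z)\<close>, which holds because \<open>Y\<close> has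
    norm 1.\<close>
  have posD: "pos D"
  proof (rule posI)
    fix Z
    have "(norm (L * Z))\<^sup>2 \<le> (norm (adj Y * Z))\<^sup>2"
      using norm_mult_fmat_le[of Y "adj Y * Z"] Y(2) by (intro power_mono) (simp_all add: L_def mult.assoc)
    moreover have "r\<^sup>2 * (norm (L * Z))\<^sup>2 \<le> 2 * r * (norm (L * Z))\<^sup>2"
      using r by (intro mult_right_mono) (simp_all add: power2_eq_square)
    moreover have "2 * r * (norm (L * Z))\<^sup>2 \<le> 2 * r * (norm (adj Y * Z))\<^sup>2"
      using r calculation(1) by simp
    moreover have "inner Z (D * Z) = 2 * r * (norm (adj Y * Z))\<^sup>2 - r\<^sup>2 * (norm (L * Z))\<^sup>2"
      by (simp add: D_def left_diff_distrib inner_diff_right power2_norm_eq_inner inner_mult_left adjL mult.assoc)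
        (simp add: L_def mult.assoc)
    ultimately show "0 \<le> inner Z (D * Z)" by linarith
  qed (simp add: D_def adjL)
  have fidD: "fid dB * D = D" by (simp add: D_def right_diff_distrib fidL flip: mult.assoc)
  have Ms: "pos (M s e)" "fid dB * M s e = M s e" if "e \<in> carrier_vec n" for e
    using M s that by (auto simp: povm_op_def)
  have Ms_fid: "M s e * fid dB = M s e" if "e \<in> carrier_vec n" for e
    using arg_cong[OF Ms(2)[OF that], of adj] pos_adj[OF Ms(1)[OF that]] by simp
  have sumM: "(\<Sum>e\<in>carrier_vec n. M s e) = fid dB" using M s by (auto simp: povm_op_def)
  have "povm_op M'"
    unfolding povm_op_def
  proof (intro ballI conjI)
    fix s' e :: "bit vec" assume "s' \<in> carrier_vec (n - m)" "e \<in> carrier_vec n"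
    then have "pos (M s' e)" "fid dB * M s' e = M s' e" using M by (auto simp: povm_op_def)
    then show "pos (M' s' e)" "fid dB * M' s' e = M' s' e"
      using pos_conj[of "M s e" T] posD pos_add
      by (auto simp: M'_def adjT fidD fidT distrib_left simp flip: mult.assoc)
  next
    fix s' :: "bit vec" assume s': "s' \<in> carrier_vec (n - m)"
    show "(\<Sum>e\<in>carrier_vec n. M' s' e) = fid dB"
    proof (cases "s' = s")
      case True
      have "(\<Sum>e\<in>carrier_vec n. M' s' e) = T * fid dB * T + D"
        using True j by (simp add: M'_def sum.distrib flip: sum_distrib_left sum_distrib_right sumM)
      also have "\<dots> = fid dB"
        by (simp add: T_def D_def algebra_simps fidL Lfid power2_eq_square scaleR_2 flip: scaleR_scaleR)
      finally show ?thesis .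
    next
      case False
      with M s' show ?thesis by (simp add: M'_def povm_op_def)
    qed
  qed
  then have "success M' \<le> \<beta>" by (rule upper)
  have jf: "j \<in> fibre n g s" using j by (simp add: fibre_iff s_def)
  have diff: "success M' = success M + (\<Sum>x\<in>fibre n g s. rtr (\<Phi> x * adj (\<Phi> x) * (M' s x - M s x)))"
  proof -
    have "success M' - success M = (\<Sum>x\<in>carrier_vec n. rtr (\<Phi> x * adj (\<Phi> x) * (M' (g *\<^sub>v x) x - M (g *\<^sub>v x) x)))"
      unfolding success_def by (simp add: right_diff_distrib rtr_diff sum_subtractf)
    also have "\<dots> = (\<Sum>x\<in>fibre n g s. rtr (\<Phi> x * adj (\<Phi> x) * (M' s x - M s x)))"
      by (rule sum.mono_neutral_cong_right) (auto simp: fibre_iff M'_def)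
    finally show ?thesis by simp
  qed
  \<comment> \<open>An inequality, because the second-order term with \<open>L * M s x * L\<close>
    is nonnegative and is dropped.\<close>
  have expand: "rtr (\<Phi> x * adj (\<Phi> x) * (M' s x - M s x))
      \<ge> - r * inner Y ((\<Phi> x * adj (\<Phi> x) * M s x + M s x * (\<Phi> x * adj (\<Phi> x))) * Y)
        + (if x = j then 2 * r * inner Y (\<Phi> j * adj (\<Phi> j) * Y) - r\<^sup>2 * (norm (\<Phi> j))\<^sup>2 else 0)"
    if x: "x \<in> fibre n g s" for x
  proof -
    have xc: "x \<in> carrier_vec n" using x by (rule fibre_carrier)
    let ?P = "\<Phi> x * adj (\<Phi> x)"
    have TMT: "T * M s x * T = M s x - r *\<^sub>R (L * M s x + M s x * L) + r\<^sup>2 *\<^sub>R (L * M s x * L)"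
      by (simp add: T_def algebra_simps Ms Ms_fid xc power2_eq_square)
    have e1: "rtr (?P * (T * M s x * T - M s x)) = - r * rtr (?P * L * M s x + ?P * M s x * L) + r\<^sup>2 * rtr (?P * (L * M s x * L))"
      unfolding TMT by (simp add: algebra_simps rtr_diff rtr_add rtr_scaleR)
    have e2: "rtr (?P * L * M s x + ?P * M s x * L) = inner Y ((?P * M s x + M s x * ?P) * Y)"
    proof -
      have "rtr (?P * L * M s x) = rtr (adj Y * (M s x * ?P) * Y)"
        using rtr_comm[of "M s x * ?P * Y" "adj Y"] rtr_comm[of "?P * L" "M s x"] by (simp add: L_def mult.assoc)
      moreover have "rtr (?P * M s x * L) = rtr (adj Y * (?P * M s x) * Y)"
        using rtr_comm[of "?P * M s x * Y" "adj Y"] by (simp add: L_def mult.assoc)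
      ultimately show ?thesis by (simp add: inner_fmat_def algebra_simps rtr_add)
    qed
    have e3: "0 \<le> rtr (?P * (L * M s x * L))"
    proof -
      have "rtr (?P * (L * M s x * L)) = rtr (adj (L * \<Phi> x) * M s x * (L * \<Phi> x))"
        using rtr_comm[of "\<Phi> x" "adj (\<Phi> x) * (L * M s x * L)"] by (simp add: adjL mult.assoc)
      then show ?thesis using rtr_conj_nonneg[OF Ms(1)[OF xc], of "L * \<Phi> x"] by (simp only:)
    qed
    have e4: "rtr (?P * D) \<ge> 2 * r * inner Y (?P * Y) - r\<^sup>2 * (norm (\<Phi> x))\<^sup>2"
    proof -
      have "rtr (?P * L) = inner Y (?P * Y)"
        using rtr_comm[of "?P * Y" "adj Y"] by (simp add: L_def inner_fmat_def mult.assoc)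
      moreover have "rtr (?P * (L * L)) = (norm (L * \<Phi> x))\<^sup>2"
        using rtr_comm[of "\<Phi> x" "adj (\<Phi> x) * (L * L)"] by (simp add: adjL mult.assoc flip: rtr_adj_mult)
      moreover have "(norm (L * \<Phi> x))\<^sup>2 \<le> (norm (\<Phi> x))\<^sup>2" using contr_L by (intro power_mono) auto
      ultimately show ?thesis by (simp add: D_def right_diff_distrib rtr_diff rtr_scaleR mult_left_mono)
    qed
    have "rtr (?P * (M' s x - M s x)) = rtr (?P * (T * M s x * T - M s x)) + (if x = j then rtr (?P * D) else 0)"
      by (simp add: M'_def algebra_simps rtr_add rtr_diff)
    moreover have "0 \<le> r\<^sup>2 * rtr (?P * (L * M s x * L))" using e3 by simp
    ultimately show ?thesis using e4 unfolding e1 e2 by (cases "x = j") auto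
  qed
  have "- r * (\<Sum>x\<in>fibre n g s. inner Y ((\<Phi> x * adj (\<Phi> x) * M s x + M s x * (\<Phi> x * adj (\<Phi> x))) * Y))
      + (2 * r * inner Y (\<Phi> j * adj (\<Phi> j) * Y) - r\<^sup>2 * (norm (\<Phi> j))\<^sup>2)
    = (\<Sum>x\<in>fibre n g s. - r * inner Y ((\<Phi> x * adj (\<Phi> x) * M s x + M s x * (\<Phi> x * adj (\<Phi> x))) * Y)
        + (if x = j then 2 * r * inner Y (\<Phi> j * adj (\<Phi> j) * Y) - r\<^sup>2 * (norm (\<Phi> j))\<^sup>2 else 0))"
    unfolding sum.distrib sum_distrib_left[symmetric] using jf by simp
  also have "\<dots> \<le> (\<Sum>x\<in>fibre n g s. rtr (\<Phi> x * adj (\<Phi> x) * (M' s x - M s x)))"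
    by (intro sum_mono expand)
  finally show ?thesis using \<open>success M' \<le> \<beta>\<close> diff by simp
qed

lemma near_optimal_dual:
  assumes upper: "\<And>M. povm_op M \<Longrightarrow> success M \<le> \<beta>"
    and near: "\<And>\<delta>. 0 < \<delta> \<Longrightarrow> \<exists>M. povm_op M \<and> \<beta> - \<delta> < success M"
    and small: "\<And>x. x \<in> carrier_vec n \<Longrightarrow> norm (\<Phi> x) \<le> 1" and \<epsilon>: "0 < \<epsilon>"
  shows "\<exists>\<tau>. (\<forall>s\<in>carrier_vec (n - m). pos (\<tau> s) \<and> fid dB * \<tau> s = \<tau> s) \<and>
    (\<forall>x\<in>carrier_vec n. pos (\<tau> (g *\<^sub>v x) - \<Phi> x * adj (\<Phi> x))) \<and>
    (\<Sum>s\<in>carrier_vec (n - m). rtr (\<tau> s)) \<le> \<beta> + \<epsilon>"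
proof -
  \<comment> \<open>\<open>M\<close> is optimal up to \<open>r\<^sup>2\<close>, so perturbing it at scale \<open>r\<close> bounds the failure of
    \<open>\<rho>\<^sub>B\<^sup>x \<le> G s\<close> by \<open>r\<close>, which the multiple \<open>r\<close> of the identity in \<open>\<tau>\<close> absorbs.\<close>
  define c where "c = real dB * 2 ^ (n - m) + 1"
  have c: "1 \<le> c" by (simp add: c_def)
  \<comment> \<open>Adding \<open>r *\<^sub>R fid dB\<close> for every syndrome raises the total
    trace by \<open>r * dB * 2 ^ (n - m)\<close>, hence the division by \<open>c\<close>. The
    minimum with 1 is the bound on \<open>r\<close> in \<open>perturbed_success_le\<close>.\<close>
  define r where "r = min 1 (\<epsilon> / c)"
  have r: "0 < r" "r \<le> 1" "r * c \<le> \<epsilon>"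
    using c \<epsilon> by (auto simp: r_def min_def field_simps)
  obtain M where M: "povm_op M" "\<beta> - r\<^sup>2 < success M" using near[of "r\<^sup>2"] r(1) by auto
  define G where "G s = (1/2) *\<^sub>R (\<Sum>x\<in>fibre n g s. \<Phi> x * adj (\<Phi> x) * M s x + M s x * (\<Phi> x * adj (\<Phi> x)))" for s
  define \<tau> where "\<tau> s = G s + r *\<^sub>R fid dB" for s
  have Ms: "pos (M s e)" "fid dB * M s e = M s e" if "s \<in> carrier_vec (n - m)" "e \<in> carrier_vec n" for s e
    using M(1) that by (auto simp: povm_op_def)
  have adj\<tau>: "adj (\<tau> s) = \<tau> s" if s: "s \<in> carrier_vec (n - m)" for s
  proof -
    have "adj (G s) = G s" unfolding G_def adj_simps adj_sum
      by (intro arg_cong[where f = "scaleR _"] sum.cong refl)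
        (simp add: pos_adj[OF Ms(1)[OF s]] fibre_carrier add.commute mult.assoc)
    then show ?thesis by (simp add: \<tau>_def)
  qed
  have fid\<tau>: "fid dB * \<tau> s = \<tau> s" if s: "s \<in> carrier_vec (n - m)" for s
  proof -
    have "fid dB * G s = G s" unfolding G_def mult_scaleR_right sum_distrib_left
      by (intro arg_cong[where f = "scaleR _"] sum.cong refl)
        (simp add: distrib_left Ms(2)[OF s] fibre_carrier \<Phi>_left flip: mult.assoc)
    then show ?thesis by (simp add: \<tau>_def distrib_left)
  qed
  have ge: "pos (\<tau> (g *\<^sub>v j) - \<Phi> j * adj (\<Phi> j))" if j: "j \<in> carrier_vec n" for j
  proof (rule pos_iff_fid_test[of _ dB])
    have s: "g *\<^sub>v j \<in> carrier_vec (n - m)" using j by simp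
    show "adj (\<tau> (g *\<^sub>v j) - \<Phi> j * adj (\<Phi> j)) = \<tau> (g *\<^sub>v j) - \<Phi> j * adj (\<Phi> j)"
      by (simp add: adj\<tau>[OF s])
    show "fid dB * (\<tau> (g *\<^sub>v j) - \<Phi> j * adj (\<Phi> j)) = \<tau> (g *\<^sub>v j) - \<Phi> j * adj (\<Phi> j)"
      by (simp add: right_diff_distrib fid\<tau>[OF s] \<Phi>_left j flip: mult.assoc)
    fix Y assume Y: "fid dB * Y = Y" "norm Y = 1"
    have "2 * inner Y (G (g *\<^sub>v j) * Y) = (\<Sum>x\<in>fibre n g (g *\<^sub>v j).
        inner Y ((\<Phi> x * adj (\<Phi> x) * M (g *\<^sub>v j) x + M (g *\<^sub>v j) x * (\<Phi> x * adj (\<Phi> x))) * Y))"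
      unfolding G_def by (simp add: sum_distrib_right inner_sum_right)
    with perturbed_success_le[OF M(1) j Y r(1,2) upper]
    have "success M - r * (2 * inner Y (G (g *\<^sub>v j) * Y)) + 2 * r * inner Y (\<Phi> j * adj (\<Phi> j) * Y)
        - r\<^sup>2 * (norm (\<Phi> j))\<^sup>2 \<le> \<beta>" by simp
    moreover have "r\<^sup>2 * (norm (\<Phi> j))\<^sup>2 \<le> r\<^sup>2 * 1"
      using small[OF j] by (intro mult_left_mono power_le_one) auto
    ultimately have "r * (2 * (inner Y (\<Phi> j * adj (\<Phi> j) * Y) - inner Y (G (g *\<^sub>v j) * Y))) \<le> r * (2 * r)"
      using M(2) by (simp add: algebra_simps power2_eq_square)
    then have "inner Y (\<Phi> j * adj (\<Phi> j) * Y) - inner Y (G (g *\<^sub>v j) * Y) \<le> r" using r(1) by simp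
    moreover have "inner Y ((\<tau> (g *\<^sub>v j) - \<Phi> j * adj (\<Phi> j)) * Y)
      = inner Y (G (g *\<^sub>v j) * Y) + r - inner Y (\<Phi> j * adj (\<Phi> j) * Y)"
      using Y by (simp add: \<tau>_def left_diff_distrib distrib_right inner_diff_right inner_add_right)
        (simp flip: power2_norm_eq_inner)
    ultimately show "0 \<le> inner Y ((\<tau> (g *\<^sub>v j) - \<Phi> j * adj (\<Phi> j)) * Y)" by simp
  qed
  \<comment> \<open>Surjectivity of \<open>g\<close> provides some \<open>j\<close> with this
    syndrome, and \<open>\<tau> s\<close> dominates the positive operator
    \<open>\<Phi> j * adj (\<Phi> j)\<close>.\<close>
  have pos\<tau>: "pos (\<tau> s)" if s: "s \<in> carrier_vec (n - m)" for s
  proof -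
    obtain j where "j \<in> carrier_vec n" "g *\<^sub>v j = s" using g_surj[OF s] by (auto simp: fibre_iff)
    then show ?thesis using pos_add[OF ge[of j] pos_mult_adj[of "\<Phi> j"]] by simp
  qed
  have "rtr (G s) = (\<Sum>x\<in>fibre n g s. rtr (\<Phi> x * adj (\<Phi> x) * M (g *\<^sub>v x) x))" for s
  proof -
    have "rtr (G s) = (1/2) * (\<Sum>x\<in>fibre n g s. rtr (\<Phi> x * adj (\<Phi> x) * M s x) + rtr (M s x * (\<Phi> x * adj (\<Phi> x))))"
      by (simp add: G_def rtr_scaleR rtr_sum rtr_add)
    also have "\<dots> = (1/2) * (\<Sum>x\<in>fibre n g s. 2 * rtr (\<Phi> x * adj (\<Phi> x) * M (g *\<^sub>v x) x))"
    proof (intro arg_cong[where f = "(*) _"] sum.cong refl)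
      fix x assume "x \<in> fibre n g s"
      then show "rtr (\<Phi> x * adj (\<Phi> x) * M s x) + rtr (M s x * (\<Phi> x * adj (\<Phi> x))) = 2 * rtr (\<Phi> x * adj (\<Phi> x) * M (g *\<^sub>v x) x)"
        using rtr_comm[of "M s x" "\<Phi> x * adj (\<Phi> x)"] by (simp add: fibre_iff)
    qed
    finally show ?thesis by (simp add: sum_distrib_left)
  qed
  then have "(\<Sum>s\<in>carrier_vec (n - m). rtr (\<tau> s)) = success M + r * dB * 2 ^ (n - m)"
    by (simp add: \<tau>_def rtr_add rtr_scaleR sum.distrib success_def sum_fibres[OF carriers(2)])
  also have "\<dots> \<le> \<beta> + r * c"
    using upper[OF M(1)] r(1) by (simp add: c_def algebra_simps)
  also have "\<dots> \<le> \<beta> + \<epsilon>" using r(3) by simp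
  finally show ?thesis using pos\<tau> fid\<tau> ge by (intro exI[of _ \<tau>]) auto
qed

end

section \<open>Basis kets as isometries\<close>

lemma less_mult_add_bound: "a < p \<Longrightarrow> b < q \<Longrightarrow> a * q + b < p * (q :: nat)"
proof -
  assume "a < p" "b < q"
  then have "a * q + b < Suc a * q" by simp
  also have "\<dots> \<le> p * q" using \<open>a < p\<close> by (intro mult_le_mono1) simp
  finally show ?thesis .
qed

lemma div_mod_less: "i < p * q \<Longrightarrow> i div q < p \<and> i mod q < (q :: nat)"
  by (cases "q = 0") (simp_all add: less_mult_imp_div_less)

lemma mult_add_eq_iff:
  "j < d \<Longrightarrow> j' < d \<Longrightarrow> a * d + j = a' * d + j' \<longleftrightarrow> a = a' \<and> j = (j' :: nat)"
proof
  assume "j < d" "j' < d" "a * d + j = a' * d + j'"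
  then have "(a * d + j) div d = (a' * d + j') div d" "(a * d + j) mod d = (a' * d + j') mod d" by simp_all
  with \<open>j < d\<close> \<open>j' < d\<close> show "a = a' \<and> j = j'" by simp
qed simp

lemma sum_div_mod:
  fixes h :: "nat \<Rightarrow> nat \<Rightarrow> 'a :: comm_monoid_add"
  shows "(\<Sum>k<p * q. h (k div q) (k mod q)) = (\<Sum>a<p. \<Sum>b<q. h a b)"
proof -
  have "(\<Sum>k<p * q. h (k div q) (k mod q)) = (\<Sum>(a, b)\<in>{..<p} \<times> {..<q}. h a b)"
    by (rule sum.reindex_bij_witness[of _ "\<lambda>(a, b). a * q + b" "\<lambda>k. (k div q, k mod q)"])
      (auto simp: div_mod_less less_mult_add_bound)
  then show ?thesis by (simp add: sum.cartesian_product)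
qed

section \<open>Kronecker products\<close>

lemma dim_kron [simp]:
  "dim_row (kron P Q) = dim_row P * dim_row Q" "dim_col (kron P Q) = dim_col P * dim_col Q"
  by (simp_all add: kron_def)

lemma kron_index:
  "i < dim_row P * dim_row Q \<Longrightarrow> j < dim_col P * dim_col Q \<Longrightarrow>
    kron P Q $$ (i, j) = P $$ (i div dim_row Q, j div dim_col Q) * Q $$ (i mod dim_row Q, j mod dim_col Q)"
  by (simp add: kron_def)

lemma kron_mult_kron:
  assumes "dim_col P = dim_row P'" "dim_col Q = dim_row Q'"
  shows "kron P Q * kron P' Q' = kron (P * P') (Q * Q')"
proof (rule eq_matI)
  fix i j assume ij: "i < dim_row (kron (P * P') (Q * Q'))" "j < dim_col (kron (P * P') (Q * Q'))"
  then have i: "i div dim_row Q < dim_row P" "i mod dim_row Q < dim_row Q"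
    and j: "j div dim_col Q' < dim_col P'" "j mod dim_col Q' < dim_col Q'"
    using div_mod_less by auto
  have "(kron P Q * kron P' Q') $$ (i, j)
    = (\<Sum>k<dim_row P' * dim_row Q'. (P $$ (i div dim_row Q, k div dim_row Q') * Q $$ (i mod dim_row Q, k mod dim_row Q'))
        * (P' $$ (k div dim_row Q', j div dim_col Q') * Q' $$ (k mod dim_row Q', j mod dim_col Q')))"
    using ij assms by (simp add: scalar_prod_def atLeast0LessThan kron_index)
  also have "\<dots> = (\<Sum>a<dim_row P'. \<Sum>b<dim_row Q'. (P $$ (i div dim_row Q, a) * Q $$ (i mod dim_row Q, b))
        * (P' $$ (a, j div dim_col Q') * Q' $$ (b, j mod dim_col Q')))"
    by (rule sum_div_mod)
  also have "\<dots> = (\<Sum>a<dim_row P'. P $$ (i div dim_row Q, a) * P' $$ (a, j div dim_col Q'))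
      * (\<Sum>b<dim_row Q'. Q $$ (i mod dim_row Q, b) * Q' $$ (b, j mod dim_col Q'))"
    by (simp add: sum_product mult_ac)
  also have "\<dots> = kron (P * P') (Q * Q') $$ (i, j)"
    using ij i j assms by (simp add: kron_index scalar_prod_def atLeast0LessThan)
  finally show "(kron P Q * kron P' Q') $$ (i, j) = kron (P * P') (Q * Q') $$ (i, j)" .
qed simp_all

lemma mat_adjoint_kron: "mat_adjoint (kron P Q) = kron (mat_adjoint P) (mat_adjoint Q)"
proof (rule eq_matI)
  fix i j assume "i < dim_row (kron (mat_adjoint P) (mat_adjoint Q))" "j < dim_col (kron (mat_adjoint P) (mat_adjoint Q))"
  then show "mat_adjoint (kron P Q) $$ (i, j) = kron (mat_adjoint P) (mat_adjoint Q) $$ (i, j)"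
    using div_mod_less[of i "dim_col P" "dim_col Q"] div_mod_less[of j "dim_row P" "dim_row Q"]
    by (simp add: kron_index mat_adjoint_eq)
qed simp_all

lemma kron_one_left [simp]: "kron (1\<^sub>m (Suc 0)) Q = Q"
  by (rule eq_matI) (simp_all add: kron_index)

lemma kron_one_right [simp]: "kron P (1\<^sub>m (Suc 0)) = P"
  by (rule eq_matI) (simp_all add: kron_index)

lemma mat_adjoint_one [simp]: "mat_adjoint (1\<^sub>m d :: complex mat) = 1\<^sub>m d"
  by (rule eq_matI) (auto simp: mat_adjoint_eq)

lemma op_of_kron_mult:
  assumes "dim_col P = dim_row P'" "dim_col Q = dim_row Q'"
  shows "op_of (kron P Q) * op_of (kron P' Q') = op_of (kron (P * P') (Q * Q'))"
  using assms by (simp add: kron_mult_kron flip: op_of_mult)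

lemma op_of_kron_ket_proj_left:
  assumes "dim_col a = 1" "R \<in> carrier_mat d d"
  shows "op_of (kron (ket_proj a) R) = op_of (kron a (1\<^sub>m d)) * op_of R * adj (op_of (kron a (1\<^sub>m d)))"
proof -
  have "kron (ket_proj a) R = kron a (1\<^sub>m d) * kron (1\<^sub>m 1) R * kron (mat_adjoint a) (1\<^sub>m d)"
    using assms by (auto simp: kron_mult_kron ket_proj_def simp del: kron_one_left)
  then have "kron (ket_proj a) R = kron a (1\<^sub>m d) * R * mat_adjoint (kron a (1\<^sub>m d))"
    using assms by (auto simp: mat_adjoint_kron)
  then show ?thesis using assms by (simp add: op_of_mult)
qed

lemma op_of_kron_ket_proj_right:
  assumes "dim_col a = 1" "R \<in> carrier_mat d d"
  shows "op_of (kron R (ket_proj a)) = op_of (kron (1\<^sub>m d) a) * op_of R * adj (op_of (kron (1\<^sub>m d) a))"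
proof -
  have "kron R (ket_proj a) = kron (1\<^sub>m d) a * kron R (1\<^sub>m 1) * kron (1\<^sub>m d) (mat_adjoint a)"
    using assms by (auto simp: kron_mult_kron ket_proj_def simp del: kron_one_right)
  then have "kron R (ket_proj a) = kron (1\<^sub>m d) a * R * mat_adjoint (kron (1\<^sub>m d) a)"
    using assms by (auto simp: mat_adjoint_kron)
  then show ?thesis using assms by (simp add: op_of_mult)
qed

lemma op_of_kron_one_left_mult:
  assumes "dim_row a = p" "dim_col a = 1" "R \<in> carrier_mat d d"
  shows "op_of (kron (1\<^sub>m p) R) * op_of (kron a (1\<^sub>m d)) = op_of (kron a (1\<^sub>m d)) * op_of R"
proof -
  have "op_of (kron (1\<^sub>m p) R) * op_of (kron a (1\<^sub>m d)) = op_of (kron a R)"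
    using assms by (subst op_of_kron_mult) auto
  also have "\<dots> = op_of (kron a (1\<^sub>m d)) * op_of (kron (1\<^sub>m 1) R)"
    using assms by (subst op_of_kron_mult) auto
  finally show ?thesis by simp
qed

text \<open>Position of the basis vector in the Kronecker ordering: the first bit is the most
  significant one because it labels the leftmost tensor factor.\<close>

definition bit_index :: "bit vec \<Rightarrow> nat" where
  "bit_index z = (\<Sum>i<dim_vec z. if z $ i = 0 then 0 else 2 ^ (dim_vec z - Suc i))"

lemma bit_index_vNil [simp]: "bit_index vNil = 0"
  by (simp add: bit_index_def)

lemma bit_index_vCons [simp]:
  "bit_index (vCons c z) = (if c = 0 then 0 else 2 ^ dim_vec z) + bit_index z"
  unfolding bit_index_def dim_vec_vCons by (simp add: sum.lessThan_Suc_shift del: sum.lessThan_Suc cong: if_cong)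

lemma bit_index_less: "bit_index z < 2 ^ dim_vec z"
  by (induction z) auto

lemma bit_index_inj: "dim_vec z = dim_vec w \<Longrightarrow> bit_index z = bit_index w \<Longrightarrow> z = w"
proof (induction z arbitrary: w)
  case vNil
  then show ?case by (cases w) auto
next
  case (vCons c z)
  then obtain c' w' where w: "w = vCons c' w'" "dim_vec z = dim_vec w'" by (cases w) auto
  have "c = c'"
    using vCons.prems w bit_index_less[of z] bit_index_less[of w'] by (cases c; cases c') auto
  with vCons w show ?case by (cases c') auto
qed

lemma bit_index_carrier: "z \<in> carrier_vec n \<Longrightarrow> bit_index z < 2 ^ n"
  using bit_index_less[of z] by auto

lemma bit_index_eq_iff:
  "z \<in> carrier_vec n \<Longrightarrow> w \<in> carrier_vec n \<Longrightarrow> bit_index z = bit_index w \<longleftrightarrow> z = w"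
  using bit_index_inj by auto

lemma bit_index_surj: "i < 2 ^ n \<Longrightarrow> \<exists>z\<in>carrier_vec n. bit_index z = i"
proof -
  assume i: "i < 2 ^ n"
  have "bit_index ` carrier_vec n = {..<2 ^ n}"
  proof (rule card_subset_eq)
    show "card (bit_index ` carrier_vec n) = card {..<2 ^ n :: nat}"
      by (subst card_image) (auto simp: inj_on_def bit_index_eq_iff)
  qed (auto simp: bit_index_carrier)
  with i show ?thesis by (metis imageE lessThan_iff)
qed

lemma ket_vCons:
  "ket_z (vCons c z) = kron (qubit_z c) (ket_z z)" "ket_x (vCons c z) = kron (qubit_x c) (ket_x z)"
  by (simp_all add: ket_z_def ket_x_def)

lemma ket_vNil: "ket_z vNil = 1\<^sub>m 1" "ket_x vNil = 1\<^sub>m 1"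
  by (simp_all add: ket_z_def ket_x_def)

lemma dim_qubit [simp]:
  "dim_row (qubit_z c) = 2" "dim_col (qubit_z c) = 1" "dim_row (qubit_x c) = 2" "dim_col (qubit_x c) = 1"
  by (simp_all add: qubit_z_def qubit_x_def)

lemma dim_ket [simp]:
  "dim_row (ket_z z) = 2 ^ dim_vec z" "dim_col (ket_z z) = 1"
  "dim_row (ket_x z) = 2 ^ dim_vec z" "dim_col (ket_x z) = 1"
  by (induction z) (simp_all add: ket_vCons ket_vNil)

lemma qubit_index:
  "i < 2 \<Longrightarrow> qubit_z c $$ (i, 0) = (if i = (if c = 0 then 0 else 1) then 1 else 0)"
  "i < 2 \<Longrightarrow> qubit_x c $$ (i, 0) = (if i = 1 \<and> c = 1 then - 1 else 1) / sqrt 2"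
  by (auto simp: qubit_z_def qubit_x_def mat_of_cols_index less_2_cases_iff)

lemma ket_z_index:
  "i < 2 ^ dim_vec z \<Longrightarrow> ket_z z $$ (i, 0) = (if i = bit_index z then 1 else 0)"
proof (induction z arbitrary: i)
  case vNil
  then show ?case by (simp add: ket_vNil)
next
  case (vCons c z)
  let ?N = "2 ^ dim_vec z :: nat"
  have i: "i div ?N < 2" "i mod ?N < ?N" using div_mod_less[of i 2 ?N] vCons.prems by auto
  have "i = (if c = 0 then 0 else ?N) + bit_index z \<longleftrightarrow>
      i div ?N = (if c = 0 then 0 else 1) \<and> i mod ?N = bit_index z" (is "?l \<longleftrightarrow> ?r")
  proof
    assume ?l
    then show ?r using bit_index_less[of z] by simp
  next
    assume ?r
    then show ?l using div_mult_mod_eq[of i ?N] by (auto split: if_splits)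
  qed
  then show ?case
    using vCons.prems i vCons.IH[OF i(2)] by (auto simp: ket_vCons kron_index qubit_index)
qed

lemma ket_x_index:
  "dim_vec x = dim_vec z \<Longrightarrow> ket_x x $$ (bit_index z, 0) = complex_of_real (chr x z / sqrt (2 ^ dim_vec x))"
proof (induction x arbitrary: z)
  case vNil
  then show ?case by (cases z) (auto simp: ket_vNil chr_def)
next
  case (vCons c x)
  then obtain c' z' where z: "z = vCons c' z'" "dim_vec x = dim_vec z'" by (cases z) auto
  let ?N = "2 ^ dim_vec x :: nat"
  let ?i = "bit_index z"
  have i: "?i div ?N = (if c' = 0 then 0 else 1)" "?i mod ?N = bit_index z'" "?i < 2 * ?N"
    using bit_index_less[of z'] by (auto simp: z)
  have chr: "chr (vCons c x) (vCons c' z') = (if c = 1 \<and> c' = 1 then - 1 else 1) * chr x z'"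
    unfolding chr_def scalar_prod_vCons by (cases c; cases c'; cases "x \<bullet> z'") simp_all
  have "ket_x (vCons c x) $$ (?i, 0) = qubit_x c $$ (?i div ?N, 0) * ket_x x $$ (?i mod ?N, 0)"
    using i(3) by (simp add: ket_vCons kron_index)
  also have "\<dots> = (if c' = 1 \<and> c = 1 then - 1 else 1) / sqrt 2 * complex_of_real (chr x z' / sqrt (2 ^ dim_vec x))"
    unfolding i(1,2) using vCons.IH[OF z(2)] by (auto simp: qubit_index)
  also have "\<dots> = complex_of_real (chr (vCons c x) z / sqrt (2 ^ dim_vec (vCons c x)))"
    by (simp add: z chr real_sqrt_mult)
  finally show ?case .
qed

text \<open>Column \<open>j\<close> is the basis vector numbered \<open>\<phi> j\<close>.
  Multiplication by such operators only relabels entries, and orthogonality relations reduce to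
  comparing index maps.\<close>

definition selects :: "fmat \<Rightarrow> nat \<Rightarrow> (nat \<Rightarrow> nat) \<Rightarrow> bool" where
  "selects V d \<phi> \<longleftrightarrow> (\<forall>i j. entry V i j = (if j < d \<and> i = \<phi> j then 1 else 0))"

lemma selects_adj_mult:
  assumes "selects V d \<phi>"
  shows "entry (adj V * B) j k = (if j < d then entry B (\<phi> j) k else 0)"
proof -
  obtain N where N: "bounded_by N (adj V)" using ex_bounded_by by blast
  have "entry (adj V) j (\<phi> j) = 1" if "j < d" using assms that by (simp add: adj.rep_eq selects_def)
  then have *: "\<phi> j < N" if "j < d" using N that unfolding bounded_by_def by (metis zero_neq_one)
  have "entry (adj V * B) j k = (\<Sum>i<N. if i = \<phi> j then (if j < d then entry B (\<phi> j) k else 0) else 0)"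
    unfolding entry_times[OF N] using assms by (intro sum.cong) (auto simp: adj.rep_eq selects_def)
  with * show ?thesis by auto
qed

lemma selects_mult:
  assumes "selects V d \<phi>"
  shows "entry (A * V) i j = (if j < d then entry A i (\<phi> j) else 0)"
proof -
  have "entry (A * V) i j = cnj (entry (adj V * adj A) j i)"
    by (simp add: adj.rep_eq flip: adj_simps(6))
  then show ?thesis using selects_adj_mult[OF assms] by (simp add: adj.rep_eq)
qed

lemma selects_cnj: "selects V d \<phi> \<Longrightarrow> cnj_fmat V = V"
  by (rule fmat_eqI) (simp add: selects_def cnj_fmat.rep_eq)

lemma selects_adj_mult_selects:
  assumes "selects V d \<phi>" "selects V' d \<phi>'"
    and "\<And>j j'. j < d \<Longrightarrow> j' < d \<Longrightarrow> \<phi> j = \<phi>' j' \<longleftrightarrow> P \<and> j = j'"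
  shows "adj V * V' = (if P then fid d else 0)"
proof (rule fmat_eqI)
  fix j k
  show "entry (adj V * V') j k = entry (if P then fid d else 0) j k"
    using assms(2,3) unfolding selects_adj_mult[OF assms(1)]
    by (auto simp: selects_def fid.rep_eq zero_fmat.rep_eq)
qed

lemma selects_cong: "selects V d \<phi> \<Longrightarrow> (\<And>j. j < d \<Longrightarrow> \<phi> j = \<phi>' j) \<Longrightarrow> selects V d \<phi>'"
  by (auto simp: selects_def)

lemma selects_kron:
  assumes P: "selects (op_of P) (dim_col P) \<phi>" and Q: "selects (op_of Q) (dim_col Q) \<phi>'"
    and less: "\<And>j. j < dim_col P \<Longrightarrow> \<phi> j < dim_row P" "\<And>j. j < dim_col Q \<Longrightarrow> \<phi>' j < dim_row Q"
  shows "selects (op_of (kron P Q)) (dim_col P * dim_col Q)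
    (\<lambda>j. \<phi> (j div dim_col Q) * dim_row Q + \<phi>' (j mod dim_col Q))"
  unfolding selects_def
proof (intro allI)
  fix i j
  let ?r = "\<phi> (j div dim_col Q)" and ?s = "\<phi>' (j mod dim_col Q)"
  show "entry (op_of (kron P Q)) i j = (if j < dim_col P * dim_col Q \<and> i = ?r * dim_row Q + ?s then 1 else 0)"
  proof (cases "j < dim_col P * dim_col Q")
    case True
    then have j: "j div dim_col Q < dim_col P" "j mod dim_col Q < dim_col Q" using div_mod_less by auto
    note rs = less(1)[OF j(1)] less(2)[OF j(2)]
    show ?thesis
    proof (cases "i < dim_row P * dim_row Q")
      case True
      then have i: "i div dim_row Q < dim_row P" "i mod dim_row Q < dim_row Q" using div_mod_less by auto
      have "i = ?r * dim_row Q + ?s \<longleftrightarrow> i div dim_row Q = ?r \<and> i mod dim_row Q = ?s"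
        using mult_add_eq_iff[OF i(2) rs(2), of "i div dim_row Q" ?r] unfolding div_mult_mod_eq .
      moreover have "P $$ (i div dim_row Q, j div dim_col Q) = (if i div dim_row Q = ?r then 1 else 0)"
        using P i(1) j(1) unfolding selects_def op_of.rep_eq by metis
      moreover have "Q $$ (i mod dim_row Q, j mod dim_col Q) = (if i mod dim_row Q = ?s then 1 else 0)"
        using Q i(2) j(2) unfolding selects_def op_of.rep_eq by metis
      ultimately show ?thesis
        using True \<open>j < dim_col P * dim_col Q\<close> by (simp add: op_of.rep_eq kron_index)
    next
      case False
      then show ?thesis using less_mult_add_bound[OF rs] by (auto simp: op_of.rep_eq)
    qed
  qed (simp add: op_of.rep_eq)
qed

lemma selects_one: "selects (op_of (1\<^sub>m d)) d (\<lambda>j. j)"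
  by (auto simp: selects_def fid.rep_eq)

lemma selects_ket: "selects (op_of (ket_z z)) (Suc 0) (\<lambda>_. bit_index z)"
  using bit_index_less[of z] by (auto simp: selects_def op_of.rep_eq ket_z_index)

lemma selects_ket_z: "selects (op_of (kron (ket_z z) (1\<^sub>m d))) d (\<lambda>j. bit_index z * d + j)"
  using selects_kron[of "ket_z z" "\<lambda>_. bit_index z" "1\<^sub>m d" "\<lambda>j. j"] selects_ket[of z] selects_one[of d]
    bit_index_less[of z]
  by (auto elim!: selects_cong)

lemma selects_kron_one_ket_z:
  "selects (op_of (kron (1\<^sub>m d) (ket_z z))) d (\<lambda>j. j * 2 ^ dim_vec z + bit_index z)"
  using selects_kron[of "1\<^sub>m d" "\<lambda>j. j" "ket_z z" "\<lambda>_. bit_index z"] selects_ket[of z] selects_one[of d]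
    bit_index_less[of z] by simp

definition Vz :: "nat \<Rightarrow> bit vec \<Rightarrow> fmat" where "Vz d z = op_of (kron (ket_z z) (1\<^sub>m d))"
definition Vx :: "nat \<Rightarrow> bit vec \<Rightarrow> fmat" where "Vx d x = op_of (kron (ket_x x) (1\<^sub>m d))"
definition Wz :: "nat \<Rightarrow> bit vec \<Rightarrow> fmat" where "Wz d z = op_of (kron (1\<^sub>m d) (ket_z z))"

lemma Vz_orth:
  assumes "z \<in> carrier_vec n" "z' \<in> carrier_vec n"
  shows "adj (Vz d z) * Vz d z' = (if z = z' then fid d else 0)"
  unfolding Vz_def
  by (rule selects_adj_mult_selects[OF selects_ket_z selects_ket_z])
    (simp add: mult_add_eq_iff bit_index_eq_iff[OF assms])

lemma fid_mult_Vz: "z \<in> carrier_vec n \<Longrightarrow> fid (2 ^ n * d) * Vz d z = Vz d z"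
  unfolding Vz_def by (intro fid_mult_op_of) auto

lemma Vz_complete: "(\<Sum>z\<in>carrier_vec n. Vz d z * adj (Vz d z)) = fid (2 ^ n * d)"
  by (rule orthogonal_ranges_complete[OF Vz_orth]) (auto simp: fid_mult_Vz)

lemma Wz_orth:
  assumes "z \<in> carrier_vec n" "z' \<in> carrier_vec n"
  shows "adj (Wz d z) * Wz d z' = (if z = z' then fid d else 0)"
  unfolding Wz_def
proof (rule selects_adj_mult_selects[OF selects_kron_one_ket_z selects_kron_one_ket_z])
  fix j j'
  show "j * 2 ^ dim_vec z + bit_index z = j' * 2 ^ dim_vec z' + bit_index z' \<longleftrightarrow> z = z' \<and> j = j'"
    using mult_add_eq_iff[of "bit_index z" "2 ^ n" "bit_index z'" j j'] assms
    by (auto simp: bit_index_eq_iff[OF assms] bit_index_carrier)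
qed

lemma fid_mult_Wz: "z \<in> carrier_vec n \<Longrightarrow> fid (d * 2 ^ n) * Wz d z = Wz d z"
  unfolding Wz_def by (intro fid_mult_op_of) auto

lemma Wz_complete: "(\<Sum>z\<in>carrier_vec n. Wz d z * adj (Wz d z)) = fid (d * 2 ^ n)"
  by (rule orthogonal_ranges_complete[OF Wz_orth]) (auto simp: fid_mult_Wz mult.commute)

text \<open>The Hadamard transform between the two bases, lifted to the isometries. It is where the
  signs and the factor in the definition of \<open>\<Phi>\<close> come from.\<close>

lemma Vx_eq_sum:
  assumes x: "x \<in> carrier_vec n"
  shows "Vx d x = (1 / sqrt (2 ^ n)) *\<^sub>R (\<Sum>z\<in>carrier_vec n. chr x z *\<^sub>R Vz d z)"
proof (rule fmat_eqI)
  fix i j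
  have rhs: "entry ((1 / sqrt (2 ^ n)) *\<^sub>R (\<Sum>z\<in>carrier_vec n. chr x z *\<^sub>R Vz d z)) i j
    = (\<Sum>z\<in>carrier_vec n. if j < d \<and> i = bit_index z * d + j then complex_of_real (chr x z / sqrt (2 ^ n)) else 0)"
    using selects_ket_z unfolding selects_def
    by (auto simp: entry_simps entry_sum Vz_def scaleR_conv_of_real sum_distrib_left intro!: sum.cong)
  show "entry (Vx d x) i j = entry ((1 / sqrt (2 ^ n)) *\<^sub>R (\<Sum>z\<in>carrier_vec n. chr x z *\<^sub>R Vz d z)) i j"
  proof (cases "i < 2 ^ n * d \<and> j < d")
    case True
    then have i: "i div d < 2 ^ n" "i mod d < d" using div_mod_less[of i _ d] by auto
    obtain z0 :: "bit vec" where z0: "z0 \<in> carrier_vec n" "bit_index z0 = i div d" using bit_index_surj[OF i(1)] by blast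
    have eq: "i = bit_index z * d + j \<longleftrightarrow> z = z0 \<and> i mod d = j" if "z \<in> carrier_vec n" for z
      using True i mult_add_eq_iff[of "i mod d" d j "i div d" "bit_index z"] bit_index_eq_iff[OF that z0(1)]
      by (auto simp: z0(2))
    have "entry (Vx d x) i j = ket_x x $$ (bit_index z0, 0) * (if i mod d = j then 1 else 0)"
      using True i x by (simp add: Vx_def op_of.rep_eq kron_index z0(2))
    also have "\<dots> = (if i mod d = j then complex_of_real (chr x z0 / sqrt (2 ^ n)) else 0)"
      using x z0(1) ket_x_index[of x z0] by (simp add: z0(2))
    also have "\<dots> = (\<Sum>z\<in>carrier_vec n. if z = z0 then if i mod d = j then complex_of_real (chr x z0 / sqrt (2 ^ n)) else 0 else 0)"
      using z0(1) by simp
    also have "\<dots> = (\<Sum>z\<in>carrier_vec n. if j < d \<and> i = bit_index z * d + j then complex_of_real (chr x z / sqrt (2 ^ n)) else 0)"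
      using True by (intro sum.cong refl) (auto simp: eq)
    finally show ?thesis unfolding rhs .
  next
    case False
    then have "\<not> (j < d \<and> i = bit_index z * d + j)" if "z \<in> carrier_vec n" for z
      using less_mult_add_bound[OF bit_index_carrier[OF that], of j d] by auto
    then have "(\<Sum>z\<in>carrier_vec n. if j < d \<and> i = bit_index z * d + j then complex_of_real (chr x z / sqrt (2 ^ n)) else 0) = 0"
      by (intro sum.neutral) auto
    moreover have "entry (Vx d x) i j = 0" using False x by (auto simp: Vx_def op_of.rep_eq)
    ultimately show ?thesis unfolding rhs by simp
  qed
qed

lemma Vx_orth:
  assumes "x \<in> carrier_vec n" "x' \<in> carrier_vec n"
  shows "adj (Vx d x) * Vx d x' = (if x = x' then fid d else 0)"
proof -
  have "adj (Vx d x) * Vx d x' = (1 / 2 ^ n) *\<^sub>R (\<Sum>z\<in>carrier_vec n. \<Sum>z'\<in>carrier_vec n.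
      (chr x z * chr x' z') *\<^sub>R (adj (Vz d z) * Vz d z'))"
    unfolding Vx_eq_sum[OF assms(1)] Vx_eq_sum[OF assms(2)] by (simp add: sum_product mult.commute)
  also have "\<dots> = (1 / 2 ^ n) *\<^sub>R (\<Sum>z\<in>carrier_vec n. \<Sum>z'\<in>carrier_vec n.
      if z' = z then (chr x z * chr x' z) *\<^sub>R fid d else 0)"
    by (intro arg_cong[where f = "scaleR _"] sum.cong refl) (auto simp: Vz_orth[of _ n])
  also have "\<dots> = (1 / 2 ^ n) *\<^sub>R ((\<Sum>z\<in>carrier_vec n. chr (x + x') z) *\<^sub>R fid d)"
    using assms by (simp add: scaleR_sum_left chr_add_left)
  also have "\<dots> = (if x = x' then fid d else 0)"
    using assms by (simp add: sum_chr bits_add_eq_0[OF assms])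
  finally show ?thesis .
qed

lemma fid_mult_Vx: "x \<in> carrier_vec n \<Longrightarrow> fid (2 ^ n * d) * Vx d x = Vx d x"
  unfolding Vx_def by (intro fid_mult_op_of) auto

lemma Vx_complete: "(\<Sum>x\<in>carrier_vec n. Vx d x * adj (Vx d x)) = fid (2 ^ n * d)"
  by (rule orthogonal_ranges_complete[OF Vx_orth]) (auto simp: fid_mult_Vx)

lemma op_of_kron_one_sum:
  assumes complete: "(\<Sum>u\<in>S. op_of (kron (a u) (1\<^sub>m d)) * adj (op_of (kron (a u) (1\<^sub>m d)))) = fid (p * d)"
    and a: "\<And>u. u \<in> S \<Longrightarrow> dim_row (a u) = p \<and> dim_col (a u) = 1" and R: "R \<in> carrier_mat d d"
  shows "op_of (kron (1\<^sub>m p) R)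
    = (\<Sum>u\<in>S. op_of (kron (a u) (1\<^sub>m d)) * op_of R * adj (op_of (kron (a u) (1\<^sub>m d))))"
proof -
  have "op_of (kron (1\<^sub>m p) R) = op_of (kron (1\<^sub>m p) R) * fid (p * d)"
    using R by (intro op_of_mult_fid[symmetric]) auto
  also have "\<dots> = (\<Sum>u\<in>S. op_of (kron (1\<^sub>m p) R) * op_of (kron (a u) (1\<^sub>m d)) * adj (op_of (kron (a u) (1\<^sub>m d))))"
    unfolding complete[symmetric] by (simp add: sum_distrib_left mult.assoc)
  also have "\<dots> = (\<Sum>u\<in>S. op_of (kron (a u) (1\<^sub>m d)) * op_of R * adj (op_of (kron (a u) (1\<^sub>m d))))"
    by (intro sum.cong refl) (simp add: op_of_kron_one_left_mult[OF _ _ R] a)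
  finally show ?thesis .
qed

lemma op_of_kron_one_Vz:
  "R \<in> carrier_mat d d \<Longrightarrow> op_of (kron (1\<^sub>m (2 ^ n)) R) = (\<Sum>u\<in>carrier_vec n. Vz d u * op_of R * adj (Vz d u))"
  using op_of_kron_one_sum[of ket_z d "carrier_vec n"] Vz_complete[of d n] by (simp add: Vz_def)

lemma op_of_kron_one_Vx:
  "R \<in> carrier_mat d d \<Longrightarrow> op_of (kron (1\<^sub>m (2 ^ n)) R) = (\<Sum>u\<in>carrier_vec n. Vx d u * op_of R * adj (Vx d u))"
  using op_of_kron_one_sum[of ket_x d "carrier_vec n"] Vx_complete[of d n] by (simp add: Vx_def)

section \<open>Blocks and measured states\<close>

lemma block_carrier:
  "ket = ket_z \<or> ket = ket_x \<Longrightarrow> u \<in> carrier_vec n \<Longrightarrow> block ket d \<rho> u \<in> carrier_mat d d"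
  by (auto simp: block_def intro!: carrier_matI)

lemma op_of_block:
  assumes "\<rho> \<in> carrier_mat (2 ^ n * d) (2 ^ n * d)" "u \<in> carrier_vec n"
  shows "op_of (block ket_z d \<rho> u) = adj (Vz d u) * op_of \<rho> * Vz d u"
    and "op_of (block ket_x d \<rho> u) = adj (Vx d u) * op_of \<rho> * Vx d u"
  using assms by (simp_all add: block_def Vz_def Vx_def op_of_mult)

lemma op_of_measured:
  assumes "\<rho> \<in> carrier_mat (2 ^ n * d) (2 ^ n * d)"
  shows "op_of (measured ket_z n d \<rho>) = (\<Sum>u\<in>carrier_vec n. Vz d u * adj (Vz d u) * op_of \<rho> * (Vz d u * adj (Vz d u)))"
    and "op_of (measured ket_x n d \<rho>) = (\<Sum>u\<in>carrier_vec n. Vx d u * adj (Vx d u) * op_of \<rho> * (Vx d u * adj (Vx d u)))"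
proof -
  have z: "op_of (kron (ket_proj (ket_z u)) (1\<^sub>m d)) = Vz d u * adj (Vz d u)" for u
    using op_of_kron_ket_proj_left[of "ket_z u" "1\<^sub>m d" d] by (simp add: Vz_def op_of_mult_fid)
  have x: "op_of (kron (ket_proj (ket_x u)) (1\<^sub>m d)) = Vx d u * adj (Vx d u)" for u
    using op_of_kron_ket_proj_left[of "ket_x u" "1\<^sub>m d" d] by (simp add: Vx_def op_of_mult_fid)
  have dims: "dim_row (ket_proj a) = dim_row a" "dim_col (ket_proj a) = dim_row a" for a by (simp_all add: ket_proj_def)
  show "op_of (measured ket_z n d \<rho>) = (\<Sum>u\<in>carrier_vec n. Vz d u * adj (Vz d u) * op_of \<rho> * (Vz d u * adj (Vz d u)))"
    unfolding measured_def using assms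
    by (subst op_of_op_sum) (auto intro!: sum.cong carrier_matI simp: op_of_mult z dims)
  show "op_of (measured ket_x n d \<rho>) = (\<Sum>u\<in>carrier_vec n. Vx d u * adj (Vx d u) * op_of \<rho> * (Vx d u * adj (Vx d u)))"
    unfolding measured_def using assms
    by (subst op_of_op_sum) (auto intro!: sum.cong carrier_matI simp: op_of_mult x dims)
qed

lemma measured_carrier [simp]: "measured ket n d \<rho> \<in> carrier_mat (2 ^ n * d) (2 ^ n * d)"
  by (simp add: measured_def op_sum_def)

text \<open>Measuring keeps the diagonal blocks and kills the others. A classical state equals its
  measured version, so its off-diagonal blocks vanish.\<close>

lemma conj_pinching:
  fixes V :: "bit vec \<Rightarrow> fmat"
  assumes orth: "\<And>u u'. u \<in> S \<Longrightarrow> u' \<in> S \<Longrightarrow> adj (V u) * V u' = (if u = u' then fid d else 0)"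
    and "u \<in> S" "u' \<in> S" "finite S"
  shows "adj (V u) * (\<Sum>w\<in>S. V w * adj (V w) * R * (V w * adj (V w))) * V u'
    = (if u = u' then adj (V u) * R * V u else 0)"
proof -
  have "adj (V u) * (\<Sum>w\<in>S. V w * adj (V w) * R * (V w * adj (V w))) * V u'
    = (\<Sum>w\<in>S. (adj (V u) * V w) * (adj (V w) * R * V w) * (adj (V w) * V u'))"
    by (simp add: sum_distrib_left sum_distrib_right mult.assoc)
  also have "\<dots> = (\<Sum>w\<in>S. if w = u then (if u = u' then fid d * (adj (V u) * R * V u) * fid d else 0) else 0)"
    using assms(2,3) by (intro sum.cong refl) (auto simp: orth)
  also have "\<dots> = (if u = u' then adj (V u) * R * V u else 0)"
  proof -
    have "V u * fid d = V u" using orth[OF assms(2,2)] by (intro isometry_right) simp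
    moreover from arg_cong[OF this, of adj] have "fid d * adj (V u) = adj (V u)" by simp
    ultimately have "fid d * (adj (V u) * R * V u) * fid d = adj (V u) * R * V u" by (metis mult.assoc)
    then show ?thesis using assms(2,4) by auto
  qed
  finally show ?thesis .
qed

lemma measured_pinching:
  assumes "\<rho> \<in> carrier_mat (2 ^ n * d) (2 ^ n * d)" "u \<in> carrier_vec n" "u' \<in> carrier_vec n"
  shows "adj (Vz d u) * op_of (measured ket_z n d \<rho>) * Vz d u' = (if u = u' then adj (Vz d u) * op_of \<rho> * Vz d u else 0)"
    and "adj (Vx d u) * op_of (measured ket_x n d \<rho>) * Vx d u' = (if u = u' then adj (Vx d u) * op_of \<rho> * Vx d u else 0)"
  unfolding op_of_measured[OF assms(1)]
  by (rule conj_pinching[where S = "carrier_vec n", OF Vz_orth]; use assms in simp)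
    (rule conj_pinching[where S = "carrier_vec n", OF Vx_orth]; use assms in simp)

lemma block_measured:
  assumes "\<rho> \<in> carrier_mat (2 ^ n * d) (2 ^ n * d)" "u \<in> carrier_vec n"
  shows "block ket_z d (measured ket_z n d \<rho>) u = block ket_z d \<rho> u"
    and "block ket_x d (measured ket_x n d \<rho>) u = block ket_x d \<rho> u"
proof -
  note m = measured_carrier[of _ n d \<rho>]
  have "op_of (block ket_z d (measured ket_z n d \<rho>) u) = op_of (block ket_z d \<rho> u)"
    unfolding op_of_block(1)[OF m assms(2)] op_of_block(1)[OF assms]
    by (simp add: measured_pinching(1)[OF assms(1,2,2)])
  then show "block ket_z d (measured ket_z n d \<rho>) u = block ket_z d \<rho> u"
    by (rule op_of_inject) (simp_all add: block_def)
  have "op_of (block ket_x d (measured ket_x n d \<rho>) u) = op_of (block ket_x d \<rho> u)"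
    unfolding op_of_block(2)[OF m assms(2)] op_of_block(2)[OF assms]
    by (simp add: measured_pinching(2)[OF assms(1,2,2)])
  then show "block ket_x d (measured ket_x n d \<rho>) u = block ket_x d \<rho> u"
    by (rule op_of_inject) (simp_all add: block_def)
qed

lemma classical_block_orth:
  assumes "\<rho> \<in> carrier_mat (2 ^ n * d) (2 ^ n * d)" "u \<in> carrier_vec n" "u' \<in> carrier_vec n" "u \<noteq> u'"
  shows "classical_in ket_z n d \<rho> \<Longrightarrow> adj (Vz d u) * op_of \<rho> * Vz d u' = 0"
    and "classical_in ket_x n d \<rho> \<Longrightarrow> adj (Vx d u) * op_of \<rho> * Vx d u' = 0"
proof -
  assume "classical_in ket_z n d \<rho>"
  then have "op_of \<rho> = op_of (measured ket_z n d \<rho>)" by (simp add: classical_in_def)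
  then show "adj (Vz d u) * op_of \<rho> * Vz d u' = 0"
    using measured_pinching(1)[OF assms(1-3)] assms(4) by simp
next
  assume "classical_in ket_x n d \<rho>"
  then have "op_of \<rho> = op_of (measured ket_x n d \<rho>)" by (simp add: classical_in_def)
  then show "adj (Vx d u) * op_of \<rho> * Vx d u' = 0"
    using measured_pinching(2)[OF assms(1-3)] assms(4) by simp
qed

lemma rtr_measured_z:
  assumes "\<rho> \<in> carrier_mat (2 ^ n * d) (2 ^ n * d)"
  shows "rtr (op_of (measured ket_z n d \<rho>)) = rtr (op_of \<rho>)"
proof -
  have "rtr (op_of M) = (\<Sum>u\<in>carrier_vec n. rtr (adj (Vz d u) * op_of M * Vz d u))"
    if "M \<in> carrier_mat (2 ^ n * d) (2 ^ n * d)" for M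
    using that by (intro rtr_compression[OF Vz_complete, symmetric] op_of_mult_fid) auto
  then show ?thesis using assms by (simp add: measured_pinching(1)[OF assms])
qed

section \<open>The purification of a state in standard form\<close>

text \<open>A maximal independent set of columns is a singleton, and by maximality every column lies
  in its span.\<close>

lemma rank_one_columns:
  fixes A :: "complex mat"
  assumes A: "A \<in> carrier_mat N nc" and rank: "vec_space.rank N A = 1"
  shows "\<exists>v a. v \<in> carrier_vec N \<and> (\<forall>j<nc. col A j = a j \<cdot>\<^sub>v v)"
proof -
  interpret vec_space "TYPE(complex)" N .
  have cols: "set (cols A) \<subseteq> carrier_vec N" using cols_dim[of A] A by auto
  have "lin_indpt {}"
    by (metis (no_types) empty_subsetI fin_dim finite_basis_exists subset_li_is_li basis_def)
  then obtain S where S: "maximal S (\<lambda>T. T \<subseteq> set (cols A) \<and> lin_indpt T)" "finite S"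
    using maximal_exists_superset[of "set (cols A)" "\<lambda>T. T \<subseteq> set (cols A) \<and> lin_indpt T" "{}"]
    by blast
  have S_sub: "S \<subseteq> set (cols A)" "lin_indpt S" using S(1) unfolding maximal_def by auto
  have "card S = 1" using rank_card_indpt[OF A S(1)] rank by simp
  then obtain v where v: "S = {v}" by (rule card_1_singletonE)
  have vc: "v \<in> carrier_vec N" using S_sub(1) cols v by auto
  have "\<exists>a. c = a \<cdot>\<^sub>v v" if c: "c \<in> set (cols A)" for c
  proof -
    have "c \<in> span S"
    proof (rule ccontr)
      assume "c \<notin> span S"
      then have "lin_indpt (S \<union> {c})"
        using lin_dep_iff_in_span[of S c] S_sub cols c span_mem[of S c] by blast
      then have "S \<union> {c} \<subseteq> S"
        using S(1) S_sub(1) c unfolding maximal_def by blast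
      then show False using span_mem[of S c] S_sub(1) cols \<open>c \<notin> span S\<close> by blast
    qed
    then obtain a where a: "c = lincomb a S" using finite_span[OF S(2)] S_sub(1) cols by auto
    have "c = a v \<cdot>\<^sub>v v"
    proof (rule eq_vecI)
      fix i assume "i < dim_vec (a v \<cdot>\<^sub>v v)"
      then show "c $ i = (a v \<cdot>\<^sub>v v) $ i"
        using vc a lincomb_index[of i S a] v by auto
    qed (use c cols vc in auto)
    then show ?thesis by blast
  qed
  moreover have "col A j \<in> set (cols A)" if "j < nc" for j
    using that A by (auto simp: cols_def)
  ultimately have "\<forall>j. \<exists>a. j < nc \<longrightarrow> col A j = a \<cdot>\<^sub>v v" by blast
  then show ?thesis using vc by metis
qed

text \<open>Rank one factors the entries as \<open>v $ i * a j\<close>. Hermiticity makes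
  \<open>a\<close> a multiple of the conjugate of \<open>v\<close>, positivity makes the multiple
  \<open>\<kappa>\<close> nonnegative, and its square root is moved into the vector.\<close>

lemma psd_rank_one:
  assumes psd: "psd N \<rho>" and rank: "vec_space.rank N \<rho> = 1"
  shows "\<exists>\<psi>. \<forall>i<N. \<forall>j<N. \<rho> $$ (i, j) = \<psi> i * cnj (\<psi> j)"
proof -
  have c: "\<rho> \<in> carrier_mat N N" using psd by (simp add: psd_def)
  obtain v a where v: "v \<in> carrier_vec N" "\<And>j. j < N \<Longrightarrow> col \<rho> j = a j \<cdot>\<^sub>v v"
    using rank_one_columns[OF c rank] by blast
  have ent: "\<rho> $$ (i, j) = v $ i * a j" if "i < N" "j < N" for i j
    using arg_cong[OF v(2)[OF that(2)], of "\<lambda>w. w $ i"] that c v(1) by (simp add: mult.commute)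
  show ?thesis
  proof (cases "\<exists>k<N. v $ k \<noteq> 0")
    case False
    with ent show ?thesis by (intro exI[of _ "\<lambda>_. 0"]) auto
  next
    case True
    then obtain k where k: "k < N" "v $ k \<noteq> 0" by blast
    define \<kappa> where "\<kappa> = cnj (a k) / v $ k"
    have a: "a j = \<kappa> * cnj (v $ j)" if "j < N" for j
    proof -
      have "v $ k * a j = cnj (v $ j * a k)"
        using psd_hermitian[OF psd that k(1)] ent k(1) that by metis
      with k(2) show ?thesis by (simp add: \<kappa>_def field_simps)
    qed
    have "0 \<le> \<rho> $$ (k, k)"
      using psd quad_form_one[OF c k(1)] by (metis psd_iff_quad_form)
    also have "\<rho> $$ (k, k) = \<kappa> * complex_of_real ((cmod (v $ k))\<^sup>2)"
      unfolding ent[OF k(1,1)] a[OF k(1)] complex_norm_square by simp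
    finally have "0 \<le> Re \<kappa> * (cmod (v $ k))\<^sup>2" "Im \<kappa> * (cmod (v $ k))\<^sup>2 = 0"
      by (simp_all add: less_eq_complex_def)
    with k(2) have "0 \<le> Re \<kappa>" "Im \<kappa> = 0" by (simp_all add: zero_le_mult_iff)
    then have "\<kappa> = complex_of_real (sqrt (Re \<kappa>)) * complex_of_real (sqrt (Re \<kappa>))"
      by (simp add: complex_eq_iff)
    then have "\<forall>i<N. \<forall>j<N. \<rho> $$ (i, j)
        = (complex_of_real (sqrt (Re \<kappa>)) * v $ i) * cnj (complex_of_real (sqrt (Re \<kappa>)) * v $ j)"
      using ent a by simp
    then show ?thesis by (rule exI[of _ "\<lambda>i. complex_of_real (sqrt (Re \<kappa>)) * v $ i"])
  qed
qed

lemma selects_basis_ket: "b < d \<Longrightarrow> selects (op_of (basis_ket d b)) (Suc 0) (\<lambda>_. b)"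
  by (auto simp: selects_def op_of.rep_eq basis_ket_def mat_of_cols_index unit_vec_def)

lemma dim_basis_ket [simp]: "dim_row (basis_ket d b) = d" "dim_col (basis_ket d b) = Suc 0"
  by (simp_all add: basis_ket_def)

locale pure_state =
  fixes n dB dE :: nat and \<rho> :: "complex mat" and \<psi> :: "nat \<Rightarrow> complex"
  assumes \<rho>: "\<rho> \<in> carrier_mat (2 ^ n * dB * dE) (2 ^ n * dB * dE)"
    and entry_\<rho>: "i < 2 ^ n * dB * dE \<Longrightarrow> j < 2 ^ n * dB * dE \<Longrightarrow> \<rho> $$ (i, j) = \<psi> i * cnj (\<psi> j)"
    and trace_\<rho>: "Re (op_trace \<rho>) \<le> 1"
begin

abbreviation "\<rho>AE \<equiv> ptrace_B (2 ^ n) dB dE \<rho>"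
abbreviation "\<rho>AB \<equiv> ptrace_E (2 ^ n) dB dE \<rho>"

lemma ptrace_carrier [simp]:
  "\<rho>AE \<in> carrier_mat (2 ^ n * dE) (2 ^ n * dE)" "\<rho>AB \<in> carrier_mat (2 ^ n * dB) (2 ^ n * dB)"
  by (simp_all add: ptrace_B_def ptrace_E_def op_sum_def)

text \<open>The argument of \<open>\<psi>\<close> is the position of the triple \<open>z\<close>,
  \<open>b\<close>, \<open>e\<close> in the Kronecker ordering of the three factors.\<close>

definition \<psi>m :: "bit vec \<Rightarrow> fmat" where
  "\<psi>m z = op_of (mat dB dE (\<lambda>(b, e). \<psi> ((bit_index z * dB + b) * dE + e)))"

definition VB :: "nat \<Rightarrow> fmat" where
  "VB b = op_of (kron (kron (1\<^sub>m (2 ^ n)) (basis_ket dB b)) (1\<^sub>m dE))"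

definition VE :: "nat \<Rightarrow> fmat" where
  "VE e = op_of (kron (kron (1\<^sub>m (2 ^ n)) (1\<^sub>m dB)) (basis_ket dE e))"

lemma selects_VB: "b < dB \<Longrightarrow> selects (VB b) (2 ^ n * dE) (\<lambda>j. (j div dE * dB + b) * dE + j mod dE)"
proof -
  assume b: "b < dB"
  have "selects (op_of (kron (1\<^sub>m (2 ^ n)) (basis_ket dB b))) (2 ^ n) (\<lambda>j. j * dB + b)"
    using selects_kron[of "1\<^sub>m (2 ^ n)" "\<lambda>j. j" "basis_ket dB b" "\<lambda>_. b"] selects_one[of "2 ^ n"] selects_basis_ket[OF b] b
    by simp
  then show ?thesis
    unfolding VB_def
    using selects_kron[of "kron (1\<^sub>m (2 ^ n)) (basis_ket dB b)" "\<lambda>j. j * dB + b" "1\<^sub>m dE" "\<lambda>j. j"] selects_one[of dE] b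
    by (simp add: less_mult_add_bound)
qed

lemma selects_VE: "e < dE \<Longrightarrow> selects (VE e) (2 ^ n * dB) (\<lambda>j. j * dE + e)"
proof -
  assume e: "e < dE"
  have "selects (op_of (kron (1\<^sub>m (2 ^ n)) (1\<^sub>m dB))) (2 ^ n * dB) (\<lambda>j. j)"
    using selects_kron[of "1\<^sub>m (2 ^ n)" "\<lambda>j. j" "1\<^sub>m dB" "\<lambda>j. j"] selects_one[of "2 ^ n"] selects_one[of dB]
    by simp
  then show ?thesis
    unfolding VE_def
    using selects_kron[of "kron (1\<^sub>m (2 ^ n)) (1\<^sub>m dB)" "\<lambda>j. j" "basis_ket dE e" "\<lambda>_. e"] selects_basis_ket[OF e] e
    by simp
qed

lemma op_of_\<rho>AE: "op_of \<rho>AE = (\<Sum>b<dB. adj (VB b) * op_of \<rho> * VB b)"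
  unfolding ptrace_B_def Let_def using \<rho>
  by (subst op_of_op_sum) (auto intro!: sum.cong carrier_matI simp: op_of_mult VB_def)

lemma op_of_\<rho>AB: "op_of \<rho>AB = (\<Sum>e<dE. adj (VE e) * op_of \<rho> * VE e)"
  unfolding ptrace_E_def Let_def using \<rho>
  by (subst op_of_op_sum) (auto intro!: sum.cong carrier_matI simp: op_of_mult VE_def)

lemma VB_complete: "(\<Sum>b<dB. VB b * adj (VB b)) = fid (2 ^ n * dB * dE)"
proof (rule orthogonal_ranges_complete)
  fix b b' assume b: "b \<in> {..<dB}" "b' \<in> {..<dB}"
  show "adj (VB b) * VB b' = (if b = b' then fid (2 ^ n * dE) else 0)"
  proof (rule selects_adj_mult_selects[OF selects_VB selects_VB])
    fix j j' assume j: "j < 2 ^ n * dE" "j' < 2 ^ n * dE"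
    show "(j div dE * dB + b) * dE + j mod dE = (j' div dE * dB + b') * dE + j' mod dE \<longleftrightarrow> b = b' \<and> j = j'"
      using b div_mod_less[OF j(1)] div_mod_less[OF j(2)] by (simp add: mult_add_eq_iff) (metis div_mult_mod_eq)
  qed (use b in auto)
qed (auto simp: VB_def mult_ac intro: fid_mult_op_of)

lemma VE_complete: "(\<Sum>e<dE. VE e * adj (VE e)) = fid (2 ^ n * dB * dE)"
proof (rule orthogonal_ranges_complete)
  fix e e' assume e: "e \<in> {..<dE}" "e' \<in> {..<dE}"
  show "adj (VE e) * VE e' = (if e = e' then fid (2 ^ n * dB) else 0)"
  proof (rule selects_adj_mult_selects[OF selects_VE selects_VE])
    fix j j'
    show "j * dE + e = j' * dE + e' \<longleftrightarrow> e = e' \<and> j = j'"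
      using e by (auto simp: mult_add_eq_iff)
  qed (use e in auto)
qed (auto simp: VE_def mult_ac intro: fid_mult_op_of)

lemma rtr_\<rho>AE: "rtr (op_of \<rho>AE) = rtr (op_of \<rho>)"
  unfolding op_of_\<rho>AE rtr_sum using \<rho> by (intro rtr_compression[OF VB_complete] op_of_mult_fid) auto

lemma rtr_\<rho>AB: "rtr (op_of \<rho>AB) = rtr (op_of \<rho>)"
  unfolding op_of_\<rho>AB rtr_sum using \<rho> by (intro rtr_compression[OF VE_complete] op_of_mult_fid) auto

lemma entry_op_of_\<rho>:
  "i < 2 ^ n * dB * dE \<Longrightarrow> j < 2 ^ n * dB * dE \<Longrightarrow> entry (op_of \<rho>) i j = \<psi> i * cnj (\<psi> j)"
  using \<rho> entry_\<rho> by (auto simp: op_of.rep_eq)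

lemma index_bound:
  "z \<in> carrier_vec n \<Longrightarrow> b < dB \<Longrightarrow> e < dE \<Longrightarrow> (bit_index z * dB + b) * dE + e < 2 ^ n * dB * dE"
  by (intro less_mult_add_bound bit_index_carrier)

text \<open>Tracing out \<open>B\<close> leaves the row index unconjugated, whereas a Gram matrix
  conjugates it. This mismatch is the origin of \<open>cnj_fmat\<close> in what follows; on the side
  of \<open>B\<close> it does not arise.\<close>

lemma \<rho>AE_block:
  assumes z: "z \<in> carrier_vec n" "z' \<in> carrier_vec n"
  shows "adj (Vz dE z) * op_of \<rho>AE * Vz dE z' = cnj_fmat (adj (\<psi>m z) * \<psi>m z')"
proof (rule fmat_eqI)
  fix e e'
  note sel = selects_ket_z[of _ dE, folded Vz_def]
  have "entry (adj (Vz dE z) * op_of \<rho>AE * Vz dE z') e e'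
    = (if e < dE \<and> e' < dE then \<Sum>b<dB. entry (adj (VB b) * op_of \<rho> * VB b) (bit_index z * dE + e) (bit_index z' * dE + e') else 0)"
    by (auto simp: selects_mult[OF sel] selects_adj_mult[OF sel] mult.assoc op_of_\<rho>AE entry_sum)
  also have "\<dots> = (if e < dE \<and> e' < dE then \<Sum>b<dB. \<psi> ((bit_index z * dB + b) * dE + e) * cnj (\<psi> ((bit_index z' * dB + b) * dE + e')) else 0)"
  proof (intro if_cong sum.cong refl)
    fix b assume "e < dE \<and> e' < dE" "b \<in> {..<dB}"
    then show "entry (adj (VB b) * op_of \<rho> * VB b) (bit_index z * dE + e) (bit_index z' * dE + e')
      = \<psi> ((bit_index z * dB + b) * dE + e) * cnj (\<psi> ((bit_index z' * dB + b) * dE + e'))"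
      using less_mult_add_bound[OF bit_index_carrier[OF z(1)], of e dE] less_mult_add_bound[OF bit_index_carrier[OF z(2)], of e' dE]
        index_bound[OF z(1)] index_bound[OF z(2)]
      by (simp add: selects_mult[OF selects_VB] selects_adj_mult[OF selects_VB] mult.assoc entry_op_of_\<rho>)
  qed
  also have "\<dots> = entry (cnj_fmat (adj (\<psi>m z) * \<psi>m z')) e e'"
  proof -
    have "entry (adj (\<psi>m z) * \<psi>m z') e e' = (\<Sum>b<dB. entry (adj (\<psi>m z)) e b * entry (\<psi>m z') b e')"
      unfolding op_of_adjoint[symmetric] \<psi>m_def by (rule entry_mult_op_of) simp
    also have "\<dots> = (if e < dE \<and> e' < dE then \<Sum>b<dB. cnj (\<psi> ((bit_index z * dB + b) * dE + e)) * \<psi> ((bit_index z' * dB + b) * dE + e') else 0)"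
      by (auto simp: \<psi>m_def adj.rep_eq op_of.rep_eq intro!: sum.cong sum.neutral)
    finally show ?thesis by (simp add: cnj_fmat.rep_eq del: cnj_fmat_simps)
  qed
  finally show "entry (adj (Vz dE z) * op_of \<rho>AE * Vz dE z') e e' = entry (cnj_fmat (adj (\<psi>m z) * \<psi>m z')) e e'" .
qed

lemma \<rho>AB_block:
  assumes z: "z \<in> carrier_vec n" "z' \<in> carrier_vec n"
  shows "adj (Vz dB z) * op_of \<rho>AB * Vz dB z' = \<psi>m z * adj (\<psi>m z')"
proof (rule fmat_eqI)
  fix b b'
  note sel = selects_ket_z[of _ dB, folded Vz_def]
  have "entry (adj (Vz dB z) * op_of \<rho>AB * Vz dB z') b b'
    = (if b < dB \<and> b' < dB then \<Sum>e<dE. entry (adj (VE e) * op_of \<rho> * VE e) (bit_index z * dB + b) (bit_index z' * dB + b') else 0)"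
    by (auto simp: selects_mult[OF sel] selects_adj_mult[OF sel] mult.assoc op_of_\<rho>AB entry_sum)
  also have "\<dots> = (if b < dB \<and> b' < dB then \<Sum>e<dE. \<psi> ((bit_index z * dB + b) * dE + e) * cnj (\<psi> ((bit_index z' * dB + b') * dE + e)) else 0)"
  proof (intro if_cong sum.cong refl)
    fix e assume "b < dB \<and> b' < dB" "e \<in> {..<dE}"
    then show "entry (adj (VE e) * op_of \<rho> * VE e) (bit_index z * dB + b) (bit_index z' * dB + b')
      = \<psi> ((bit_index z * dB + b) * dE + e) * cnj (\<psi> ((bit_index z' * dB + b') * dE + e))"
      using less_mult_add_bound[OF bit_index_carrier[OF z(1)], of b dB] less_mult_add_bound[OF bit_index_carrier[OF z(2)], of b' dB]
        index_bound[OF z(1)] index_bound[OF z(2)]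
      by (simp add: selects_mult[OF selects_VE] selects_adj_mult[OF selects_VE] mult.assoc entry_op_of_\<rho>)
  qed
  also have "\<dots> = entry (\<psi>m z * adj (\<psi>m z')) b b'"
  proof -
    have "entry (\<psi>m z * adj (\<psi>m z')) b b' = (\<Sum>e<dE. entry (\<psi>m z) b e * entry (adj (\<psi>m z')) e b')"
      unfolding \<psi>m_def by (rule entry_mult_op_of) simp
    also have "\<dots> = (if b < dB \<and> b' < dB then \<Sum>e<dE. \<psi> ((bit_index z * dB + b) * dE + e) * cnj (\<psi> ((bit_index z' * dB + b') * dE + e)) else 0)"
      by (auto simp: \<psi>m_def adj.rep_eq op_of.rep_eq intro!: sum.cong sum.neutral)
    finally show ?thesis by simp
  qed
  finally show "entry (adj (Vz dB z) * op_of \<rho>AB * Vz dB z') b b' = entry (\<psi>m z * adj (\<psi>m z')) b b'" .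
qed

lemma fid_\<psi>m [simp]: "fid dB * \<psi>m z = \<psi>m z" "\<psi>m z * fid dE = \<psi>m z"
  by (simp_all add: \<psi>m_def fid_mult_op_of op_of_mult_fid)

end

locale dual_pure_state = pure_state n dB dE \<rho> \<psi> + dual_pair n m f g
  for n dB dE \<rho> \<psi> m f g

text \<open>Concretely, \<open>J\<close> and \<open>K\<close> adjoin z basis kets to
  \<open>E\<close> and to \<open>B\<close>. These kets have real entries, so conjugation fixes the
  isometries.\<close>

sublocale dual_pure_state \<subseteq> purified n m f g dB dE \<psi>m "Vz dE" "Vz dB"
  by unfold_locales (auto simp: Vz_orth)

context dual_pure_state
begin

lemma \<rho>AB_block_x:
  assumes "x \<in> carrier_vec n" "x' \<in> carrier_vec n"
  shows "adj (Vx dB x) * op_of \<rho>AB * Vx dB x' = \<Phi> x * adj (\<Phi> x')"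
proof -
  have "adj (Vx dB x) * op_of \<rho>AB * Vx dB x' = (1 / 2 ^ n) *\<^sub>R (\<Sum>z\<in>carrier_vec n. \<Sum>z'\<in>carrier_vec n.
      (chr x z * chr x' z') *\<^sub>R (adj (Vz dB z) * op_of \<rho>AB * Vz dB z'))"
    unfolding Vx_eq_sum[OF assms(1)] Vx_eq_sum[OF assms(2)]
    by (simp add: sum_distrib_right[of _ _ "op_of \<rho>AB"] sum_product mult.commute)
  also have "\<dots> = (1 / 2 ^ n) *\<^sub>R (\<Sum>z\<in>carrier_vec n. \<Sum>z'\<in>carrier_vec n.
      (chr x z * chr x' z') *\<^sub>R (\<psi>m z * adj (\<psi>m z')))"
    by (intro arg_cong[where f = "scaleR _"] sum.cong refl) (simp add: \<rho>AB_block)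
  also have "\<dots> = \<Phi> x * adj (\<Phi> x')"
    by (simp add: \<Phi>_def sum_product mult.commute)
  finally show ?thesis .
qed

lemma op_of_block_x: "x \<in> carrier_vec n \<Longrightarrow> op_of (block ket_x dB \<rho>AB x) = \<Phi> x * adj (\<Phi> x)"
  by (simp add: op_of_block(2)[OF ptrace_carrier(2)] \<rho>AB_block_x)

lemma op_of_block_z: "z \<in> carrier_vec n \<Longrightarrow> op_of (block ket_z dE \<rho>AE z) = cnj_fmat (adj (\<psi>m z) * \<psi>m z)"
  by (simp add: op_of_block(1)[OF ptrace_carrier(1)] \<rho>AE_block)

lemma sum_norm_\<Phi>: "(\<Sum>x\<in>carrier_vec n. (norm (\<Phi> x))\<^sup>2) = rtr (op_of \<rho>)"
proof -
  have "(\<Sum>x\<in>carrier_vec n. (norm (\<Phi> x))\<^sup>2) = (\<Sum>x\<in>carrier_vec n. rtr (adj (Vx dB x) * op_of \<rho>AB * Vx dB x))"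
    by (intro sum.cong refl) (simp add: \<rho>AB_block_x rtr_mult_adj)
  also have "\<dots> = rtr (op_of \<rho>AB)"
    by (intro rtr_compression[OF Vx_complete] op_of_mult_fid) (simp add: carrier_matD(2)[OF ptrace_carrier(2)])
  finally show ?thesis by (simp add: rtr_\<rho>AB)
qed

lemma norm_\<Phi>_le: "x \<in> carrier_vec n \<Longrightarrow> norm (\<Phi> x) \<le> 1"
proof -
  assume x: "x \<in> carrier_vec n"
  have "(norm (\<Phi> x))\<^sup>2 \<le> (\<Sum>x\<in>carrier_vec n. (norm (\<Phi> x))\<^sup>2)"
    using x by (intro member_le_sum) auto
  also have "\<dots> \<le> 1" using trace_\<rho> \<rho> by (simp add: sum_norm_\<Phi> rtr_op_of)
  finally show ?thesis by (simp add: power2_le_iff_abs_le abs_square_le_1)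
qed

section \<open>Fidelity of the hashed state with uniform states\<close>

definition hashed :: "complex mat" where "hashed = hashed_state n m dE ((*\<^sub>v) f) \<rho>AE"

lemma hashed_carrier: "hashed \<in> carrier_mat (2 ^ m * dE) (2 ^ m * dE)"
  by (simp add: hashed_def hashed_state_def op_sum_def)

lemma op_of_hashed: "op_of hashed = cnj_fmat \<rho>KE"
proof -
  let ?R = "\<lambda>k. op_sum dE dE (block ket_z dE \<rho>AE) {z \<in> carrier_vec n. f *\<^sub>v z = k}"
  have R: "?R k \<in> carrier_mat dE dE" for k by (simp add: op_sum_def)
  have dims: "dim_row (ket_proj a) = dim_row a" "dim_col (ket_proj a) = dim_row a" for a by (simp_all add: ket_proj_def)
  have opR: "op_of (?R k) = (\<Sum>z\<in>fibre n f k. cnj_fmat (adj (\<psi>m z) * \<psi>m z))" for k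
    by (subst op_of_op_sum) (auto simp: fibre_def op_of_block_z intro!: sum.cong block_carrier)
  have real: "cnj_fmat (Vz dE k) = Vz dE k" for k
    using selects_cnj[OF selects_ket_z] by (simp add: Vz_def)
  have "op_of hashed = (\<Sum>k\<in>carrier_vec m. Vz dE k * op_of (?R k) * adj (Vz dE k))"
    unfolding hashed_def hashed_state_def using R
    by (subst op_of_op_sum) (auto simp: op_of_kron_ket_proj_left Vz_def dims carrier_matD[OF R] intro!: sum.cong carrier_matI)
  also have "\<dots> = (\<Sum>k\<in>carrier_vec m. \<Sum>z\<in>fibre n f k. cnj_fmat (Vz dE (f *\<^sub>v z) * (adj (\<psi>m z) * \<psi>m z) * adj (Vz dE (f *\<^sub>v z))))"
    unfolding opR sum_distrib_left sum_distrib_right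
    by (intro sum.cong refl) (auto simp: fibre_iff real)
  also have "\<dots> = cnj_fmat \<rho>KE" by (simp only: \<rho>KE_def cnj_fmat_sum sum_fibres[OF carriers(1)])
  finally show ?thesis .
qed

lemma psd_hashed: "psd (2 ^ m * dE) hashed"
  using pos_op_of_iff[OF hashed_carrier] pos_cnj_fmat[OF pos_adj_mult[of \<Xi>]]
  by (simp add: op_of_hashed \<Xi>_gram del: cnj_fmat_simps)

definition uniform :: "complex mat \<Rightarrow> complex mat" where
  "uniform \<sigma> = kron ((1 / of_nat (2 ^ m)) \<cdot>\<^sub>m 1\<^sub>m (2 ^ m)) \<sigma>"

lemma op_of_uniform:
  assumes "\<sigma> \<in> carrier_mat dE dE"
  shows "op_of (uniform \<sigma>) = (1 / 2 ^ m) *\<^sub>R (\<Sum>k\<in>carrier_vec m. Vz dE k * op_of \<sigma> * adj (Vz dE k))"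
proof -
  have "uniform \<sigma> = complex_of_real (1 / 2 ^ m) \<cdot>\<^sub>m kron (1\<^sub>m (2 ^ m)) \<sigma>"
    unfolding uniform_def
    by (rule eq_matI) (use div_mod_less[of _ "2 ^ m"] assms in \<open>auto simp: kron_index\<close>)
  then show ?thesis by (simp only: op_of_smult_real op_of_kron_one_Vz[OF assms])
qed

lemma uniform_carrier: "\<sigma> \<in> carrier_mat dE dE \<Longrightarrow> uniform \<sigma> \<in> carrier_mat (2 ^ m * dE) (2 ^ m * dE)"
  by (auto simp: uniform_def intro!: carrier_matI)

lemma psd_uniform: "psd dE \<sigma> \<Longrightarrow> psd (2 ^ m * dE) (uniform \<sigma>)"
proof -
  assume \<sigma>: "psd dE \<sigma>"
  then have c: "\<sigma> \<in> carrier_mat dE dE" by (simp add: psd_def)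
  have "pos (Vz dE k * op_of \<sigma> * adj (Vz dE k))" for k
    using pos_conj[OF pos_op_of[OF \<sigma>], of "adj (Vz dE k)"] by simp
  then have "pos (op_of (uniform \<sigma>))"
    unfolding op_of_uniform[OF c] by (intro pos_scaleR pos_sum) auto
  then show ?thesis using pos_op_of_iff[OF uniform_carrier[OF c]] by simp
qed

text \<open>The correction term for sub-normalized states vanishes because the uniform state has
  trace one.\<close>

lemma fidelity_uniform:
  assumes \<sigma>: "normalized dE \<sigma>"
  shows "fidelity hashed (uniform \<sigma>) = trace_norm (psd_sqrt hashed * psd_sqrt (uniform \<sigma>))"
proof -
  have c: "\<sigma> \<in> carrier_mat dE dE" using \<sigma> by (simp add: normalized_def psd_def)
  then have tr\<sigma>: "rtr (op_of \<sigma>) = 1" using \<sigma> by (auto simp: rtr_op_of normalized_def)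
  have "rtr (Vz dE k * op_of \<sigma> * adj (Vz dE k)) = 1" if "k \<in> carrier_vec m" for k
  proof -
    have "rtr (Vz dE k * op_of \<sigma> * adj (Vz dE k)) = rtr (adj (Vz dE k) * Vz dE k * op_of \<sigma>)"
      by (subst rtr_comm) (simp add: mult.assoc)
    then show ?thesis using c that tr\<sigma> by (simp add: Vz_orth[of _ m] fid_mult_op_of)
  qed
  then have "rtr (op_of (uniform \<sigma>)) = 1"
    by (simp add: op_of_uniform[OF c] rtr_scaleR rtr_sum)
  then have "Re (op_trace (uniform \<sigma>)) = 1"
    using uniform_carrier[OF c] by (simp add: rtr_op_of)
  then show ?thesis by (simp add: fidelity_def)
qed

text \<open>Positive success allows the operator \<open>\<omega>\<close> of the measurement to be
  normalized to a state on \<open>E\<close>; this state is the candidate in the maximum.\<close>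

lemma success_le_fidelity:
  assumes M: "povm_op M" and pos: "0 < success M"
  shows "\<exists>\<sigma>. normalized dE \<sigma> \<and> success M \<le> (fidelity hashed (uniform \<sigma>))\<^sup>2"
proof -
  define Mx where "Mx x = M (g *\<^sub>v x) x" for x
  have Mx: "pos (Mx x)" "fid dB * Mx x = Mx x" if "x \<in> carrier_vec n" for x
    using M that by (auto simp: povm_op_def Mx_def)
  \<comment> \<open>What is missing from the identity is the sum of the POVM elements for guesses
    outside the fibre of \<open>s\<close>.\<close>
  have Mx_le: "pos (fid dB - (\<Sum>x\<in>fibre n g s. Mx x))" if s: "s \<in> carrier_vec (n - m)" for s
  proof -
    have "fid dB = (\<Sum>e\<in>carrier_vec n. M s e)" using M s by (auto simp: povm_op_def)
    also have "\<dots> = (\<Sum>x\<in>fibre n g s. M s x) + (\<Sum>x\<in>carrier_vec n - fibre n g s. M s x)"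
      by (rule sum.subset_diff[THEN trans, OF _ _ add.commute]) (auto simp: fibre_carrier)
    also have "(\<Sum>x\<in>fibre n g s. M s x) = (\<Sum>x\<in>fibre n g s. Mx x)"
      by (intro sum.cong) (auto simp: Mx_def fibre_iff)
    finally have "fid dB - (\<Sum>x\<in>fibre n g s. Mx x) = (\<Sum>x\<in>carrier_vec n - fibre n g s. M s x)"
      by (simp add: algebra_simps)
    then show ?thesis using M s by (auto simp: povm_op_def intro!: pos_sum)
  qed
  define \<beta> where "\<beta> = rtr (\<omega> Mx)"
  have success: "success M = \<beta>"
    unfolding success_def \<beta>_def \<omega>_def rtr_sum Mx_def
    by (intro sum.cong refl) (metis mult.assoc rtr_comm)
  define \<sigma> where "\<sigma> = mat_of dE dE (cnj_fmat ((1 / \<beta>) *\<^sub>R \<omega> Mx))"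
  have pos_\<omega>: "pos (\<omega> Mx)" unfolding \<omega>_def using Mx by (intro pos_sum pos_conj) auto
  have \<omega>_fid: "\<omega> Mx * fid dE = \<omega> Mx" unfolding \<omega>_def sum_distrib_right
    by (intro sum.cong refl) (simp add: mult.assoc \<Phi>_right)
  have fid_\<omega>: "fid dE * \<omega> Mx = \<omega> Mx" using arg_cong[OF \<omega>_fid, of adj] pos_adj[OF pos_\<omega>] by simp
  have fid_cnj: "fid dE * cnj_fmat (\<omega> Mx) = cnj_fmat (\<omega> Mx)" "cnj_fmat (\<omega> Mx) * fid dE = cnj_fmat (\<omega> Mx)"
    using arg_cong[OF fid_\<omega>, of cnj_fmat] arg_cong[OF \<omega>_fid, of cnj_fmat] by simp_all
  have op\<sigma>: "op_of \<sigma> = (1 / \<beta>) *\<^sub>R cnj_fmat (\<omega> Mx)"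
    by (simp add: \<sigma>_def op_of_mat_of fid_cnj)
  have \<sigma>c: "\<sigma> \<in> carrier_mat dE dE" by (simp add: \<sigma>_def)
  have "pos (op_of \<sigma>)" using pos success unfolding op\<sigma> by (intro pos_scaleR pos_cnj_fmat pos_\<omega>) simp
  then have psd\<sigma>: "psd dE \<sigma>" using pos_op_of_iff[OF \<sigma>c] by simp
  have "Re (op_trace \<sigma>) = 1"
    using \<sigma>c pos success by (simp add: op\<sigma> rtr_scaleR \<beta>_def flip: rtr_op_of)
  moreover have "Im (op_trace \<sigma>) = 0"
  proof -
    have "Im (\<sigma> $$ (i, i)) = 0" if "i < dE" for i
      using arg_cong[OF psd_hermitian[OF psd\<sigma> that that], of Im] by simp
    then show ?thesis using \<sigma>c by (simp add: op_trace_def)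
  qed
  ultimately have norm\<sigma>: "normalized dE \<sigma>"
    using psd\<sigma> by (simp add: normalized_def complex_eq_iff)
  \<comment> \<open>With this scaling the bound of \<open>\<Gamma>_gram_le\<close> becomes the
    uniform state with \<open>\<sigma>\<close>, and the overlap
    \<open>sqrt (2 ^ m) * \<beta>\<close> becomes \<open>sqrt \<beta>\<close>.\<close>
  define c where "c = 1 / (sqrt (2 ^ m) * sqrt \<beta>)"
  have c2: "c\<^sup>2 = 1 / (2 ^ m * \<beta>)" using pos success by (simp add: c_def power_divide power_mult_distrib)
  have real: "cnj_fmat (Vz dE k) = Vz dE k" for k
    using selects_cnj[OF selects_ket_z] by (simp add: Vz_def)
  define Y where "Y = c *\<^sub>R cnj_fmat (\<Gamma> Mx)"
  have "rtr (adj Y * cnj_fmat \<Xi>) \<le> trace_norm (psd_sqrt hashed * psd_sqrt (uniform \<sigma>))"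
  proof (rule uhlmann_le[OF psd_hashed psd_uniform[OF psd\<sigma>]])
    show "adj (cnj_fmat \<Xi>) * cnj_fmat \<Xi> = op_of hashed"
      using arg_cong[OF \<Xi>_gram, of cnj_fmat] by (simp add: op_of_hashed)
    fix Z
    have eq: "op_of (uniform \<sigma>) - adj Y * Y
      = c\<^sup>2 *\<^sub>R cnj_fmat ((\<Sum>k\<in>carrier_vec m. Vz dE k * \<omega> Mx * adj (Vz dE k)) - adj (\<Gamma> Mx) * \<Gamma> Mx)"
      unfolding op_of_uniform[OF \<sigma>c] op\<sigma> Y_def
      by (simp add: c2 real scaleR_sum_right scaleR_diff_right flip: power2_eq_square)
    have "pos (op_of (uniform \<sigma>) - adj Y * Y)"
      unfolding eq by (intro pos_scaleR pos_cnj_fmat \<Gamma>_gram_le[OF Mx Mx_le] zero_le_power2)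
    from pos_inner[OF this, of Z] show "(norm (Y * Z))\<^sup>2 \<le> inner Z (op_of (uniform \<sigma>) * Z)"
      by (simp add: left_diff_distrib inner_diff_right power2_norm_eq_inner inner_mult_left mult.assoc)
  qed
  also have "rtr (adj Y * cnj_fmat \<Xi>) = c * rtr (adj (\<Gamma> Mx) * \<Xi>)"
    using rtr_cnj_fmat[of "adj (\<Gamma> Mx) * \<Xi>"] by (simp add: Y_def rtr_scaleR)
  also have "\<dots> = c * (sqrt (2 ^ m) * \<beta>)"
    using \<Gamma>_overlap[OF Mx Mx_le] by (simp add: \<beta>_def)
  also have "\<dots> = sqrt \<beta>" using pos success by (simp add: c_def real_div_sqrt)
  finally have "sqrt \<beta> \<le> fidelity hashed (uniform \<sigma>)" by (simp add: fidelity_uniform[OF norm\<sigma>])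
  then have "(sqrt \<beta>)\<^sup>2 \<le> (fidelity hashed (uniform \<sigma>))\<^sup>2" using pos success by (intro power_mono) auto
  with norm\<sigma> pos success show ?thesis by (intro exI[of _ \<sigma>]) simp
qed

lemma fidelity_sq_le:
  assumes std: "classical_in ket_z n dE \<rho>AE \<or> classical_in ket_x n dB \<rho>AB"
    and \<sigma>: "normalized dE \<sigma>"
    and \<tau>: "\<And>s. s \<in> carrier_vec (n - m) \<Longrightarrow> pos (\<tau> s)"
    and \<tau>_ge: "\<And>x. x \<in> carrier_vec n \<Longrightarrow> pos (\<tau> (g *\<^sub>v x) - \<Phi> x * adj (\<Phi> x))"
  shows "(fidelity hashed (uniform \<sigma>))\<^sup>2 \<le> (\<Sum>s\<in>carrier_vec (n - m). rtr (\<tau> s))"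
proof -
  have psd\<sigma>: "psd dE \<sigma>" and c: "\<sigma> \<in> carrier_mat dE dE" using \<sigma> by (auto simp: normalized_def psd_def)
  let ?S = "op_of (psd_sqrt \<sigma>)"
  \<comment> \<open>The hashed state is the conjugate of \<open>\<rho>KE\<close>, so the root of
    \<open>\<sigma>\<close> is conjugated once here and the overlap bounds are applied to
    unconjugated purifications.\<close>
  define S where "S = cnj_fmat ?S"
  note sq = op_of_psd_sqrt[OF psd\<sigma>]
  have sqc: "psd_sqrt \<sigma> \<in> carrier_mat dE dE" using psd_sqrt(1)[OF psd\<sigma>] by (simp add: psd_def)
  have adjS: "adj S = S" using pos_adj[OF pos_cnj_fmat[OF sq(1)]] by (simp add: S_def)
  have "fid dE * ?S = ?S" using sqc by (intro fid_mult_op_of) auto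
  from arg_cong[OF this, of cnj_fmat] have fidS: "fid dE * S = S" by (simp add: S_def)
  have "(norm S)\<^sup>2 = rtr (?S * ?S)" using rtr_adj_mult[of ?S] by (simp add: S_def pos_adj[OF sq(1)])
  also have "\<dots> = 1" using \<sigma> c by (auto simp: sq(2) rtr_op_of normalized_def)
  finally have normS: "norm S = 1" by (intro power2_eq_imp_eq[of "norm S" 1]) simp_all
  have real: "cnj_fmat (Vz dE k) = Vz dE k" for k
    using selects_cnj[OF selects_ket_z] by (simp add: Vz_def)
  define Q where "Q = purif S"
  have gramQ: "adj (cnj_fmat Q) * cnj_fmat Q = op_of (uniform \<sigma>)"
  proof -
    have cQ: "cnj_fmat Q = (1 / sqrt (2 ^ m)) *\<^sub>R (\<Sum>k\<in>carrier_vec m. Vz dE k * ?S * adj (Vz dE k))"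
      by (simp add: Q_def purif_def S_def real)
    have fidS0: "fid dE * (?S * adj (Vz dE k)) = ?S * adj (Vz dE k)" for k
      using \<open>fid dE * ?S = ?S\<close> by (simp flip: mult.assoc)
    have "adj (cnj_fmat Q) * cnj_fmat Q = (1 / 2 ^ m) *\<^sub>R (\<Sum>k\<in>carrier_vec m. \<Sum>k'\<in>carrier_vec m.
        Vz dE k * (?S * (adj (Vz dE k) * (Vz dE k' * (?S * adj (Vz dE k'))))))"
      unfolding cQ by (simp add: sum_product mult.assoc pos_adj[OF sq(1)])
    also have "\<dots> = (1 / 2 ^ m) *\<^sub>R (\<Sum>k\<in>carrier_vec m. \<Sum>k'\<in>carrier_vec m.
        if k' = k then Vz dE k * (?S * (?S * adj (Vz dE k))) else 0)"
      by (intro arg_cong[where f = "scaleR _"] sum.cong refl) (auto simp: J_mult_J fidS0)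
    also have "\<dots> = op_of (uniform \<sigma>)"
      unfolding op_of_uniform[OF c] sq(2)[symmetric] by (simp add: mult.assoc)
    finally show ?thesis .
  qed
  let ?F = "fidelity hashed (uniform \<sigma>)"
  have F0: "0 \<le> ?F"
  proof -
    have "psd_sqrt hashed * psd_sqrt (uniform \<sigma>) \<in> carrier_mat (2 ^ m * dE) (2 ^ m * dE)"
      using psd_sqrt(1)[OF psd_hashed] psd_sqrt(1)[OF psd_uniform[OF psd\<sigma>]] by (auto simp: psd_def)
    from trace_norm_op[OF this] show ?thesis
      unfolding fidelity_uniform[OF \<sigma>] by (metis pos_rtr)
  qed
  have F_eq: "\<exists>U. contr U \<and> ?F = rtr (U * X * adj Q)" if X: "adj X * X = \<rho>KE" for X
  proof -
    have "adj (cnj_fmat X) * cnj_fmat X = op_of hashed"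
      using arg_cong[OF X, of cnj_fmat] by (simp add: op_of_hashed)
    from uhlmann_eq[OF psd_hashed psd_uniform[OF psd\<sigma>] this gramQ] obtain U where
      U: "contr U" "?F = rtr (U * cnj_fmat X * adj (cnj_fmat Q))"
      by (auto simp: fidelity_uniform[OF \<sigma>])
    have "rtr (U * cnj_fmat X * adj (cnj_fmat Q)) = rtr (cnj_fmat (cnj_fmat U * X * adj Q))" by simp
    also have "\<dots> = rtr (cnj_fmat U * X * adj Q)" by (rule rtr_cnj_fmat)
    finally show ?thesis using U contr_cnj by auto
  qed
  show ?thesis
    using std
  proof
    assume "classical_in ket_x n dB \<rho>AB"
    then have orth: "\<Phi> x * adj (\<Phi> x') = 0" if "x \<in> carrier_vec n" "x' \<in> carrier_vec n" "x \<noteq> x'" for x x'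
      using classical_block_orth(2)[OF ptrace_carrier(2) that] that by (simp add: \<rho>AB_block_x)
    obtain U where "contr U" "?F = rtr (U * \<Xi> * adj Q)" using F_eq[OF \<Xi>_gram] by blast
    then have "?F \<le> sqrt (\<Sum>s\<in>carrier_vec (n - m). rtr (\<tau> s))"
      using overlap_le_X[OF _ normS adjS fidS \<tau> \<tau>_ge orth] by (simp add: Q_def)
    then have "?F\<^sup>2 \<le> (sqrt (\<Sum>s\<in>carrier_vec (n - m). rtr (\<tau> s)))\<^sup>2" using F0 by (rule power_mono)
    also have "\<dots> = (\<Sum>s\<in>carrier_vec (n - m). rtr (\<tau> s))"
      using \<tau> by (intro real_sqrt_pow2 sum_nonneg pos_rtr) auto
    finally show ?thesis .
  next
    assume "classical_in ket_z n dE \<rho>AE"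
    then have "cnj_fmat (adj (\<psi>m z) * \<psi>m z') = 0" if "z \<in> carrier_vec n" "z' \<in> carrier_vec n" "z \<noteq> z'" for z z'
      using classical_block_orth(1)[OF ptrace_carrier(1) that] that by (simp add: \<rho>AE_block del: cnj_fmat_simps)
    then have orth: "adj (\<psi>m z) * \<psi>m z' = 0" if "z \<in> carrier_vec n" "z' \<in> carrier_vec n" "z \<noteq> z'" for z z'
      using that by (metis cnj_fmat_cnj_fmat cnj_fmat_simps(1))
    \<comment> \<open>Every syndrome gives a bound by itself, through the purification signed by one
      of its representatives. Averaging over all \<open>2 ^ (n - m)\<close> syndromes cancels the
      factor.\<close>
    have each: "?F\<^sup>2 \<le> 2 ^ (n - m) * rtr (\<tau> s)" if s: "s \<in> carrier_vec (n - m)" for s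
    proof -
      obtain x0 where x0: "x0 \<in> fibre n g s" using g_surj[OF s] by blast
      define X where "X = (\<Sum>z\<in>carrier_vec n. chr x0 z *\<^sub>R \<psi>m z * adj (Vz dE (f *\<^sub>v z)))"
      obtain U where "contr U" "?F = rtr (U * X * adj Q)" using F_eq[OF gram_Z[OF orth X_def]] by blast
      then have "?F \<le> sqrt (2 ^ (n - m) * rtr (\<tau> s))"
        using overlap_le_Z[OF _ normS adjS fidS \<tau> \<tau>_ge s x0 X_def] by (simp add: Q_def)
      then have "?F\<^sup>2 \<le> (sqrt (2 ^ (n - m) * rtr (\<tau> s)))\<^sup>2" using F0 by (rule power_mono)
      then show ?thesis using pos_rtr[OF \<tau>[OF s]] by simp
    qed
    have "2 ^ (n - m) * ?F\<^sup>2 = (\<Sum>s\<in>(carrier_vec (n - m) :: bit vec set). ?F\<^sup>2)" by simp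
    also have "\<dots> \<le> (\<Sum>s\<in>carrier_vec (n - m). 2 ^ (n - m) * rtr (\<tau> s))" by (intro sum_mono each)
    also have "\<dots> = 2 ^ (n - m) * (\<Sum>s\<in>carrier_vec (n - m). rtr (\<tau> s))" by (simp add: sum_distrib_left)
    finally show ?thesis by simp
  qed
qed

end

section \<open>Values of the entropies and indices\<close>

lemma log2_ereal_mono: "x \<le> y \<Longrightarrow> log2_ereal x \<le> log2_ereal y"
  by (simp add: log2_ereal_def)

text \<open>The supremum is over logarithms, so it is matched with \<open>t\<close> by approximation
  from below. For \<open>t \<le> 0\<close> both sides are \<open>- \<infinity>\<close>, even over an
  empty index set.\<close>

lemma SUP_log2_ereal:
  assumes le: "\<And>i. i \<in> S \<Longrightarrow> h i \<le> t"
    and approx: "\<And>r. 0 < r \<Longrightarrow> r < t \<Longrightarrow> \<exists>i\<in>S. r < h i"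
  shows "(SUP i\<in>S. log2_ereal (h i)) = log2_ereal t"
proof (rule antisym)
  show "(SUP i\<in>S. log2_ereal (h i)) \<le> log2_ereal t"
    by (intro SUP_least log2_ereal_mono le)
  show "log2_ereal t \<le> (SUP i\<in>S. log2_ereal (h i))"
  proof (cases "0 < t")
    case True
    show ?thesis
      unfolding le_SUP_iff
    proof (intro allI impI)
      fix y assume y: "y < log2_ereal t"
      show "\<exists>i\<in>S. y < log2_ereal (h i)"
      proof (cases y)
        case (real r)
        then have "r < log 2 t" using y True by (simp add: log2_ereal_def)
        then have "2 powr r < t" using True by (simp add: less_log_iff)
        then obtain i where i: "i \<in> S" "2 powr r < h i" using approx[of "2 powr r"] by auto
        then have "0 < h i" using order_less_trans[OF powr_gt_zero[of 2 r, THEN iffD2] i(2)] by simp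
        then have "y < log2_ereal (h i)" using i(2) real by (simp add: log2_ereal_def less_log_iff)
        with i(1) show ?thesis by blast
      next
        case PInf
        with y show ?thesis by simp
      next
        case MInf
        obtain i where i: "i \<in> S" "t / 2 < h i" using approx[of "t / 2"] True by auto
        then have "y < log2_ereal (h i)" using True MInf by (simp add: log2_ereal_def)
        with i(1) show ?thesis by blast
      qed
    qed
  qed (simp add: log2_ereal_def)
qed

lemma exp2_ereal_minus_infinity [simp]: "exp2_ereal (- \<infinity>) = 0"
  by (simp flip: MInfty_eq_minfinity)

lemma exp2_log2_ereal_diff:
  assumes "0 \<le> t"
  shows "exp2_ereal (log2_ereal (2 ^ m * t) - ereal (real m)) = t"
proof (cases "t = 0")
  case False
  with assms have "0 < t" by simp
  then have "log 2 (2 ^ m * t) - real m = log 2 t" by (simp add: log_mult log_nat_power)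
  with \<open>0 < t\<close> show ?thesis by (simp add: log2_ereal_def)
qed (simp add: log2_ereal_def)

lemma exp2_log2_ereal: "0 \<le> t \<Longrightarrow> exp2_ereal (log2_ereal t) = t"
  using exp2_log2_ereal_diff[of t 0] by (simp add: zero_ereal_def[symmetric])

text \<open>Over the two-element field \<open>x + e\<close> vanishes exactly when \<open>e\<close>
  is \<open>x\<close>, so the objectives agree for each POVM family and not just in the
  minimum.\<close>

lemma Q_EC_eq_Q_DC: "Q_EC n l dB h R = Q_DC n l dB h R"
proof -
  have "{e \<in> carrier_vec n. x + e \<noteq> 0\<^sub>v n} = {e \<in> carrier_vec n. e \<noteq> x}" if "x \<in> carrier_vec n" for x :: "bit vec"
    using bits_add_eq_0[OF that] by auto
  then show ?thesis unfolding Q_EC_def Q_DC_def by (intro INF_cong sum.cong) auto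
qed

lemma conj_Vx_sum:
  assumes "x \<in> carrier_vec n" "fid d * R x * fid d = R x"
  shows "adj (Vx d x) * (\<Sum>u\<in>carrier_vec n. Vx d u * R u * adj (Vx d u)) * Vx d x = R x"
proof -
  have "adj (Vx d x) * (\<Sum>u\<in>carrier_vec n. Vx d u * R u * adj (Vx d u)) * Vx d x
    = (\<Sum>u\<in>carrier_vec n. (adj (Vx d x) * Vx d u) * R u * (adj (Vx d u) * Vx d x))"
    by (simp add: sum_distrib_left sum_distrib_right mult.assoc)
  also have "\<dots> = (\<Sum>u\<in>carrier_vec n. if u = x then R x else 0)"
    using assms by (intro sum.cong refl) (auto simp: Vx_orth[of _ n])
  finally show ?thesis using assms(1) by simp
qed

section \<open>Optimal guessing probability\<close>

context purified
begin

lemma success_plus_failure: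
  assumes M: "povm_op M"
  shows "success M + (\<Sum>x\<in>carrier_vec n. \<Sum>e\<in>{e \<in> carrier_vec n. e \<noteq> x}. rtr (\<Phi> x * adj (\<Phi> x) * M (g *\<^sub>v x) e))
    = (\<Sum>x\<in>carrier_vec n. (norm (\<Phi> x))\<^sup>2)"
  unfolding success_def sum.distrib[symmetric]
proof (intro sum.cong refl)
  fix x :: "bit vec" assume x: "x \<in> carrier_vec n"
  have "rtr (\<Phi> x * adj (\<Phi> x) * M (g *\<^sub>v x) x) + (\<Sum>e\<in>{e \<in> carrier_vec n. e \<noteq> x}. rtr (\<Phi> x * adj (\<Phi> x) * M (g *\<^sub>v x) e))
    = (\<Sum>e\<in>insert x {e \<in> carrier_vec n. e \<noteq> x}. rtr (\<Phi> x * adj (\<Phi> x) * M (g *\<^sub>v x) e))"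
    by simp
  also have "insert x {e \<in> carrier_vec n. e \<noteq> x} = carrier_vec n" using x by auto
  also have "(\<Sum>e\<in>carrier_vec n. rtr (\<Phi> x * adj (\<Phi> x) * M (g *\<^sub>v x) e)) = rtr (\<Phi> x * adj (\<Phi> x) * fid dB)"
    using M x by (simp add: povm_op_def flip: rtr_sum sum_distrib_left)
  also have "\<dots> = (norm (\<Phi> x))\<^sup>2"
    using rtr_comm[of "\<Phi> x * adj (\<Phi> x)" "fid dB"] x by (simp add: \<Phi>_left rtr_mult_adj flip: mult.assoc)
  finally show "rtr (\<Phi> x * adj (\<Phi> x) * M (g *\<^sub>v x) x) + (\<Sum>e\<in>{e \<in> carrier_vec n. e \<noteq> x}. rtr (\<Phi> x * adj (\<Phi> x) * M (g *\<^sub>v x) e))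
    = (norm (\<Phi> x))\<^sup>2" .
qed

lemma rtr_gram_povm_nonneg:
  assumes "povm_op M" "s \<in> carrier_vec (n - m)" "e \<in> carrier_vec n"
  shows "0 \<le> rtr (\<Phi> x * adj (\<Phi> x) * M s e)"
proof -
  have "pos (M s e)" using assms by (auto simp: povm_op_def)
  then have "0 \<le> rtr (adj (\<Phi> x) * M s e * \<Phi> x)" by (rule rtr_conj_nonneg)
  also have "\<dots> = rtr (\<Phi> x * adj (\<Phi> x) * M s e)" by (metis mult.assoc rtr_comm)
  finally show ?thesis .
qed

lemma success_nonneg: "povm_op M \<Longrightarrow> 0 \<le> success M"
  unfolding success_def by (intro sum_nonneg rtr_gram_povm_nonneg) auto

lemma success_le: "povm_op M \<Longrightarrow> success M \<le> (\<Sum>x\<in>carrier_vec n. (norm (\<Phi> x))\<^sup>2)"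
proof -
  assume M: "povm_op M"
  have "0 \<le> (\<Sum>x\<in>carrier_vec n. \<Sum>e\<in>{e \<in> carrier_vec n. e \<noteq> x}. rtr (\<Phi> x * adj (\<Phi> x) * M (g *\<^sub>v x) e))"
    using M by (intro sum_nonneg rtr_gram_povm_nonneg) auto
  with success_plus_failure[OF M] show ?thesis by simp
qed

text \<open>The common value behind the theorem: for a fixed dual pair, each entropy exponential
  equals it and each index equals the trace minus it.\<close>

definition guess :: real where "guess = Sup (success ` Collect povm_op)"

lemma ex_povm_op: "\<exists>M. povm_op M"
proof -
  have "povm_op (\<lambda>s e. if e = 0\<^sub>v n then fid dB else 0)"
    by (auto simp: povm_op_def pos_fid_fid)
  then show ?thesis by blast
qed

lemma bdd_above_success: "bdd_above (success ` Collect povm_op)"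
  using success_le by (auto simp: bdd_above_def)

lemma success_le_guess: "povm_op M \<Longrightarrow> success M \<le> guess"
  unfolding guess_def by (rule cSUP_upper) (auto simp: bdd_above_success)

lemma ex_near_guess: "0 < \<delta> \<Longrightarrow> \<exists>M. povm_op M \<and> guess - \<delta> < success M"
  using less_cSUP_iff[OF _ bdd_above_success, of "guess - \<delta>"] ex_povm_op by (auto simp: guess_def)

lemma guess_least: "(\<And>M. povm_op M \<Longrightarrow> success M \<le> b) \<Longrightarrow> guess \<le> b"
  unfolding guess_def using ex_povm_op by (intro cSUP_least) auto

lemma guess_nonneg: "0 \<le> guess"
  using ex_povm_op success_nonneg success_le_guess by (meson order_trans)

end

context dual_pure_state
begin

lemma povm_family_op: "povm_family n (n - m) dB M \<Longrightarrow> povm_op (\<lambda>s e. op_of (M s e))"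
proof -
  assume M: "povm_family n (n - m) dB M"
  have "(\<Sum>e\<in>carrier_vec n. op_of (M s e)) = fid dB" if s: "s \<in> carrier_vec (n - m)" for s
  proof -
    have p: "povm n dB (M s)" using M s by (simp add: povm_family_def)
    then have "op_of (op_sum dB dB (M s) (carrier_vec n)) = (\<Sum>e\<in>carrier_vec n. op_of (M s e))"
      by (intro op_of_op_sum) (auto simp: povm_def psd_def)
    with p show ?thesis by (simp add: povm_def)
  qed
  moreover have "pos (op_of (M s e)) \<and> fid dB * op_of (M s e) = op_of (M s e)"
    if "s \<in> carrier_vec (n - m)" "e \<in> carrier_vec n" for s e
  proof -
    have psd: "psd dB (M s e)" using M that by (auto simp: povm_family_def povm_def)
    then have "dim_row (M s e) = dB" by (auto simp: psd_def)
    then show ?thesis using pos_op_of[OF psd] by (simp add: fid_mult_op_of)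
  qed
  ultimately show ?thesis by (simp add: povm_op_def)
qed

lemma povm_op_family:
  assumes N: "povm_op N"
  obtains M where "povm_family n (n - m) dB M"
    "\<And>s e. s \<in> carrier_vec (n - m) \<Longrightarrow> e \<in> carrier_vec n \<Longrightarrow> op_of (M s e) = N s e"
proof
  let ?M = "\<lambda>s e. mat_of dB dB (N s e)"
  have fid: "fid dB * N s e * fid dB = N s e" if "s \<in> carrier_vec (n - m)" "e \<in> carrier_vec n" for s e
  proof -
    have *: "pos (N s e)" "fid dB * N s e = N s e" using N that by (auto simp: povm_op_def)
    have "N s e * fid dB = N s e" using arg_cong[OF *(2), of adj] by (simp add: pos_adj[OF *(1)])
    with *(2) show ?thesis by simp
  qed
  show op: "op_of (?M s e) = N s e" if "s \<in> carrier_vec (n - m)" "e \<in> carrier_vec n" for s e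
    using fid[OF that] by (simp add: op_of_mat_of)
  show "povm_family n (n - m) dB ?M"
    unfolding povm_family_def povm_def
  proof (intro ballI conjI)
    fix s e :: "bit vec" assume "s \<in> carrier_vec (n - m)" "e \<in> carrier_vec n"
    then show "psd dB (?M s e)" using fid N by (intro psd_mat_of) (auto simp: povm_op_def)
  next
    fix s :: "bit vec" assume s: "s \<in> carrier_vec (n - m)"
    have "op_of (op_sum dB dB (?M s) (carrier_vec n)) = (\<Sum>e\<in>carrier_vec n. op_of (?M s e))"
      by (rule op_of_op_sum) simp
    also have "\<dots> = op_of (1\<^sub>m dB)" using N s op by (simp add: povm_op_def)
    finally show "op_sum dB dB (?M s) (carrier_vec n) = 1\<^sub>m dB"
      by (rule op_of_inject) (simp_all add: op_sum_def)
  qed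
qed

abbreviation "\<rho>XB \<equiv> measured ket_x n dB \<rho>AB"
abbreviation "\<rho>ZE \<equiv> measured ket_z n dE \<rho>AE"

lemma failure_eq:
  assumes M: "povm_family n (n - m) dB M"
  shows "(\<Sum>x\<in>carrier_vec n. \<Sum>e\<in>{e \<in> carrier_vec n. e \<noteq> x}. Re (op_trace (block ket_x dB \<rho>XB x * M (g *\<^sub>v x) e)))
    = Re (op_trace \<rho>) - success (\<lambda>s e. op_of (M s e))"
proof -
  have "Re (op_trace (block ket_x dB \<rho>XB x * M (g *\<^sub>v x) e)) = rtr (\<Phi> x * adj (\<Phi> x) * op_of (M (g *\<^sub>v x) e))"
    if "x \<in> carrier_vec n" "e \<in> carrier_vec n" for x e
  proof -
    have "psd dB (M (g *\<^sub>v x) e)" using M that by (auto simp: povm_family_def povm_def)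
    then have c: "M (g *\<^sub>v x) e \<in> carrier_mat dB dB" by (simp add: psd_def)
    have b: "block ket_x dB \<rho>AB x \<in> carrier_mat dB dB" using that by (intro block_carrier) auto
    have "rtr (op_of (block ket_x dB \<rho>AB x * M (g *\<^sub>v x) e)) = Re (op_trace (block ket_x dB \<rho>AB x * M (g *\<^sub>v x) e))"
      using b c by (intro rtr_op_of) auto
    then show ?thesis
      using b c that by (simp add: block_measured(2)[OF ptrace_carrier(2)] op_of_mult op_of_block_x)
  qed
  then have "(\<Sum>x\<in>carrier_vec n. \<Sum>e\<in>{e \<in> carrier_vec n. e \<noteq> x}. Re (op_trace (block ket_x dB \<rho>XB x * M (g *\<^sub>v x) e)))
    = (\<Sum>x\<in>carrier_vec n. \<Sum>e\<in>{e \<in> carrier_vec n. e \<noteq> x}. rtr (\<Phi> x * adj (\<Phi> x) * op_of (M (g *\<^sub>v x) e)))"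
    by (intro sum.cong refl) auto
  moreover have "(\<Sum>x\<in>carrier_vec n. (norm (\<Phi> x))\<^sup>2) = Re (op_trace \<rho>)"
    using \<rho> by (simp add: sum_norm_\<Phi> rtr_op_of)
  ultimately show ?thesis using success_plus_failure[OF povm_family_op[OF M]] by simp
qed

lemma Q_DC_eq: "Q_DC n (n - m) dB ((*\<^sub>v) g) \<rho>XB = Re (op_trace \<rho>) - guess"
  unfolding Q_DC_def
proof (rule cInf_eq)
  fix y assume "y \<in> (\<lambda>M. \<Sum>x\<in>carrier_vec n. \<Sum>e\<in>{e \<in> carrier_vec n. e \<noteq> x}.
    Re (op_trace (block ket_x dB \<rho>XB x * M (g *\<^sub>v x) e))) ` {M. povm_family n (n - m) dB M}"
  then show "Re (op_trace \<rho>) - guess \<le> y"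
    using success_le_guess[OF povm_family_op] by (auto simp: failure_eq)
next
  fix y assume lower: "\<And>v. v \<in> (\<lambda>M. \<Sum>x\<in>carrier_vec n. \<Sum>e\<in>{e \<in> carrier_vec n. e \<noteq> x}.
    Re (op_trace (block ket_x dB \<rho>XB x * M (g *\<^sub>v x) e))) ` {M. povm_family n (n - m) dB M} \<Longrightarrow> y \<le> v"
  have "guess \<le> Re (op_trace \<rho>) - y"
  proof (rule guess_least)
    fix N assume N: "povm_op N"
    obtain M where M: "povm_family n (n - m) dB M"
      "\<And>s e. s \<in> carrier_vec (n - m) \<Longrightarrow> e \<in> carrier_vec n \<Longrightarrow> op_of (M s e) = N s e"
      using povm_op_family[OF N] by blast
    have "success (\<lambda>s e. op_of (M s e)) = success N"
      unfolding success_def by (intro sum.cong refl) (simp add: M(2))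
    moreover have "y \<le> Re (op_trace \<rho>) - success (\<lambda>s e. op_of (M s e))"
      unfolding failure_eq[OF M(1), symmetric] by (rule lower) (use M(1) in blast)
    ultimately show "success N \<le> Re (op_trace \<rho>) - y" by simp
  qed
  then show "y \<le> Re (op_trace \<rho>) - guess" by simp
qed

text \<open>Constraints of the program dual to guessing, with one operator per syndrome. It is the
  block form to which the bounds in the min-entropy reduce.\<close>

definition feasible :: "(bit vec \<Rightarrow> fmat) \<Rightarrow> bool" where
  "feasible \<tau> \<longleftrightarrow> (\<forall>s\<in>carrier_vec (n - m). pos (\<tau> s)) \<and>
     (\<forall>x\<in>carrier_vec n. pos (\<tau> (g *\<^sub>v x) - \<Phi> x * adj (\<Phi> x)))"

lemma ex_feasible:
  assumes "0 < \<epsilon>"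
  obtains \<tau> where "feasible \<tau>" "\<And>s. s \<in> carrier_vec (n - m) \<Longrightarrow> fid dB * \<tau> s = \<tau> s"
    "(\<Sum>s\<in>carrier_vec (n - m). rtr (\<tau> s)) \<le> guess + \<epsilon>"
  using near_optimal_dual[OF success_le_guess ex_near_guess norm_\<Phi>_le assms] unfolding feasible_def by blast

context
  assumes std: "classical_in ket_z n dE \<rho>AE \<or> classical_in ket_x n dB \<rho>AB"
begin

lemma fidelity_sq_le_feasible:
  "normalized dE \<sigma> \<Longrightarrow> feasible \<tau> \<Longrightarrow> (fidelity hashed (uniform \<sigma>))\<^sup>2 \<le> (\<Sum>s\<in>carrier_vec (n - m). rtr (\<tau> s))"
  unfolding feasible_def by (intro fidelity_sq_le[OF std]) auto

lemma fidelity_sq_le_guess: "normalized dE \<sigma> \<Longrightarrow> (fidelity hashed (uniform \<sigma>))\<^sup>2 \<le> guess"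
proof (rule field_le_epsilon)
  fix \<epsilon> :: real assume \<sigma>: "normalized dE \<sigma>" and "0 < \<epsilon>"
  then obtain \<tau> where "feasible \<tau>" "(\<Sum>s\<in>carrier_vec (n - m). rtr (\<tau> s)) \<le> guess + \<epsilon>"
    using ex_feasible by blast
  with fidelity_sq_le_feasible[OF \<sigma>] show "(fidelity hashed (uniform \<sigma>))\<^sup>2 \<le> guess + \<epsilon>"
    by (meson order_trans)
qed

text \<open>Weak duality is obtained by way of the fidelity. Zero success is treated apart because
  \<open>success_le_fidelity\<close> normalizes by the success probability.\<close>

lemma guess_le_feasible: "feasible \<tau> \<Longrightarrow> guess \<le> (\<Sum>s\<in>carrier_vec (n - m). rtr (\<tau> s))"
proof (rule guess_least)
  fix M assume \<tau>: "feasible \<tau>" and M: "povm_op M"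
  show "success M \<le> (\<Sum>s\<in>carrier_vec (n - m). rtr (\<tau> s))"
  proof (cases "0 < success M")
    case True
    then show ?thesis
      using success_le_fidelity[OF M] fidelity_sq_le_feasible[OF _ \<tau>] by (meson order_trans)
  next
    case False
    moreover have "0 \<le> (\<Sum>s\<in>carrier_vec (n - m). rtr (\<tau> s))"
      using \<tau> by (intro sum_nonneg pos_rtr) (auto simp: feasible_def)
    ultimately show ?thesis by simp
  qed
qed

lemma H_max_hash_eq: "H_max_hash n m dE ((*\<^sub>v) f) \<rho>AE = log2_ereal (2 ^ m * guess)"
proof -
  have "(SUP \<sigma>\<in>{\<sigma>. normalized dE \<sigma>}. log2_ereal (2 ^ m * (fidelity hashed (uniform \<sigma>))\<^sup>2)) = log2_ereal (2 ^ m * guess)"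
  proof (rule SUP_log2_ereal)
    fix \<sigma> assume "\<sigma> \<in> {\<sigma>. normalized dE \<sigma>}"
    then show "2 ^ m * (fidelity hashed (uniform \<sigma>))\<^sup>2 \<le> 2 ^ m * guess"
      using fidelity_sq_le_guess by simp
  next
    fix r :: real assume r: "0 < r" "r < 2 ^ m * guess"
    obtain M where M: "povm_op M" "guess - (guess - r / 2 ^ m) < success M"
      using ex_near_guess[of "guess - r / 2 ^ m"] r by (auto simp: field_simps)
    then have "r < 2 ^ m * success M" "0 < success M"
      using r(1) by (auto simp: field_simps intro: order_less_trans[of 0 "r / 2 ^ m"])
    then obtain \<sigma> where \<sigma>: "normalized dE \<sigma>" "success M \<le> (fidelity hashed (uniform \<sigma>))\<^sup>2"
      using success_le_fidelity[OF M(1)] by blast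
    have "r < 2 ^ m * (fidelity hashed (uniform \<sigma>))\<^sup>2"
      by (rule order_less_le_trans[OF \<open>r < 2 ^ m * success M\<close> mult_left_mono[OF \<sigma>(2)]]) simp
    with \<sigma>(1) show "\<exists>\<sigma>\<in>{\<sigma>. normalized dE \<sigma>}. r < 2 ^ m * (fidelity hashed (uniform \<sigma>))\<^sup>2"
      by blast
  qed
  then show ?thesis
    by (simp add: H_max_hash_def H_max_def hashed_def uniform_def)
qed

section \<open>Min-entropy of the syndrome state\<close>

abbreviation "d' \<equiv> dB * 2 ^ (n - m)"

lemma op_of_syndrome:
  "op_of (syndrome_state n (n - m) dB ((*\<^sub>v) g) \<rho>AB)
    = (\<Sum>x\<in>carrier_vec n. Vx d' x * (Wz dB (g *\<^sub>v x) * (\<Phi> x * adj (\<Phi> x)) * adj (Wz dB (g *\<^sub>v x))) * adj (Vx d' x))"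
proof -
  have dims: "dim_row (ket_proj a) = dim_row a" "dim_col (ket_proj a) = dim_row a" for a by (simp_all add: ket_proj_def)
  have c: "block ket_x dB \<rho>AB x \<in> carrier_mat dB dB" if "x \<in> carrier_vec n" for x
    using that by (intro block_carrier) auto
  have dimg: "dim_vec (g *\<^sub>v x) = n - m" if "x \<in> carrier_vec n" for x
    by (rule carrier_vecD[OF image_carrier(2)[OF that]])
  have c': "kron (block ket_x dB \<rho>AB x) (ket_proj (ket_z (g *\<^sub>v x))) \<in> carrier_mat d' d'" if "x \<in> carrier_vec n" for x
    using c[OF that] dimg[OF that] by (auto simp: dims intro!: carrier_matI)
  show ?thesis
    unfolding syndrome_state_def
  proof (subst op_of_op_sum)
    fix x :: "bit vec" assume x: "x \<in> carrier_vec n"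
    then show "kron (ket_proj (ket_x x)) (kron (block ket_x dB \<rho>AB x) (ket_proj (ket_z (g *\<^sub>v x))))
      \<in> carrier_mat (2 ^ n * d') (2 ^ n * d')"
      using c'[OF x] by (auto simp: dims intro!: carrier_matI)
  next
    show "(\<Sum>x\<in>carrier_vec n. op_of (kron (ket_proj (ket_x x)) (kron (block ket_x dB \<rho>AB x) (ket_proj (ket_z (g *\<^sub>v x))))))
      = (\<Sum>x\<in>carrier_vec n. Vx d' x * (Wz dB (g *\<^sub>v x) * (\<Phi> x * adj (\<Phi> x)) * adj (Wz dB (g *\<^sub>v x))) * adj (Vx d' x))"
    proof (intro sum.cong refl)
      fix x :: "bit vec" assume x: "x \<in> carrier_vec n"
      show "op_of (kron (ket_proj (ket_x x)) (kron (block ket_x dB \<rho>AB x) (ket_proj (ket_z (g *\<^sub>v x)))))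
        = Vx d' x * (Wz dB (g *\<^sub>v x) * (\<Phi> x * adj (\<Phi> x)) * adj (Wz dB (g *\<^sub>v x))) * adj (Vx d' x)"
        using op_of_kron_ket_proj_left[OF _ c'[OF x], of "ket_x x"] op_of_kron_ket_proj_right[OF _ c[OF x], of "ket_z (g *\<^sub>v x)"]
        by (simp add: Vx_def Wz_def op_of_block_x[OF x])
    qed
  qed
qed

definition syndrome_bounds :: "complex mat set" where
  "syndrome_bounds = {\<sigma>. psd d' \<sigma> \<and> loewner_le (2 ^ n * d')
     (syndrome_state n (n - m) dB ((*\<^sub>v) g) \<rho>AB) (kron (1\<^sub>m (2 ^ n)) \<sigma>)}"

text \<open>Both sides of the operator inequality are block diagonal in the x basis, so their
  difference can be written through its blocks.\<close>

lemma syndrome_bounds_iff: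
  assumes \<sigma>: "\<sigma> \<in> carrier_mat d' d'"
  shows "\<sigma> \<in> syndrome_bounds \<longleftrightarrow> psd d' \<sigma> \<and> pos (\<Sum>x\<in>carrier_vec n.
    Vx d' x * (op_of \<sigma> - Wz dB (g *\<^sub>v x) * (\<Phi> x * adj (\<Phi> x)) * adj (Wz dB (g *\<^sub>v x))) * adj (Vx d' x))"
proof -
  let ?\<rho> = "syndrome_state n (n - m) dB ((*\<^sub>v) g) \<rho>AB"
  have c: "?\<rho> \<in> carrier_mat (2 ^ n * d') (2 ^ n * d')" by (simp add: syndrome_state_def op_sum_def)
  have k: "kron (1\<^sub>m (2 ^ n)) \<sigma> \<in> carrier_mat (2 ^ n * d') (2 ^ n * d')" using \<sigma> by (auto intro!: carrier_matI)
  have "op_of (kron (1\<^sub>m (2 ^ n)) \<sigma> - ?\<rho>) = op_of (kron (1\<^sub>m (2 ^ n)) \<sigma>) - op_of ?\<rho>"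
    using carrier_matD[OF c] carrier_matD[OF k] by (intro op_of_minus) simp_all
  also have "\<dots> = (\<Sum>x\<in>carrier_vec n.
    Vx d' x * (op_of \<sigma> - Wz dB (g *\<^sub>v x) * (\<Phi> x * adj (\<Phi> x)) * adj (Wz dB (g *\<^sub>v x))) * adj (Vx d' x))"
    unfolding op_of_kron_one_Vx[OF \<sigma>] op_of_syndrome
    by (simp add: right_diff_distrib left_diff_distrib sum_subtractf)
  finally have eq: "op_of (kron (1\<^sub>m (2 ^ n)) \<sigma> - ?\<rho>) = \<dots>" .
  have "kron (1\<^sub>m (2 ^ n)) \<sigma> - ?\<rho> \<in> carrier_mat (2 ^ n * d') (2 ^ n * d')" by (rule minus_carrier_mat[OF c])
  then show ?thesis
    using c k pos_op_of_iff unfolding syndrome_bounds_def loewner_le_def eq[symmetric] by blast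
qed

text \<open>Compressing \<open>\<sigma>\<close> by the ket of each syndrome yields a feasible
  family, and completeness of these kets makes the traces add up to that of
  \<open>\<sigma>\<close>.\<close>

lemma syndrome_bound_feasible:
  assumes \<sigma>: "\<sigma> \<in> syndrome_bounds"
  shows "guess \<le> Re (op_trace \<sigma>)"
proof -
  have psd: "psd d' \<sigma>" using \<sigma> by (simp add: syndrome_bounds_def)
  then have c: "\<sigma> \<in> carrier_mat d' d'" by (simp add: psd_def)
  let ?R = "\<lambda>x. op_of \<sigma> - Wz dB (g *\<^sub>v x) * (\<Phi> x * adj (\<Phi> x)) * adj (Wz dB (g *\<^sub>v x))"
  have pos: "pos (\<Sum>x\<in>carrier_vec n. Vx d' x * ?R x * adj (Vx d' x))"
    using \<sigma> syndrome_bounds_iff[OF c] by simp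
  define \<tau> where "\<tau> s = adj (Wz dB s) * op_of \<sigma> * Wz dB s" for s
  have "feasible \<tau>"
    unfolding feasible_def
  proof (intro conjI ballI)
    fix s :: "bit vec" show "pos (\<tau> s)" unfolding \<tau>_def by (rule pos_conj[OF pos_op_of[OF psd]])
  next
    fix x :: "bit vec" assume x: "x \<in> carrier_vec n"
    have gx: "g *\<^sub>v x \<in> carrier_vec (n - m)" using x by simp
    have fW: "fid d' * Wz dB (g *\<^sub>v x) = Wz dB (g *\<^sub>v x)" by (rule fid_mult_Wz[OF gx])
    have Wf: "adj (Wz dB (g *\<^sub>v x)) * fid d' = adj (Wz dB (g *\<^sub>v x))" using arg_cong[OF fW, of adj] by simp
    have WW: "adj (Wz dB (g *\<^sub>v x)) * Wz dB (g *\<^sub>v x) = fid dB" using Wz_orth[OF gx gx] by simp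
    have "fid d' * op_of \<sigma> * fid d' = op_of \<sigma>" using c by (simp add: fid_mult_op_of op_of_mult_fid)
    moreover have "fid d' * (Wz dB (g *\<^sub>v x) * (\<Phi> x * adj (\<Phi> x)) * adj (Wz dB (g *\<^sub>v x))) * fid d'
      = Wz dB (g *\<^sub>v x) * (\<Phi> x * adj (\<Phi> x)) * adj (Wz dB (g *\<^sub>v x))"
      by (metis Wf fW mult.assoc)
    ultimately have "fid d' * ?R x * fid d' = ?R x" by (simp add: right_diff_distrib left_diff_distrib)
    from conj_Vx_sum[where R = ?R, OF x this] pos_conj[OF pos, of "Vx d' x"] have "pos (?R x)" by simp
    then have "pos (adj (Wz dB (g *\<^sub>v x)) * ?R x * Wz dB (g *\<^sub>v x))" by (rule pos_conj)
    also have "adj (Wz dB (g *\<^sub>v x)) * ?R x * Wz dB (g *\<^sub>v x)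
      = \<tau> (g *\<^sub>v x) - (adj (Wz dB (g *\<^sub>v x)) * Wz dB (g *\<^sub>v x)) * (\<Phi> x * adj (\<Phi> x)) * (adj (Wz dB (g *\<^sub>v x)) * Wz dB (g *\<^sub>v x))"
      by (simp add: \<tau>_def right_diff_distrib left_diff_distrib mult.assoc)
    also have "\<dots> = \<tau> (g *\<^sub>v x) - \<Phi> x * adj (\<Phi> x)"
    proof -
      have "adj (\<Phi> x) * fid dB = adj (\<Phi> x)" using arg_cong[OF \<Phi>_left[OF x], of adj] by simp
      then have "fid dB * (\<Phi> x * adj (\<Phi> x)) * fid dB = \<Phi> x * adj (\<Phi> x)" by (metis \<Phi>_left[OF x] mult.assoc)
      then show ?thesis by (simp add: WW)
    qed
    finally show "pos (\<tau> (g *\<^sub>v x) - \<Phi> x * adj (\<Phi> x))" .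
  qed
  then have "guess \<le> (\<Sum>s\<in>carrier_vec (n - m). rtr (\<tau> s))" by (rule guess_le_feasible)
  also have "\<dots> = rtr (op_of \<sigma>)"
    unfolding \<tau>_def using c by (intro rtr_compression[OF Wz_complete] op_of_mult_fid) auto
  also have "\<dots> = Re (op_trace \<sigma>)" using c by (simp add: rtr_op_of)
  finally show ?thesis .
qed

text \<open>Conversely, a feasible family is assembled into a block diagonal operator. For a given
  \<open>x\<close>, the blocks of the other syndromes are a positive surplus.\<close>

lemma ex_syndrome_bound:
  assumes "0 < \<epsilon>"
  shows "\<exists>\<sigma>\<in>syndrome_bounds. Re (op_trace \<sigma>) \<le> guess + \<epsilon>"
proof -
  obtain \<tau> where \<tau>: "feasible \<tau>" "\<And>s. s \<in> carrier_vec (n - m) \<Longrightarrow> fid dB * \<tau> s = \<tau> s"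
    "(\<Sum>s\<in>carrier_vec (n - m). rtr (\<tau> s)) \<le> guess + \<epsilon>"
    using ex_feasible[OF assms] by blast
  have pos_conj': "pos A \<Longrightarrow> pos (V * A * adj V)" for A V using pos_conj[of A "adj V"] by simp
  define S where "S = (\<Sum>s\<in>carrier_vec (n - m). Wz dB s * \<tau> s * adj (Wz dB s))"
  have posS: "pos S" unfolding S_def using \<tau>(1) by (intro pos_sum pos_conj') (simp add: feasible_def)
  have fS: "fid d' * S = S" unfolding S_def sum_distrib_left
    by (intro sum.cong refl) (simp add: fid_mult_Wz flip: mult.assoc)
  have Sf: "S * fid d' = S" using arg_cong[OF fS, of adj] pos_adj[OF posS] by simp
  define \<sigma> where "\<sigma> = mat_of d' d' S"
  have op\<sigma>: "op_of \<sigma> = S" by (simp add: \<sigma>_def op_of_mat_of fS Sf)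
  have c: "\<sigma> \<in> carrier_mat d' d'" by (simp add: \<sigma>_def)
  have psd: "psd d' \<sigma>" using pos_op_of_iff[OF c] posS op\<sigma> by simp
  have "pos (S - Wz dB (g *\<^sub>v x) * (\<Phi> x * adj (\<Phi> x)) * adj (Wz dB (g *\<^sub>v x)))" if x: "x \<in> carrier_vec n" for x
  proof -
    let ?s = "g *\<^sub>v x"
    have "S = Wz dB ?s * \<tau> ?s * adj (Wz dB ?s) + (\<Sum>s\<in>carrier_vec (n - m) - {?s}. Wz dB s * \<tau> s * adj (Wz dB s))"
      unfolding S_def using x by (intro sum.remove) auto
    then have "S - Wz dB ?s * (\<Phi> x * adj (\<Phi> x)) * adj (Wz dB ?s)
      = Wz dB ?s * (\<tau> ?s - \<Phi> x * adj (\<Phi> x)) * adj (Wz dB ?s)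
        + (\<Sum>s\<in>carrier_vec (n - m) - {?s}. Wz dB s * \<tau> s * adj (Wz dB s))"
      by (simp add: right_diff_distrib left_diff_distrib)
    also have "pos \<dots>"
      using \<tau>(1) x by (intro pos_add pos_sum pos_conj') (auto simp: feasible_def)
    finally show ?thesis .
  qed
  then have "pos (\<Sum>x\<in>carrier_vec n.
    Vx d' x * (op_of \<sigma> - Wz dB (g *\<^sub>v x) * (\<Phi> x * adj (\<Phi> x)) * adj (Wz dB (g *\<^sub>v x))) * adj (Vx d' x))"
    unfolding op\<sigma> by (intro pos_sum pos_conj')
  then have "\<sigma> \<in> syndrome_bounds" using syndrome_bounds_iff[OF c] psd by simp
  moreover have "Re (op_trace \<sigma>) = (\<Sum>s\<in>carrier_vec (n - m). rtr (\<tau> s))"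
  proof -
    have "rtr (Wz dB s * \<tau> s * adj (Wz dB s)) = rtr (\<tau> s)" if s: "s \<in> carrier_vec (n - m)" for s
    proof -
      have "rtr (Wz dB s * \<tau> s * adj (Wz dB s)) = rtr (adj (Wz dB s) * Wz dB s * \<tau> s)"
        by (metis mult.assoc rtr_comm)
      then show ?thesis using Wz_orth[OF s s] \<tau>(2)[OF s] by simp
    qed
    then have "rtr S = (\<Sum>s\<in>carrier_vec (n - m). rtr (\<tau> s))" by (simp add: S_def rtr_sum)
    then show ?thesis using c by (simp flip: op\<sigma> add: rtr_op_of)
  qed
  ultimately show ?thesis using \<tau>(3) by (intro bexI[of _ \<sigma>]) simp_all
qed

lemma exp2_H_min_syndrome: "exp2_ereal (- H_min_syndrome n (n - m) dB ((*\<^sub>v) g) \<rho>AB) = guess"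
proof -
  have set: "{Re (op_trace \<sigma>) |\<sigma>. psd d' \<sigma> \<and> loewner_le (2 ^ n * d')
     (syndrome_state n (n - m) dB ((*\<^sub>v) g) \<rho>AB) (kron (1\<^sub>m (2 ^ n)) \<sigma>)} = (\<lambda>\<sigma>. Re (op_trace \<sigma>)) ` syndrome_bounds"
    by (auto simp: syndrome_bounds_def)
  have "Inf ((\<lambda>\<sigma>. Re (op_trace \<sigma>)) ` syndrome_bounds) = guess"
  proof (rule cInf_eq)
    fix y assume "y \<in> (\<lambda>\<sigma>. Re (op_trace \<sigma>)) ` syndrome_bounds"
    then show "guess \<le> y" using syndrome_bound_feasible by auto
  next
    fix y assume lower: "\<And>v. v \<in> (\<lambda>\<sigma>. Re (op_trace \<sigma>)) ` syndrome_bounds \<Longrightarrow> y \<le> v"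
    show "y \<le> guess"
    proof (rule field_le_epsilon)
      fix \<epsilon> :: real assume "0 < \<epsilon>"
      then obtain \<sigma> where "\<sigma> \<in> syndrome_bounds" "Re (op_trace \<sigma>) \<le> guess + \<epsilon>" using ex_syndrome_bound by blast
      with lower show "y \<le> guess + \<epsilon>" by force
    qed
  qed
  then show ?thesis
    unfolding H_min_syndrome_def H_min_def set using exp2_log2_ereal[OF guess_nonneg] by simp
qed

lemma exp2_H_max_hash: "exp2_ereal (H_max_hash n m dE ((*\<^sub>v) f) \<rho>AE - ereal (real m)) = guess"
  unfolding H_max_hash_eq by (rule exp2_log2_ereal_diff[OF guess_nonneg])

text \<open>Measuring changes neither the diagonal blocks nor the trace, so the index can be
  evaluated on the unmeasured state.\<close>

lemma Q_PA_eq: "Q_PA n m dE ((*\<^sub>v) f) \<rho>ZE = Re (op_trace \<rho>) - guess"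
proof -
  have "hashed_state n m dE ((*\<^sub>v) f) \<rho>ZE = hashed_state n m dE ((*\<^sub>v) f) \<rho>AE"
  proof -
    have "op_sum dE dE (block ket_z dE \<rho>ZE) {z \<in> carrier_vec n. f *\<^sub>v z = k}
      = op_sum dE dE (block ket_z dE \<rho>AE) {z \<in> carrier_vec n. f *\<^sub>v z = k}" for k
      unfolding op_sum_def using block_measured(1)[OF ptrace_carrier(1)]
      by (intro arg_cong[where f = "mat dE dE"] ext sum.cong) auto
    then show ?thesis by (simp add: hashed_state_def)
  qed
  moreover have "Re (op_trace \<rho>ZE) = Re (op_trace \<rho>)"
    using rtr_measured_z[OF ptrace_carrier(1)] \<rho> carrier_matD[OF measured_carrier[of ket_z n dE \<rho>AE]]
    by (simp add: rtr_\<rho>AE rtr_op_of)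
  ultimately show ?thesis
    using exp2_H_max_hash by (simp add: Q_PA_def H_max_hash_def)
qed

end

end

section \<open>Reduction of random functions to a single dual pair\<close>

lemma standard_form_pure_state:
  assumes "standard_form n dB dE \<rho>"
  shows "\<exists>\<psi>. pure_state n dB dE \<rho> \<psi>"
proof -
  have psd: "psd (2 ^ n * dB * dE) \<rho>" and tr: "Re (op_trace \<rho>) \<le> 1"
    and rank: "vec_space.rank (2 ^ n * dB * dE) \<rho> = 1"
    using assms by (auto simp: standard_form_def sub_normalized_def)
  then have c: "\<rho> \<in> carrier_mat (2 ^ n * dB * dE) (2 ^ n * dB * dE)" by (simp add: psd_def)
  obtain \<psi> where "\<forall>i<2 ^ n * dB * dE. \<forall>j<2 ^ n * dB * dE. \<rho> $$ (i, j) = \<psi> i * cnj (\<psi> j)"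
    using psd_rank_one[OF psd rank] by blast
  then have "pure_state n dB dE \<rho> \<psi>" using c tr by unfold_locales auto
  then show ?thesis by blast
qed

text \<open>One witness, the guessing probability, serves all five quantities, so the passage to
  random functions is just linearity of expectation.\<close>

lemma dual_pair_indices:
  assumes "m \<le> n" "dual_functions n m f g" "standard_form n dB dE \<rho>"
  shows "\<exists>b. Q_PA n m dE ((*\<^sub>v) f) (measured ket_z n dE (ptrace_B (2 ^ n) dB dE \<rho>)) = Re (op_trace \<rho>) - b \<and>
    Q_EC n (n - m) dB ((*\<^sub>v) g) (measured ket_x n dB (ptrace_E (2 ^ n) dB dE \<rho>)) = Re (op_trace \<rho>) - b \<and>
    Q_DC n (n - m) dB ((*\<^sub>v) g) (measured ket_x n dB (ptrace_E (2 ^ n) dB dE \<rho>)) = Re (op_trace \<rho>) - b \<and>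
    exp2_ereal (H_max_hash n m dE ((*\<^sub>v) f) (ptrace_B (2 ^ n) dB dE \<rho>) - ereal (real m)) = b \<and>
    exp2_ereal (- H_min_syndrome n (n - m) dB ((*\<^sub>v) g) (ptrace_E (2 ^ n) dB dE \<rho>)) = b"
proof -
  obtain \<psi> where "pure_state n dB dE \<rho> \<psi>" using standard_form_pure_state[OF assms(3)] by blast
  then interpret pure_state n dB dE \<rho> \<psi> .
  interpret dual_pure_state n dB dE \<rho> \<psi> m f g by unfold_locales (use assms in auto)
  have std: "classical_in ket_z n dE \<rho>AE \<or> classical_in ket_x n dB \<rho>AB"
    using assms(3) by (simp add: standard_form_def)
  show ?thesis
    using Q_PA_eq[OF std] Q_DC_eq Q_EC_eq_Q_DC exp2_H_max_hash[OF std] exp2_H_min_syndrome[OF std]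
    by auto
qed

text \<open>Injectivity turns expectations into sums over indices; a dual pair then gives both
  expectations the same weights, index by index.\<close>

lemma expectation_indexed:
  fixes r :: "'a \<Rightarrow> real"
  assumes "inj_on h {..<N::nat}" "set_pmf P \<subseteq> h ` {..<N}"
  shows "measure_pmf.expectation P r = (\<Sum>i<N. r (h i) * pmf P (h i))"
proof -
  have "measure_pmf.expectation P r = (\<Sum>a\<in>h ` {..<N}. r a * pmf P a)"
    by (rule integral_measure_pmf_real) (use assms(2) in auto)
  also have "\<dots> = (\<Sum>i<N. r (h i) * pmf P (h i))" by (simp add: sum.reindex[OF assms(1)])
  finally show ?thesis .
qed

theorem corollary1:
  fixes n m dB dE :: nat
    and F G :: "bit mat pmf"
    and \<rho> :: "complex mat"
  assumes "m \<le> n"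
    and "dual_random_functions n m F G"
    and "standard_form n dB dE \<rho>"
  defines "\<rho>AE \<equiv> ptrace_B (2 ^ n) dB dE \<rho>"
    and "\<rho>AB \<equiv> ptrace_E (2 ^ n) dB dE \<rho>"
  defines "\<rho>ZE \<equiv> measured ket_z n dE \<rho>AE"
    and "\<rho>XB \<equiv> measured ket_x n dB \<rho>AB"
  shows "measure_pmf.expectation F (\<lambda>f. Q_PA n m dE ((*\<^sub>v) f) \<rho>ZE)
     = measure_pmf.expectation G (\<lambda>g. Q_EC n (n - m) dB ((*\<^sub>v) g) \<rho>XB) \<and>
    measure_pmf.expectation G (\<lambda>g. Q_EC n (n - m) dB ((*\<^sub>v) g) \<rho>XB)
     = measure_pmf.expectation G (\<lambda>g. Q_DC n (n - m) dB ((*\<^sub>v) g) \<rho>XB) \<and>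
    measure_pmf.expectation G (\<lambda>g. Q_DC n (n - m) dB ((*\<^sub>v) g) \<rho>XB)
     = Re (op_trace \<rho>) - measure_pmf.expectation F
           (\<lambda>f. exp2_ereal (H_max_hash n m dE ((*\<^sub>v) f) \<rho>AE - ereal (real m))) \<and>
    Re (op_trace \<rho>) - measure_pmf.expectation F
           (\<lambda>f. exp2_ereal (H_max_hash n m dE ((*\<^sub>v) f) \<rho>AE - ereal (real m)))
     = Re (op_trace \<rho>) - measure_pmf.expectation G
           (\<lambda>g. exp2_ereal (- H_min_syndrome n (n - m) dB ((*\<^sub>v) g) \<rho>AB))"
proof -
  obtain N f g where inj: "inj_on f {..<N::nat}" "inj_on g {..<N}"
    and supp: "set_pmf F \<subseteq> f ` {..<N}" "set_pmf G \<subseteq> g ` {..<N}"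
    and fg: "\<And>i. i < N \<Longrightarrow> dual_functions n m (f i) (g i)" "\<And>i. i < N \<Longrightarrow> pmf F (f i) = pmf G (g i)"
    using assms(2) unfolding dual_random_functions_def by blast
  define b where "b i = exp2_ereal (- H_min_syndrome n (n - m) dB ((*\<^sub>v) (g i)) \<rho>AB)" for i
  have b: "Q_PA n m dE ((*\<^sub>v) (f i)) \<rho>ZE = Re (op_trace \<rho>) - b i"
    "Q_EC n (n - m) dB ((*\<^sub>v) (g i)) \<rho>XB = Re (op_trace \<rho>) - b i"
    "Q_DC n (n - m) dB ((*\<^sub>v) (g i)) \<rho>XB = Re (op_trace \<rho>) - b i"
    "exp2_ereal (H_max_hash n m dE ((*\<^sub>v) (f i)) \<rho>AE - ereal (real m)) = b i" if "i < N" for i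
    using dual_pair_indices[OF assms(1) fg(1)[OF that] assms(3)]
    unfolding b_def \<rho>AE_def \<rho>AB_def \<rho>ZE_def \<rho>XB_def by auto
  note E = expectation_indexed[OF inj(1) supp(1)] expectation_indexed[OF inj(2) supp(2)]
  \<comment> \<open>Weights of total mass one let the constant trace leave the expectation.\<close>
  have total: "(\<Sum>i<N. pmf G (g i)) = 1"
    using E(2)[of "\<lambda>_. 1"] by simp
  have affine: "(\<Sum>i<N. (Re (op_trace \<rho>) - b i) * pmf G (g i)) = Re (op_trace \<rho>) - (\<Sum>i<N. b i * pmf G (g i))"
    using total by (simp add: left_diff_distrib sum_subtractf flip: sum_distrib_left)
  show ?thesis
    unfolding E by (simp add: b fg(2) affine flip: b_def)
qed

end
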